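(* Let $q$ be an odd prime power, $g\geq 1$ and $n\geq 1$. Then, with $\eta_n=1$ for $n$ even and $\eta_n=0$ for $n$ odd, \[ \langle \operatorname{tr}(\Theta_{C_Q}^n)\rangle_{\mathcal{F}_{2g+2}} = -\frac{1}{q^{\frac{n}{2}}}+\eta_n \frac{1}{q^{\frac{n}{2}}}\sum_{\deg(P)\mid\frac{n}{2}} \frac{\deg(P)}{|P|+1} +O(gq^{-\frac{g}{2}})+ \begin{cases} -\eta_n & 0<n< 2g+1,\\ \frac{q^{1/2}}{q-1} & n=2g+1,\\ O(nq^{\frac{n}{2}-2g}) & 2g+1<n, \end{cases} \] where the sum is over monic irreducible $P\in\mathbb{F}_q[x]$ whose degree divides $n/2$.
   Context: $\mathbb{F}_q$ is a finite field with $q$ odd. $\mathcal{F}_{d}$ is the set of monic squarefree polynomials of degree $d$ in $\mathbb{F}_q[x]$, and for a function $F$ on it, $\langle F\rangle_{\mathcal{F}_d}=\frac{1}{\#\mathcal{F}_d}\sum_{Q\in\mathcal{F}_d}F(Q)$. For monic irreducible $P$, $|P|=q^{\deg P}$. For squarefree $Q$, $C_Q$ is the (smooth projective model of the) hyperelliptic curve $y^2=Q(x)$, with Zeta function $\exp(\sum_{m\ge1}\#C_Q(\mathbb{F}_{q^m})u^m/m)=\frac{\prod_{j=1}^{2g}(1-q^{1/2}e^{i\theta_j}u)}{(1-u)(1-qu)}$, and $\Theta_{C_Q}$ is the unitary matrix $\mathrm{diag}(e^{i\theta_1},\dots,e^{i\theta_{2g}})$ (unitarized Frobenius class). Explicitly,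 \[ \operatorname{tr}(\Theta_{C_Q}^n)=-\frac{\lambda_Q^n}{q^{n/2}}-\frac{1}{q^{n/2}}\sum_{\deg f=n}\Lambda(f)\chi_Q(f), \] where the sum is over monic $f$, $\chi_Q(f)=\left(\frac{Q}{f}\right)$ is the quadratic residue (Jacobi) symbol in $\mathbb{F}_q[x]$, $\Lambda(f)=\deg P$ if $f=P^k$ for a monic irreducible $P$ and $0$ otherwise, and $\lambda_Q=0$ if $\deg Q$ is odd, $\lambda_Q=1$ if $\deg Q$ is even and the leading coefficient of $Q$ is a square in $\mathbb{F}_q^*$, $\lambda_Q=-1$ otherwise (so $\lambda_Q=1$ for $Q\in\mathcal{F}_{2g+2}$). *)

theory Defs
  imports
    Complex_Main
    "HOL-Library.Cardinality"
    "HOL-Computational_Algebra.Computational_Algebra"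
    "HOL-Algebra.Algebraic_Closure_Type"
    "Jordan_Normal_Form.Matrix"
begin

text \<open>
  The field with \<open>q\<close> elements is a type \<open>'a :: {field,finite}\<close>, with \<open>q = CARD('a)\<close>.
\<close>

definition monic_squarefree :: "nat \<Rightarrow> 'a::{field,finite} poly set" where
  "monic_squarefree d =
     {Q. Polynomial.degree Q = d \<and> Polynomial.lead_coeff Q = 1 \<and> squarefree Q}"

definition mean_monic_squarefree :: "nat \<Rightarrow> ('a::{field,finite} poly \<Rightarrow> complex) \<Rightarrow> complex" where
  "mean_monic_squarefree d F =
     (\<Sum>Q\<in>monic_squarefree d. F Q) / of_nat (card (monic_squarefree d :: 'a poly set))"

definition monic_irreducible :: "'a::{field,finite} poly \<Rightarrow> bool" where
  "monic_irreducible P \<longleftrightarrow> Polynomial.lead_coeff P = 1 \<and> Factorial_Ring.irreducible P"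

definition poly_abs :: "'a::{field,finite} poly \<Rightarrow> real" where
  "poly_abs P = real CARD('a) ^ Polynomial.degree P"

text \<open>
  The extension of degree \<open>m \<ge> 1\<close> of the base field inside its algebraic closure.
\<close>

definition Fq_ext :: "nat \<Rightarrow> 'a::{field,finite} alg_closure set" where
  "Fq_ext m = {x. x ^ (CARD('a) ^ m) = x}"

text \<open>
  Genus of \<open>y\<^sup>2 = Q(x)\<close>, for \<open>Q\<close> squarefree of degree \<open>2g+1\<close> or \<open>2g+2\<close>.
\<close>

definition hyp_genus :: "'a::{field,finite} poly \<Rightarrow> nat" where
  "hyp_genus Q = (Polynomial.degree Q - 1) div 2"

definition affine_points :: "'a::{field,finite} poly \<Rightarrow> nat \<Rightarrow> ('a alg_closure \<times> 'a alg_closure) set" where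
  "affine_points Q m =
     {(x, y). x \<in> Fq_ext m \<and> y \<in> Fq_ext m \<and> y\<^sup>2 = poly (map_poly to_ac Q) x}"

text \<open>
  The smooth projective model of \<open>y\<^sup>2 = Q(x)\<close> is obtained by gluing the affine curve along
  \<open>u = 1/x\<close>, \<open>v = y/x\<^bsup>g+1\<^esup>\<close> to the chart \<open>v\<^sup>2 = u\<^bsup>2g+2\<^esup> Q(1/u)\<close>. Its points at infinity are
  those with \<open>u = 0\<close> in the second chart, that is \<open>v\<^sup>2 =\<close> the coefficient of \<open>Q\<close> at \<open>2g+2\<close>
  (one point if \<open>deg Q = 2g+1\<close>).
\<close>

definition infinite_points :: "'a::{field,finite} poly \<Rightarrow> nat \<Rightarrow> 'a alg_closure set" where
  "infinite_points Q m =
     {v \<in> Fq_ext m. v\<^sup>2 = to_ac (Polynomial.coeff Q (2 * hyp_genus Q + 2))}"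

definition num_points :: "'a::{field,finite} poly \<Rightarrow> nat \<Rightarrow> nat" where
  "num_points Q m = card (affine_points Q m) + card (infinite_points Q m)"

definition hyp_zeta :: "'a::{field,finite} poly \<Rightarrow> complex fps" where
  "hyp_zeta Q =
     fps_compose (fps_exp 1)
       (Abs_fps (\<lambda>m. if m = 0 then 0 else of_nat (num_points Q m) / of_nat m))"

definition is_unitarized_frobenius :: "'a::{field,finite} poly \<Rightarrow> complex mat \<Rightarrow> bool" where
  "is_unitarized_frobenius Q \<Theta> \<longleftrightarrow>
     (\<exists>\<theta> :: nat \<Rightarrow> real.
        \<Theta> = mat_diag (2 * hyp_genus Q) (\<lambda>j. cis (\<theta> j)) \<and>
        hyp_zeta Q =
          (\<Prod>j<2 * hyp_genus Q.
             1 - fps_const (of_real (sqrt (real CARD('a))) * cis (\<theta> j)) * fps_X) /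
          ((1 - fps_X) * (1 - fps_const (of_nat CARD('a)) * fps_X)))"

text \<open>
  Such a matrix exists by Weil's theorem. The zeta function determines the angles modulo
  \<open>2\<pi>\<close> and up to order, so traces of powers of \<open>\<Theta>\<close> do not depend on the choice.
\<close>

definition Frob_class :: "'a::{field,finite} poly \<Rightarrow> complex mat" where
  "Frob_class Q = (SOME \<Theta>. is_unitarized_frobenius Q \<Theta>)"

definition mat_trace :: "complex mat \<Rightarrow> complex" where
  "mat_trace A = sum_list (diag_mat A)"

definition eta :: "nat \<Rightarrow> real" where
  "eta n = (if even n then 1 else 0)"

end

theory Submission
  imports Defs
begin

text \<open>
  The trace is \<open>-q\<^bsup>-n/2\<^esup>\<close> times one plus the character sum of \<open>\<Lambda>(f) (Q/f)\<close> over \<open>deg f = n\<close>, which we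
  average over squarefree \<open>Q\<close>. Even prime powers \<open>f = P\<^bsup>2k\<^esup>\<close> count the \<open>Q\<close> prime to \<open>P\<close>; they give the
  terms \<open>-\<eta>\<^sub>n\<close> and \<open>deg P / (|P| + 1)\<close>. For odd powers of \<open>P\<close> the average over \<open>Q\<close> is, by sieving out
  squares, a combination of coefficients of the L-function of \<open>(\<sqdot>/P)\<close>, a polynomial of degree less
  than \<open>deg P\<close>. Powers beyond the first contribute little. For \<open>f = P\<close> the vanishing of the high
  coefficients suffices if \<open>n \<le> 2g\<close>; for larger \<open>n\<close> the functional equation moves the sum to low
  degree, where reciprocity and the Riemann hypothesis for the curves \<open>y\<^sup>2 = B(x)\<close> bound the average over \<open>P\<close> unless
  \<open>B\<close> is a square. The squares \<open>B\<close> produce the term at \<open>n = 2g+1\<close> and cancel \<open>-\<eta>\<^sub>n\<close> for \<open>n > 2g+1\<close>.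
\<close>

hide_const (open) UnivPoly.coeff UnivPoly.monom Module.smult

section \<open>Finite fields inside an algebraic closure\<close>

text \<open>\<open>Frob_class\<close> is a choice, so a trace formula presupposes that a unitary
  matrix exists. The bound by sqrt q on the inverse roots does not give that; equality follows once
  the functional equation fixes the modulus of their product. Thus the Riemann hypothesis enters
  twice: here and in the average over \<open>P\<close>. For the latter, the sums over
  \<open>f\<close> and \<open>P\<close> are exchanged, so that every monic nonsquare
  \<open>B\<close> occurs, squarefree or not; the point count is therefore arranged to ask only for
  one root of odd order. Symbols are computed in the algebraic closure. (f/Q) is Euler's power of
  the resultant, which makes reciprocity a sign rule, and for irreducible \<open>P\<close> it is the
  quadratic character of the field with q^(deg P) elements at a root of \<open>P\<close>. Sums over
  prime powers thereby become sums over points. Gauss sums use integer valued kernels, so the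
  functional equations are identities between integers; for irreducible moduli the Gauss sum is
  evaluated, which fixes the sign. The sign matters: the average over \<open>P\<close> has to retain
  the contribution of the squares.\<close>

lemma poly_eq_0_many_roots:
  fixes p :: "'k::idom poly"
  assumes "finite S" "degree p < card S" "\<And>x. x \<in> S \<Longrightarrow> poly p x = 0"
  shows "p = 0"
proof (rule ccontr)
  assume p: "p \<noteq> 0"
  have "card S \<le> card {x. poly p x = 0}"
    by (rule card_mono) (use assms p in \<open>auto simp: poly_roots_finite\<close>)
  also have "\<dots> \<le> degree p"
    using p by (intro card_poly_roots_bound)
  finally show False using assms by simp
qed

lemma proots_factorization:
  fixes p :: "'k::alg_closed_field poly"
  assumes "p \<noteq> 0"
  shows "p = smult (lead_coeff p) (\<Prod>x\<in>#proots p. [:-x, 1:])"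
    and "size (proots p) = degree p"
proof -
  obtain A where A: "size A = degree p" "p = smult (lead_coeff p) (\<Prod>x\<in>#A. [:-x, 1:])"
    using alg_closed_imp_factorization[OF assms] by blast
  have "proots p = proots (\<Prod>x\<in>#A. [:-x, 1:])"
    using assms by (subst A(2)) (simp add: proots_smult del: proots_uminus)
  also have "\<dots> = A"
  proof (induction A)
    case (add x A)
    have "[:-x, 1:] \<noteq> 0" "(\<Prod>x\<in>#A. [:-x, 1:]) \<noteq> 0"
      by auto
    from proots_mult[OF this] add show ?case by simp
  qed simp
  finally show "p = smult (lead_coeff p) (\<Prod>x\<in>#proots p. [:-x, 1:])" "size (proots p) = degree p"
    using A by auto
qed

text \<open>A double root would be a common root of p and its derivative, so all multiplicities are
  one.\<close>

lemma card_roots_separable: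
  fixes p :: "'k::alg_closed_field poly"
  assumes "p \<noteq> 0" "\<And>x. poly p x = 0 \<Longrightarrow> poly (pderiv p) x \<noteq> 0"
  shows "card {x. poly p x = 0} = degree p"
proof -
  have "count (proots p) x \<le> 1" for x
  proof (rule ccontr)
    assume "\<not> count (proots p) x \<le> 1"
    hence "order x p \<ge> 2" using assms by simp
    hence "[:-x, 1:] ^ 2 dvd p"
      using order_1 power_le_dvd by blast
    then obtain r where r: "p = [:-x, 1:] ^ 2 * r" by (elim dvdE)
    have "poly p x = 0" "poly (pderiv p) x = 0"
      by (simp_all add: r pderiv_mult pderiv_power_Suc numeral_2_eq_2 del: mult_pCons_left power_Suc)
    with assms show False by blast
  qed
  hence "proots p = mset_set (set_mset (proots p))"
    by (intro multiset_eqI) (metis count_mset_set(1,3) finite_set_mset le_antisym less_one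
        not_in_iff not_less_iff_gr_or_eq not_le_imp_less)
  hence "size (proots p) = card (set_mset (proots p))"
    by (metis size_mset_set)
  thus ?thesis
    using assms proots_factorization(2)[of p] by simp
qed

text \<open>Translation by 1 permutes the field, so the sum of all elements is unchanged when
  \<open>CARD('a)\<close> copies of 1 are added.\<close>

lemma of_nat_card_field: "of_nat CARD('a::{field,finite}) = (0::'a)"
proof -
  have "(\<Sum>x\<in>(UNIV::'a set). x) = (\<Sum>x\<in>(UNIV::'a set). x + 1)"
    by (rule sum.reindex_bij_witness[of _ "\<lambda>x. x + 1" "\<lambda>x. x - 1"]) auto
  thus ?thesis by (simp add: sum.distrib)
qed

lemma two_neq_0_field:
  assumes "odd CARD('a::{field,finite})"
  shows "(2::'a) \<noteq> 0"
proof
  assume "(2::'a) = 0"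
  obtain k where "CARD('a) = 2 * k + 1" using assms by (elim oddE)
  hence "of_nat CARD('a) = (2 * of_nat k + 1 :: 'a)" by simp
  thus False using of_nat_card_field[where ?'a = 'a] \<open>2 = 0\<close> by simp
qed

lemma card_field_gt_1: "CARD('a::{field,finite}) > 1"
  using card_mono[of "UNIV::'a set" "{0, 1}"] by simp

text \<open>Multiplication by a nonzero x permutes the nonzero elements, so their product absorbs a
  factor x^(q - 1).\<close>

lemma power_card_field: "(x::'a::{field,finite}) ^ CARD('a) = x"
proof (cases "x = 0")
  case False
  let ?S = "UNIV - {0::'a}"
  have "(\<Prod>y\<in>?S. y) = (\<Prod>y\<in>?S. x * y)"
    by (rule prod.reindex_bij_witness[of _ "\<lambda>y. x * y" "\<lambda>y. y / x"]) (use False in auto)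
  also have "\<dots> = x ^ card ?S * (\<Prod>y\<in>?S. y)" by (simp add: prod.distrib)
  finally have "x ^ card ?S = 1" by simp
  hence "x ^ Suc (card ?S) = x" by (simp only: power_Suc) simp
  moreover have "Suc (card ?S) = CARD('a)"
    by (rule card_Suc_Diff1) auto
  ultimately show ?thesis by metis
next
  case True
  then show ?thesis using card_field_gt_1[where ?'a='a] by (simp add: power_0_left)
qed

text \<open>As a polynomial in z, (z + y)^q - z^q - y^q has degree below q, so q zeros make it
  vanish. For y in the base field the zeros are the base field itself, where the q-th power is the
  identity. That settles all z and hence, with the roles exchanged, supplies q zeros for arbitrary
  y.\<close>

lemma power_card_additive:
  fixes x y :: "'a::{field,finite} alg_closure"
  shows "(x + y) ^ CARD('a) = x ^ CARD('a) + y ^ CARD('a)"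
proof -
  let ?q = "CARD('a)" and ?R = "range (to_ac :: 'a \<Rightarrow> _)"
  have q: "?q > 1" by (rule card_field_gt_1)
  have cR: "card ?R = ?q" by (simp add: card_image inj_to_ac)
  define D :: "'a alg_closure \<Rightarrow> 'a alg_closure poly"
    where "D = (\<lambda>y. [:y, 1:] ^ ?q - monom 1 ?q - [:y ^ ?q:])"
  have polyD: "poly (D y) z = (z + y) ^ ?q - z ^ ?q - y ^ ?q" for y z
    by (simp add: D_def poly_monom algebra_simps)
  have degD: "degree (D y) < ?q" for y
  proof -
    have "degree (D y) \<le> ?q"
      unfolding D_def
      by (intro degree_diff_le) (auto simp: degree_power_eq degree_monom_eq)
    moreover have "coeff (D y) ?q = 0"
    proof -
      have "coeff ([:y, 1:] ^ ?q) ?q = 1"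
        using lead_coeff_power[of "[:y, 1:]" ?q] by (simp add: degree_power_eq)
      thus ?thesis using q by (simp add: D_def coeff_pCons split: nat.splits)
    qed
    moreover have "coeff (D y) ?q \<noteq> 0" if "degree (D y) = ?q"
      using that q leading_coeff_neq_0[of "D y"] by fastforce
    ultimately show ?thesis by fastforce
  qed
  have *: "(a + b) ^ ?q = a ^ ?q + b ^ ?q" if "a \<in> ?R" "b \<in> ?R" for a b
    using that by (auto simp: power_card_field simp flip: to_ac_power to_ac_add)
  have "D a = 0" if "a \<in> ?R" for a
    by (rule poly_eq_0_many_roots[of ?R]) (use cR degD * that in \<open>auto simp: polyD\<close>)
  hence **: "(z + a) ^ ?q = z ^ ?q + a ^ ?q" if "a \<in> ?R" for a z
    using polyD[of a z] that by (simp add: algebra_simps)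
  have "D y = 0"
    by (rule poly_eq_0_many_roots[of ?R])
       (use cR degD ** in \<open>auto simp: polyD add.commute[of _ y]\<close>)
  thus ?thesis using polyD[of y x] by (simp add: algebra_simps)
qed

abbreviation frobpow :: "nat \<Rightarrow> 'a::{field,finite} alg_closure \<Rightarrow> 'a alg_closure" where
  "frobpow n x \<equiv> x ^ (CARD('a) ^ n)"

lemma frobpow_add:
  fixes x y :: "'a::{field,finite} alg_closure"
  shows "frobpow n (x + y) = frobpow n x + frobpow n y"
  by (induction n arbitrary: x y) (simp_all add: power_card_additive power_mult)

lemma frobpow_0 [simp]: "frobpow n (0::'a::{field,finite} alg_closure) = 0"
  using card_field_gt_1[where ?'a='a] by (simp add: power_0_left)

lemma frobpow_uminus:
  fixes x :: "'a::{field,finite} alg_closure"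
  shows "frobpow n (- x) = - frobpow n x"
  using frobpow_add[of x "-x" n] by (simp add: add_eq_0_iff2)

lemma frobpow_diff:
  fixes x y :: "'a::{field,finite} alg_closure"
  shows "frobpow n (x - y) = frobpow n x - frobpow n y"
  using frobpow_add[of x "-y" n] by (simp add: frobpow_uminus)

lemma frobpow_sum:
  fixes f :: "'b \<Rightarrow> 'a::{field,finite} alg_closure"
  shows "frobpow n (\<Sum>i\<in>A. f i) = (\<Sum>i\<in>A. frobpow n (f i))"
  by (induction A rule: infinite_finite_induct) (simp_all add: frobpow_add)

lemma frobpow_eq_iff [simp]:
  fixes x y :: "'a::{field,finite} alg_closure"
  shows "frobpow n x = frobpow n y \<longleftrightarrow> x = y"
  using frobpow_diff[of x y n] by auto

lemma frobpow_frobpow: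
  fixes x :: "'a::{field,finite} alg_closure"
  shows "frobpow m (frobpow n x) = frobpow (n + m) x"
  by (simp add: power_add flip: power_mult)

lemma frobpow_to_ac [simp]: "frobpow n (to_ac (a::'a::{field,finite})) = to_ac a"
  by (induction n) (simp_all add: power_mult power_card_field flip: to_ac_power)

text \<open>X^q - X has at most q roots, and the base field already supplies q of them.\<close>

lemma in_range_to_ac_iff:
  fixes x :: "'a::{field,finite} alg_closure"
  shows "x \<in> range to_ac \<longleftrightarrow> x ^ CARD('a) = x"
proof
  assume "x ^ CARD('a) = x"
  let ?q = "CARD('a)"
  define p :: "'a alg_closure poly" where "p = monom 1 ?q - [:0, 1:]"
  have q: "?q > 1" by (rule card_field_gt_1)
  show "x \<in> range to_ac"
  proof (rule ccontr)
    assume "x \<notin> range to_ac"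
    hence "card (insert x (range (to_ac :: 'a \<Rightarrow> _))) = Suc ?q"
      by (simp add: card_image inj_to_ac)
    moreover have "degree p \<le> ?q"
      unfolding p_def using q by (intro degree_diff_le) (auto simp: degree_monom_eq)
    moreover have "poly p y = 0" if "y \<in> insert x (range (to_ac :: 'a \<Rightarrow> _))" for y
      using that \<open>x ^ CARD('a) = x\<close> frobpow_to_ac[where n=1 and ?'a='a]
      by (auto simp: p_def poly_monom)
    ultimately have "p = 0"
      by (intro poly_eq_0_many_roots[of "insert x (range to_ac)"]) auto
    hence "coeff p ?q = 0" by simp
    thus False using q by (simp add: p_def coeff_pCons split: nat.splits)
  qed
qed (use frobpow_to_ac[where n=1 and ?'a='a] in auto)

lemma Fq_ext_iff: "x \<in> Fq_ext n \<longleftrightarrow> frobpow n x = x"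
  by (simp add: Fq_ext_def)

lemma Fq_ext_closed:
  assumes "x \<in> Fq_ext n" "y \<in> Fq_ext n"
  shows "x + y \<in> Fq_ext n" "x - y \<in> Fq_ext n" "x * y \<in> Fq_ext n" "x / y \<in> Fq_ext n" "-x \<in> Fq_ext n"
  using assms by (auto simp: Fq_ext_iff frobpow_add frobpow_diff frobpow_uminus power_mult_distrib power_divide)

lemma Fq_ext_0_1 [simp]: "0 \<in> Fq_ext n" "1 \<in> Fq_ext n" "to_ac a \<in> Fq_ext n"
  by (auto simp: Fq_ext_iff)

text \<open>The derivative of X^(q^n) - X is -1, so its roots are simple and their number is the
  degree.\<close>

lemma
  assumes "n > 0"
  shows finite_Fq_ext: "finite (Fq_ext n :: 'a::{field,finite} alg_closure set)"
    and card_Fq_ext: "card (Fq_ext n :: 'a alg_closure set) = CARD('a) ^ n"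
proof -
  let ?r = "CARD('a) ^ n"
  define p :: "'a alg_closure poly" where "p = monom 1 ?r - [:0, 1:]"
  have r: "?r > 1" using assms by (intro one_less_power card_field_gt_1)
  have d: "degree p = ?r"
    unfolding p_def diff_conv_add_uminus
    using r by (subst degree_add_eq_left) (auto simp: degree_monom_eq)
  hence p0: "p \<noteq> 0" using r by auto
  have eq: "Fq_ext n = {x. poly p x = 0}"
    by (auto simp: Fq_ext_def p_def poly_monom)
  show "finite (Fq_ext n :: 'a alg_closure set)"
    unfolding eq using p0 by (rule poly_roots_finite)
  have "of_nat ?r = (0 :: 'a alg_closure)"
    using of_nat_card_field[where ?'a='a] assms
    by (metis of_nat_power power_0_left not_gr_zero to_ac_0 to_ac_of_nat)
  hence "pderiv p = -1"
    by (simp add: p_def pderiv_diff pderiv_monom pderiv_pCons one_pCons del: of_nat_power)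
  thus "card (Fq_ext n :: 'a alg_closure set) = ?r"
    unfolding eq d[symmetric] using p0 by (intro card_roots_separable) auto
qed

lemma poly_to_ac_frobpow:
  fixes Q :: "'a::{field,finite} poly"
  shows "poly (map_poly to_ac Q) (frobpow n x) = frobpow n (poly (map_poly to_ac Q) x)"
  by (simp add: poly_altdef frobpow_sum power_mult_distrib coeff_map_poly flip: power_mult)
     (simp add: mult.commute)

lemma Fq_ext_poly:
  fixes Q :: "'a::{field,finite} poly"
  assumes "x \<in> Fq_ext n"
  shows "poly (map_poly to_ac Q) x \<in> Fq_ext n"
  using assms poly_to_ac_frobpow[where Q=Q and n=n and x=x] by (simp add: Fq_ext_iff)

section \<open>Polynomials over a finite field\<close>

lemma map_poly_add_hom:
  assumes "h 0 = 0" "\<And>x y. h (x + y) = h x + h y"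
  shows "map_poly h (p + q) = map_poly h p + map_poly h q"
  by (rule poly_eqI) (simp add: coeff_map_poly assms)

lemma map_poly_mult_hom:
  assumes h: "h 0 = 0" "\<And>x y. h (x + y) = h x + h y" "\<And>x y. h (x * y) = h x * h y"
  shows "map_poly h (p * q) = map_poly h p * map_poly h q"
proof -
  have "h (sum f A) = (\<Sum>i\<in>A. h (f i))" for f :: "nat \<Rightarrow> _" and A
    by (induction A rule: infinite_finite_induct) (simp_all add: h)
  thus ?thesis
    by (intro poly_eqI) (simp add: coeff_map_poly coeff_mult h)
qed

definition ev :: "'a::{field,finite} poly \<Rightarrow> 'a alg_closure \<Rightarrow> 'a alg_closure" where
  "ev Q x = poly (map_poly to_ac Q) x"

lemma map_to_ac_mult: "map_poly to_ac (p * q) = map_poly to_ac p * map_poly to_ac q"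
  by (rule map_poly_mult_hom) auto

lemma map_to_ac_add: "map_poly to_ac (p + q) = map_poly to_ac p + map_poly to_ac q"
  by (rule map_poly_add_hom) auto

lemma map_to_ac_eq_0_iff [simp]: "map_poly to_ac p = 0 \<longleftrightarrow> p = 0"
  by (rule map_poly_eq_0_iff) auto

lemma degree_map_to_ac [simp]: "degree (map_poly to_ac p) = degree p"
  by (rule degree_map_poly) auto

lemma ev_simps [simp]:
  "ev (p + q) x = ev p x + ev q x" "ev (p * q) x = ev p x * ev q x"
  "ev 0 x = 0" "ev 1 x = 1" "ev [:a:] x = to_ac a" "ev (monom a n) x = to_ac a * x ^ n"
  "ev (smult a p) x = to_ac a * ev p x" "ev (p ^ n) x = ev p x ^ n"
proof -
  show mult: "ev (p * q) x = ev p x * ev q x" for p q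
    by (simp add: ev_def map_to_ac_mult)
  show const: "ev [:a:] x = to_ac a"
    by (cases "a = 0") (simp_all add: ev_def map_poly_pCons)
  show "ev (smult a p) x = to_ac a * ev p x"
    using mult[of "[:a:]" p] const by simp
  show one: "ev 1 x = 1" by (simp add: ev_def)
  show "ev (p ^ n) x = ev p x ^ n" by (induction n) (simp_all add: mult one)
qed (simp_all add: ev_def map_to_ac_add map_poly_monom poly_monom)

lemma ev_minus [simp]: "ev (- p) x = - ev p x" "ev (p - q) x = ev p x - ev q x"
  using ev_simps(7)[of "-1" p x] ev_simps(7)[of "-1" q x] ev_simps(1)[of p "-q" x] by simp_all

lemma ev_frobpow: "ev Q (frobpow n x) = frobpow n (ev Q x)"
  by (simp add: ev_def poly_to_ac_frobpow)

lemma ev_in_Fq_ext: "x \<in> Fq_ext n \<Longrightarrow> ev Q x \<in> Fq_ext n"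
  by (simp add: ev_def Fq_ext_poly)

section \<open>Monic polynomials and polynomials of bounded degree\<close>

definition monics :: "nat \<Rightarrow> 'a::{field,finite} poly set" where
  "monics k = {f. degree f = k \<and> lead_coeff f = 1}"

text \<open>Stated by coefficients rather than by \<open>degree f < k\<close>: the zero polynomial,
  which has degree 0, must belong to the space also for \<open>k = 0\<close>.\<close>

definition polys_lt :: "nat \<Rightarrow> 'a::{field,finite} poly set" where
  "polys_lt k = {f. \<forall>i\<ge>k. coeff f i = 0}"

lemma polys_lt_iff: "f \<in> polys_lt k \<longleftrightarrow> f = 0 \<or> degree f < k"
  unfolding polys_lt_def
  by (auto simp: coeff_eq_0) (metis leading_coeff_0_iff not_le_imp_less)

lemma polys_lt_0 [simp]: "polys_lt 0 = {0}"
  by (auto simp: polys_lt_iff)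

lemma polys_lt_Suc: "polys_lt (Suc k) = (\<lambda>(a, f). pCons a f) ` (UNIV \<times> polys_lt k)"
proof (intro equalityI subsetI)
  fix f :: "'a poly" assume "f \<in> polys_lt (Suc k)"
  moreover obtain a g where "f = pCons a g" by (cases f)
  ultimately have "g \<in> polys_lt k" by (auto simp: polys_lt_def coeff_pCons split: nat.splits)
  with \<open>f = pCons a g\<close> show "f \<in> (\<lambda>(a, f). pCons a f) ` (UNIV \<times> polys_lt k)" by auto
qed (auto simp: polys_lt_def coeff_pCons split: nat.splits)

lemma inj_pCons: "inj_on (\<lambda>(a, f). pCons a f) A"
  by (auto simp: inj_on_def)

lemma finite_polys_lt [simp]: "finite (polys_lt k)"
  by (induction k) (auto simp: polys_lt_Suc)

lemma card_polys_lt: "card (polys_lt k :: 'a::{field,finite} poly set) = CARD('a) ^ k"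
  by (induction k) (simp_all add: polys_lt_Suc card_image inj_pCons card_cartesian_product)

lemma polys_lt_closed:
  assumes "f \<in> polys_lt k" "g \<in> polys_lt k"
  shows "f + g \<in> polys_lt k" "f - g \<in> polys_lt k" "-f \<in> polys_lt k" "smult c f \<in> polys_lt k"
  using assms by (auto simp: polys_lt_def)

lemma zero_in_polys_lt [simp]: "0 \<in> polys_lt k"
  by (simp add: polys_lt_def)

lemma polys_lt_mono: "k \<le> l \<Longrightarrow> f \<in> polys_lt k \<Longrightarrow> f \<in> polys_lt l"
  by (simp add: polys_lt_def)

lemma mod_in_polys_lt [simp]: "Q \<noteq> 0 \<Longrightarrow> f mod Q \<in> polys_lt (degree Q)"
  using degree_mod_less'[of Q f] by (auto simp: polys_lt_iff)

lemma mod_eq_self: "f \<in> polys_lt (degree Q) \<Longrightarrow> f mod Q = f"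
  by (auto simp: polys_lt_iff mod_poly_less)

lemma in_monics_iff: "f \<in> monics k \<longleftrightarrow> f - monom 1 k \<in> polys_lt k"
proof
  assume "f \<in> monics k"
  thus "f - monom 1 k \<in> polys_lt k"
    by (auto simp: monics_def polys_lt_def coeff_eq_0 le_less)
next
  assume *: "f - monom 1 k \<in> polys_lt k"
  hence c: "coeff f k = 1" by (auto simp: polys_lt_def)
  moreover have "coeff f i = 0" if "i > k" for i
    using * that by (auto simp: polys_lt_def)
  hence "degree f = k"
    using c by (intro antisym degree_le le_degree) auto
  ultimately show "f \<in> monics k" by (simp add: monics_def)
qed

lemma monics_eq_image: "monics k = (\<lambda>f. monom 1 k + f) ` polys_lt k"
proof (intro equalityI subsetI)
  fix f :: "'a poly" assume "f \<in> monics k"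
  thus "f \<in> (\<lambda>f. monom 1 k + f) ` polys_lt k"
    by (intro image_eqI[of _ _ "f - monom 1 k"]) (auto simp: in_monics_iff)
qed (auto simp: in_monics_iff)

lemma finite_monics [simp]: "finite (monics k)"
  by (simp add: monics_eq_image)

lemma card_monics: "card (monics k :: 'a::{field,finite} poly set) = CARD('a) ^ k"
  unfolding monics_eq_image by (subst card_image) (auto simp: card_polys_lt inj_on_def)

lemma monics_0 [simp]: "monics 0 = {1}"
proof (intro equalityI subsetI)
  fix f :: "'a poly" assume "f \<in> monics 0"
  hence f: "degree f = 0" "lead_coeff f = 1" by (auto simp: monics_def)
  from f(1) obtain c where "f = [:c:]" by (elim degree_eq_zeroE)
  with f(2) show "f \<in> {1}" by (simp add: one_pCons)
qed (simp add: monics_def)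

lemma monics_nonzero: "f \<in> monics k \<Longrightarrow> f \<noteq> 0"
  by (auto simp: monics_def)

lemma monics_mult: "f \<in> monics j \<Longrightarrow> g \<in> monics k \<Longrightarrow> f * g \<in> monics (j + k)"
  using lead_coeff_mult[of f g] degree_mult_eq[of f g]
  by (cases "f = 0 \<or> g = 0") (auto simp: monics_def)

lemma monics_degree: "lead_coeff f = 1 \<Longrightarrow> f \<in> monics (degree f)"
  by (simp add: monics_def)

section \<open>Irreducible factors of monic polynomials\<close>

lemma monic_dvd_antisym:
  fixes f g :: "'a::field poly"
  assumes "lead_coeff f = 1" "lead_coeff g = 1" "f dvd g" "degree g \<le> degree f"
  shows "f = g"
proof -
  from assms(3) obtain h where h: "g = f * h" by (elim dvdE)
  have nz: "f \<noteq> 0" "g \<noteq> 0" "h \<noteq> 0" using assms h by auto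
  hence "degree h = 0" using assms(4) by (simp add: h degree_mult_eq)
  then obtain c where "h = [:c:]" by (elim degree_eq_zeroE)
  with assms(1,2) h have "h = 1" using lead_coeff_mult[of f h] by (simp add: one_pCons)
  thus ?thesis by (simp add: h)
qed

lemma monic_cofactor:
  fixes f g :: "'a::field poly"
  assumes "lead_coeff (f * g) = 1" "lead_coeff f = 1"
  shows "lead_coeff g = 1"
  using assms by (simp add: lead_coeff_mult)

lemma monic_irreducibleD:
  assumes "monic_irreducible P"
  shows "lead_coeff P = 1" "irreducible P" "prime_elem P" "P \<noteq> 0" "degree P > 0" "P \<in> monics (degree P)"
proof -
  show l: "lead_coeff P = 1" and i: "irreducible P" using assms by (auto simp: monic_irreducible_def)
  show "prime_elem P" using i by (rule field_poly_irreducible_imp_prime)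
  show nz: "P \<noteq> 0" using i by auto
  show "degree P > 0"
    using irreducible_not_unit[OF i] nz by (auto simp: is_unit_iff_degree)
  show "P \<in> monics (degree P)" using l by (rule monics_degree)
qed

lemma monic_irreducible_dvd_eq:
  assumes "monic_irreducible P" "monic_irreducible R" "P dvd R"
  shows "P = R"
proof -
  note P = monic_irreducibleD[OF assms(1)] and R = monic_irreducibleD[OF assms(2)]
  from assms(3) obtain h where h: "R = P * h" by (elim dvdE)
  with R(2) have "is_unit h" using P(2) irreducible_not_unit by (metis irreducibleD)
  moreover have "h \<noteq> 0" using h R by auto
  ultimately have "degree h = 0" "h \<noteq> 0" by (auto simp: is_unit_iff_degree)
  hence "degree R \<le> degree P" using P by (simp add: h degree_mult_eq)
  thus ?thesis using P R assms(3) monic_dvd_antisym by blast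
qed

text \<open>A divisor of least positive degree is irreducible.\<close>

lemma exists_monic_irreducible_factor:
  fixes f :: "'a::{field,finite} poly"
  assumes "degree f > 0"
  obtains P where "monic_irreducible P" "P dvd f"
proof -
  let ?A = "\<lambda>g. lead_coeff g = 1 \<and> degree g > 0 \<and> g dvd f"
  have f0: "f \<noteq> 0" using assms by auto
  have ex: "?A (smult (inverse (lead_coeff f)) f)"
    using assms f0 by (auto simp: smult_dvd_iff)
  define P where "P = arg_min degree ?A"
  have P: "?A P" and min: "\<And>g. ?A g \<Longrightarrow> degree P \<le> degree g"
    unfolding P_def using arg_min_natI[of ?A, OF ex] arg_min_nat_le[of ?A] by blast+
  have "irreducible P"
  proof (rule irreducibleI)
    show "P \<noteq> 0" using P by auto
    thus "\<not> P dvd 1" using P by (simp add: is_unit_iff_degree)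
    fix a b assume ab: "P = a * b"
    hence nz: "a \<noteq> 0" "b \<noteq> 0" using P by auto
    show "a dvd 1 \<or> b dvd 1"
    proof (cases "degree a = 0")
      case False
      have "?A (smult (inverse (lead_coeff a)) a)"
        using False nz P ab by (auto simp: smult_dvd_iff intro: dvd_mult_left)
      from min[OF this] have "degree b = 0" using ab nz by (simp add: degree_mult_eq)
      thus ?thesis using nz by (simp add: is_unit_iff_degree)
    qed (use nz in \<open>simp add: is_unit_iff_degree\<close>)
  qed
  thus ?thesis using that P by (auto simp: monic_irreducible_def)
qed

lemma monic_induct [consumes 1, case_names one mult]:
  fixes f :: "'a::{field,finite} poly"
  assumes "lead_coeff f = 1"
  assumes one: "Pr 1"
    and mult: "\<And>P g. monic_irreducible P \<Longrightarrow> lead_coeff g = 1 \<Longrightarrow> Pr g \<Longrightarrow> Pr (P * g)"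
  shows "Pr f"
  using assms(1)
proof (induction "degree f" arbitrary: f rule: less_induct)
  case less
  show ?case
  proof (cases "degree f = 0")
    case True
    with less.prems have "f \<in> monics 0" by (simp add: monics_def)
    thus ?thesis using one by simp
  next
    case False
    then obtain P where P: "monic_irreducible P" "P dvd f"
      using exists_monic_irreducible_factor by blast
    then obtain g where g: "f = P * g" by (elim dvdE)
    note Pd = monic_irreducibleD[OF P(1)]
    have "f \<noteq> 0" using less.prems by auto
    hence "degree g < degree f" using g Pd by (auto simp: degree_mult_eq)
    moreover have "lead_coeff g = 1" using less.prems Pd unfolding g by (auto intro: monic_cofactor)
    ultimately show ?thesis using less.hyps mult P g by blast
  qed
qed

section \<open>Minimal polynomials and Frobenius orbits\<close>

lemma exists_min_poly:
  fixes x :: "'a::{field,finite} alg_closure"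
  obtains P where "monic_irreducible P" "ev P x = 0"
proof -
  obtain p :: "'a poly" where p: "p \<noteq> 0" "ev p x = 0"
    using alg_closure_algebraic[of x] unfolding ev_def by blast
  define f where "f = smult (inverse (lead_coeff p)) p"
  have f: "lead_coeff f = 1" "ev f x = 0" using p by (auto simp: f_def)
  have "\<exists>P. monic_irreducible P \<and> ev P x = 0"
    using f by (induction f rule: monic_induct) auto
  thus ?thesis using that by blast
qed

text \<open>A nonzero polynomial G of least degree vanishing at x divides every polynomial vanishing
  at x, by division with remainder. It divides P and is not a unit, so irreducibility makes it an
  associate of P.\<close>

lemma ev_eq_0_iff_dvd:
  fixes x :: "'a::{field,finite} alg_closure"
  assumes P: "monic_irreducible P" "ev P x = 0"
  shows "ev F x = 0 \<longleftrightarrow> P dvd F"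
proof
  assume F: "ev F x = 0"
  note Pd = monic_irreducibleD[OF P(1)]
  show "P dvd F"
  proof (cases "F = 0")
    case False
    define f where "f = smult (inverse (lead_coeff F)) F"
    have f: "lead_coeff f = 1" "ev f x = 0" using F False by (auto simp: f_def)
    let ?A = "\<lambda>g. g \<noteq> 0 \<and> ev g x = 0"
    define G where "G = arg_min degree ?A"
    have G: "?A G" and min: "\<And>g. ?A g \<Longrightarrow> degree G \<le> degree g"
      unfolding G_def using arg_min_natI[of ?A P] arg_min_nat_le[of ?A] P Pd by blast+
    have dvd: "G dvd g" if "ev g x = 0" for g
    proof (rule ccontr)
      assume "\<not> G dvd g"
      hence nz: "g mod G \<noteq> 0" by (simp add: dvd_eq_mod_eq_0)
      have "g = g div G * G + g mod G" by simp
      hence "ev g x = ev (g div G) x * ev G x + ev (g mod G) x" by (metis ev_simps(1,2))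
      hence "ev (g mod G) x = 0" using that G by simp
      with nz min have "degree G \<le> degree (g mod G)" by blast
      thus False using degree_mod_less'[of G g] G nz by simp
    qed
    have "\<not> is_unit G"
    proof
      assume "is_unit G"
      hence "G dvd 1" .
      then obtain H where "1 = G * H" by (elim dvdE)
      hence "ev 1 x = ev G x * ev H x" by (metis ev_simps(2))
      thus False using G by simp
    qed
    moreover from dvd[OF P(2)] obtain H where "P = G * H" by (elim dvdE)
    ultimately have "is_unit H" using Pd(2) irreducibleD by blast
    hence "P dvd G" using \<open>P = G * H\<close> by (simp add: mult_unit_dvd_iff)
    thus ?thesis using dvd[OF F] dvd_trans by blast
  qed simp
qed (use P in auto)

lemma min_poly_unique:
  assumes "monic_irreducible P" "ev P x = 0" "monic_irreducible R" "ev R x = 0"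
  shows "P = R"
  using assms ev_eq_0_iff_dvd monic_irreducible_dvd_eq by blast

lemma finite_ev_roots: "F \<noteq> 0 \<Longrightarrow> finite {x. ev F x = 0}"
  unfolding ev_def by (intro poly_roots_finite) auto

lemma card_ev_roots: "F \<noteq> 0 \<Longrightarrow> card {x. ev F x = 0} \<le> degree F"
  unfolding ev_def using card_poly_roots_bound[of "map_poly to_ac F"] by simp

text \<open>The product R over the Frobenius orbit of x is fixed by Frobenius, hence has
  coefficients in the base field; it vanishes at x, so P divides it. The orbit consists of roots of
  P, so deg R is at most deg P and the two monic polynomials agree. All three claims are read off
  from P = R.\<close>

lemma
  fixes x :: "'a::{field,finite} alg_closure"
  assumes P: "monic_irreducible P" "ev P x = 0"
  shows orbit_inj: "inj_on (\<lambda>i. frobpow i x) {..<degree P}"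
    and orbit_closes: "frobpow (degree P) x = x"
    and orbit_factorization: "map_poly to_ac P = (\<Prod>i<degree P. [:- frobpow i x, 1:])"
proof -
  note Pd = monic_irreducibleD[OF P(1)]
  have roots: "ev P (frobpow i x) = 0" for i by (simp add: ev_frobpow P)
  have "\<not> inj (\<lambda>i. frobpow i x)"
  proof
    assume "inj (\<lambda>i. frobpow i x)"
    hence "infinite (range (\<lambda>i. frobpow i x))" by (simp add: finite_image_iff)
    moreover have "range (\<lambda>i. frobpow i x) \<subseteq> {x. ev P x = 0}" using roots by auto
    ultimately show False using finite_ev_roots[of P] Pd finite_subset by blast
  qed
  then obtain i j where "frobpow i x = frobpow j x" "i < j"
    unfolding inj_def by (metis nat_neq_iff)
  hence "frobpow i (frobpow (j - i) x) = frobpow i x"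
    by (simp add: frobpow_frobpow)
  hence "frobpow (j - i) x = x" by (simp only: frobpow_eq_iff)
  hence ex: "\<exists>t. t > 0 \<and> frobpow t x = x" using \<open>i < j\<close> by (intro exI[of _ "j - i"]) auto
  define t where "t = (LEAST t. t > 0 \<and> frobpow t x = x)"
  have t: "t > 0" "frobpow t x = x" using LeastI_ex[OF ex] by (auto simp: t_def)
  have least: "t \<le> u" if "u > 0" "frobpow u x = x" for u
    unfolding t_def using that by (intro Least_le) auto
  have inj: "inj_on (\<lambda>i. frobpow i x) {..<t}"
  proof (rule linorder_inj_onI)
    fix i j assume ij: "i < j" "i \<in> {..<t}" "j \<in> {..<t}"
    show "frobpow i x \<noteq> frobpow j x"
    proof
      assume "frobpow i x = frobpow j x"
      hence "frobpow i (frobpow (j - i) x) = frobpow i x"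
        using ij by (simp add: frobpow_frobpow)
      hence "frobpow (j - i) x = x" by (simp only: frobpow_eq_iff)
      with least[of "j - i"] ij show False by auto
    qed
  qed auto
  have "t = card ((\<lambda>i. frobpow i x) ` {..<t})" using inj by (simp add: card_image)
  also have "\<dots> \<le> card {x. ev P x = 0}"
    by (rule card_mono) (use roots finite_ev_roots[of P] Pd in auto)
  also have "\<dots> \<le> degree P" by (rule card_ev_roots) (use Pd in auto)
  finally have tP: "t \<le> degree P" .

  define R where "R = (\<Prod>i<t. [:- frobpow i x, 1:])"
  let ?\<phi> = "\<lambda>z::'a alg_closure. z ^ CARD('a)"
  have \<phi>: "map_poly ?\<phi> (p * q) = map_poly ?\<phi> p * map_poly ?\<phi> q" for p q
    by (rule map_poly_mult_hom) (auto simp: power_0_left power_card_additive power_mult_distrib)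
  have \<phi>_prod: "map_poly ?\<phi> (\<Prod>i\<in>A. f i) = (\<Prod>i\<in>A. map_poly ?\<phi> (f i))" for f :: "nat \<Rightarrow> _" and A
    by (induction A rule: infinite_finite_induct) (simp_all add: \<phi>)
  have "map_poly ?\<phi> [:- frobpow i x, 1:] = [:- frobpow (Suc i) x, 1:]" for i
  proof -
    have "?\<phi> (- frobpow i x) = - frobpow (Suc i) x"
      using frobpow_uminus[of "frobpow i x" 1] frobpow_frobpow[of x i 1] by simp
    thus ?thesis by (simp add: map_poly_pCons power_0_left)
  qed
  hence "map_poly ?\<phi> R = (\<Prod>i<t. [:- frobpow (Suc i) x, 1:])"
    by (simp add: R_def \<phi>_prod)
  \<comment> \<open>Frobenius moves each linear factor to the next; since
    \<open>frobpow t x = x\<close>, the last one returns to the first.\<close>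
  also have "\<dots> = (\<Prod>i\<in>{..<t}. [:- frobpow i x, 1:])"
  proof -
    obtain u where u: "t = Suc u" using t(1) gr0_conv_Suc by blast
    have "(\<Prod>i<t. [:- frobpow (Suc i) x, 1:]) = (\<Prod>i<u. [:- frobpow (Suc i) x, 1:]) * [:- frobpow t x, 1:]"
      by (simp only: u prod.lessThan_Suc)
    also have "frobpow t x = frobpow 0 x" using t by simp
    also have "(\<Prod>i<u. [:- frobpow (Suc i) x, 1:]) * [:- frobpow 0 x, 1:] = (\<Prod>i<t. [:- frobpow i x, 1:])"
      unfolding u prod.lessThan_Suc_shift by (simp only: mult.commute)
    finally show ?thesis .
  qed
  finally have \<phi>R: "map_poly ?\<phi> R = R" by (simp add: R_def)
  have "coeff R i \<in> range to_ac" for i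
    using arg_cong[OF \<phi>R, of "\<lambda>p. coeff p i"]
    by (simp add: coeff_map_poly in_range_to_ac_iff power_0_left)
  hence R: "map_poly to_ac (map_poly of_ac R) = R"
    by (intro poly_eqI) (simp add: coeff_map_poly to_ac_of_ac)
  define R0 where "R0 = map_poly of_ac R"
  have degR: "degree R = t" unfolding R_def by (subst degree_prod_eq_sum_degree) auto
  have "lead_coeff R = 1" unfolding R_def by (simp add: lead_coeff_prod)
  have degR0: "degree R0 = t" using degR R R0_def by (metis degree_map_to_ac)
  have "to_ac (lead_coeff R0) = 1"
    using \<open>lead_coeff R = 1\<close> R degR degR0 unfolding R0_def
    by (metis coeff_map_poly to_ac_0)
  hence lR0: "lead_coeff R0 = 1" by (metis to_ac_1 to_ac_eq_iff)
  have "poly [:- frobpow 0 x, 1:] x = 0" by simp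
  hence "poly R x = 0" unfolding R_def poly_prod using t(1) by (intro prod_zero bexI[of _ 0]) auto
  hence "ev R0 x = 0" by (simp add: ev_def R0_def R)
  hence "P dvd R0" using ev_eq_0_iff_dvd P by blast
  hence PR: "P = R0" using Pd lR0 degR0 tP by (intro monic_dvd_antisym) auto
  show "inj_on (\<lambda>i. frobpow i x) {..<degree P}" using inj by (simp only: PR degR0)
  show "frobpow (degree P) x = x" using t by (simp only: PR degR0)
  show "map_poly to_ac P = (\<Prod>i<degree P. [:- frobpow i x, 1:])"
    using R unfolding PR degR0 R0_def[symmetric] unfolding R_def .
qed

lemma orbit_mod:
  fixes x :: "'a::{field,finite} alg_closure"
  assumes P: "monic_irreducible P" "ev P x = 0"
  shows "frobpow n x = frobpow (n mod degree P) x"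
proof -
  let ?m = "degree P"
  have "frobpow (k * ?m) x = x" for k
  proof (induction k)
    case (Suc k)
    have "frobpow (Suc k * ?m) x = frobpow (k * ?m) (frobpow ?m x)"
      by (simp only: frobpow_frobpow mult_Suc)
    thus ?case using Suc orbit_closes[OF P] by simp
  qed simp
  hence "frobpow (n mod ?m) (frobpow (n div ?m * ?m) x) = frobpow (n mod ?m) x" by simp
  thus ?thesis by (simp only: frobpow_frobpow div_mult_mod_eq)
qed

lemma in_Fq_ext_iff_degree_dvd:
  fixes x :: "'a::{field,finite} alg_closure"
  assumes P: "monic_irreducible P" "ev P x = 0"
  shows "x \<in> Fq_ext n \<longleftrightarrow> degree P dvd n"
proof -
  have d: "degree P > 0" using monic_irreducibleD[OF P(1)] by auto
  have "x \<in> Fq_ext n \<longleftrightarrow> frobpow (n mod degree P) x = frobpow 0 x"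
    by (simp add: Fq_ext_iff orbit_mod[OF P, of n])
  also have "\<dots> \<longleftrightarrow> n mod degree P = 0"
    using inj_on_eq_iff[OF orbit_inj[OF P], of "n mod degree P" 0] d by simp
  finally show ?thesis by (simp add: dvd_eq_mod_eq_0)
qed

lemma ev_roots_orbit:
  fixes x :: "'a::{field,finite} alg_closure"
  assumes P: "monic_irreducible P" "ev P x = 0"
  shows "{y. ev P y = 0} = (\<lambda>i. frobpow i x) ` {..<degree P}"
  by (auto simp: ev_def orbit_factorization[OF P] poly_prod)

lemma exists_root:
  assumes "monic_irreducible P"
  obtains x where "ev P x = 0"
  using alg_closed_imp_poly_has_root[of "map_poly to_ac P"] monic_irreducibleD[OF assms]
  unfolding ev_def by auto

lemma card_ev_roots_irreducible:
  assumes "monic_irreducible P"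
  shows "card {y. ev P y = 0} = degree P"
proof -
  obtain x where "ev P x = 0" using exists_root[OF assms] .
  thus ?thesis
    using ev_roots_orbit[OF assms] orbit_inj[OF assms] by (simp add: card_image)
qed

definition irreds :: "nat \<Rightarrow> 'a::{field,finite} poly set" where
  "irreds n = {P. monic_irreducible P \<and> degree P dvd n}"

lemma finite_irreds_le: "finite {P :: 'a::{field,finite} poly. monic_irreducible P \<and> degree P \<le> n}"
proof (rule finite_subset)
  show "{P :: 'a poly. monic_irreducible P \<and> degree P \<le> n} \<subseteq> polys_lt (Suc n)"
    by (auto simp: polys_lt_iff)
qed simp

lemma irreds_subset: "n > 0 \<Longrightarrow> irreds n \<subseteq> {P. monic_irreducible P \<and> degree P \<le> n}"
  unfolding irreds_def by (intro Collect_mono) (blast intro: dvd_imp_le)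

lemma finite_irreds [simp]: "n > 0 \<Longrightarrow> finite (irreds n)"
  using finite_subset[OF irreds_subset finite_irreds_le] .

lemma Fq_ext_eq_Union:
  shows "Fq_ext n = (\<Union>P\<in>irreds n. {x. ev P x = 0})"
proof (intro equalityI subsetI)
  fix x :: "'a alg_closure" assume "x \<in> Fq_ext n"
  moreover obtain P where "monic_irreducible P" "ev P x = 0" by (rule exists_min_poly)
  ultimately show "x \<in> (\<Union>P\<in>irreds n. {x. ev P x = 0})"
    using in_Fq_ext_iff_degree_dvd by (auto simp: irreds_def)
qed (use in_Fq_ext_iff_degree_dvd in \<open>auto simp: irreds_def\<close>)

text \<open>Points of the field with q^n elements are grouped by minimal polynomial; each
  \<open>P\<close> whose degree divides \<open>n\<close> accounts for \<open>degree P\<close>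
  points. This is the bridge between prime sums and point sums.\<close>

lemma sum_Fq_ext:
  fixes h :: "'a::{field,finite} alg_closure \<Rightarrow> 'c::comm_semiring_1"
  assumes "n > 0" and h: "\<And>P x. P \<in> irreds n \<Longrightarrow> ev P x = 0 \<Longrightarrow> h x = G P"
  shows "(\<Sum>x\<in>Fq_ext n. h x) = (\<Sum>P\<in>irreds n. of_nat (degree P) * G P)"
proof -
  have "(\<Sum>x\<in>Fq_ext n. h x) = (\<Sum>P\<in>irreds n. \<Sum>x | ev P x = 0. h x)"
    unfolding Fq_ext_eq_Union
  proof (rule sum.UNION_disjoint)
    show "\<forall>P\<in>irreds n. finite {x. ev P x = 0}"
      using monic_irreducibleD(4) by (auto simp: irreds_def intro!: finite_ev_roots)
    show "\<forall>P\<in>irreds n. \<forall>R\<in>irreds n. P \<noteq> R \<longrightarrow> {x. ev P x = 0} \<inter> {x. ev R x = 0} = {}"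
      using min_poly_unique by (auto simp: irreds_def)
  qed (use assms in auto)
  also have "\<dots> = (\<Sum>P\<in>irreds n. of_nat (degree P) * G P)"
  proof (rule sum.cong)
    fix P :: "'a poly" assume P: "P \<in> irreds n"
    have "(\<Sum>x | ev P x = 0. h x) = (\<Sum>x | ev P x = 0. G P)"
      using h P by (intro sum.cong) auto
    thus "(\<Sum>x | ev P x = 0. h x) = of_nat (degree P) * G P"
      using P card_ev_roots_irreducible[of P] by (simp add: irreds_def)
  qed simp
  finally show ?thesis .
qed

lemma sum_degree_irreds:
  assumes "n > 0"
  shows "(\<Sum>P\<in>(irreds n :: 'a::{field,finite} poly set). degree P) = CARD('a) ^ n"
  using sum_Fq_ext[OF assms, of "\<lambda>_::'a alg_closure. 1::nat" "\<lambda>_. 1"] card_Fq_ext[OF assms, where ?'a='a]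
  by simp

section \<open>Quadratic symbols\<close>

text \<open>Lifts the field elements 0, 1, -1 to integers. Every other element also goes to -1,
  which keeps the values in {-1, 0, 1} without side conditions.\<close>

definition sgnc :: "'a::field \<Rightarrow> int" where
  "sgnc z = (if z = 0 then 0 else if z = 1 then 1 else -1)"

text \<open>Euler's criterion: on \<open>Fq_ext n\<close> this is the quadratic character of the
  field with q^n elements; \<open>leg 1\<close> is that of the base field.\<close>

definition leg :: "nat \<Rightarrow> 'a::{field,finite} alg_closure \<Rightarrow> int" where
  "leg n y = sgnc (y ^ ((CARD('a) ^ n - 1) div 2))"

lemma two_neq_0_ac:
  assumes "odd CARD('a::{field,finite})"
  shows "(2::'a alg_closure) \<noteq> 0"
proof -
  have "to_ac (2::'a) \<noteq> to_ac 0" using two_neq_0_field[OF assms] by (simp only: to_ac_eq_iff) simp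
  thus ?thesis by simp
qed

lemma minus_one_neq_one_ac:
  assumes "odd CARD('a::{field,finite})"
  shows "(-1::'a alg_closure) \<noteq> 1"
  using two_neq_0_ac[OF assms] by (metis add.right_inverse one_add_one)

lemma half_exponent:
  assumes "odd CARD('a::{field,finite})" "n > 0"
  shows "2 * ((CARD('a) ^ n - 1) div 2) = CARD('a) ^ n - 1" "(CARD('a) ^ n - 1) div 2 > 0"
proof -
  have "CARD('a) ^ n > 1" using assms by (intro one_less_power card_field_gt_1)
  moreover have "odd (CARD('a) ^ n)" using assms by simp
  ultimately show "2 * ((CARD('a) ^ n - 1) div 2) = CARD('a) ^ n - 1" "(CARD('a) ^ n - 1) div 2 > 0"
    by presburger+
qed

lemma power_half_cases:
  fixes y :: "'a::{field,finite} alg_closure"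
  assumes q: "odd CARD('a)" and n: "n > 0" and y: "y \<in> Fq_ext n" "y \<noteq> 0"
  shows "y ^ ((CARD('a) ^ n - 1) div 2) = 1 \<or> y ^ ((CARD('a) ^ n - 1) div 2) = -1"
proof -
  let ?e = "(CARD('a) ^ n - 1) div 2"
  have "y * y ^ (CARD('a) ^ n - 1) = y ^ CARD('a) ^ n"
    by (simp flip: power_Suc)
  hence "y ^ (CARD('a) ^ n - 1) = 1" using y by (simp add: Fq_ext_iff)
  hence "(y ^ ?e) ^ 2 = 1" using half_exponent[OF q n] by (metis mult.commute power_mult)
  thus ?thesis by (simp add: power2_eq_1_iff)
qed

lemma leg_0 [simp]:
  assumes "odd CARD('a)" "n > 0"
  shows "leg n (0 :: 'a::{field,finite} alg_closure) = 0"
  using half_exponent[OF assms] by (simp add: leg_def sgnc_def power_0_left)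

lemma leg_1 [simp]: "leg n 1 = 1"
  by (simp add: leg_def sgnc_def)

lemma leg_eq_0_iff:
  fixes y :: "'a::{field,finite} alg_closure"
  assumes "odd CARD('a)" "n > 0"
  shows "leg n y = 0 \<longleftrightarrow> y = 0"
  using half_exponent[OF assms] by (simp add: leg_def sgnc_def)

lemma leg_cases: "leg n y = 0 \<or> leg n y = 1 \<or> leg n y = -1"
  by (simp add: leg_def sgnc_def)

lemma leg_mult:
  fixes x y :: "'a::{field,finite} alg_closure"
  assumes q: "odd CARD('a)" "n > 0" and "x \<in> Fq_ext n" "y \<in> Fq_ext n"
  shows "leg n (x * y) = leg n x * leg n y"
proof (cases "x = 0 \<or> y = 0")
  case False
  thus ?thesis
    using power_half_cases[OF q assms(3)] power_half_cases[OF q assms(4)] minus_one_neq_one_ac[OF q(1)]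
    by (auto simp: leg_def sgnc_def power_mult_distrib)
qed (use q in auto)

lemma Fq_ext_power: "x \<in> Fq_ext n \<Longrightarrow> x ^ k \<in> Fq_ext n"
  by (induction k) (auto intro: Fq_ext_closed)

lemma leg_power:
  fixes x :: "'a::{field,finite} alg_closure"
  assumes q: "odd CARD('a)" "n > 0" and "x \<in> Fq_ext n"
  shows "leg n (x ^ k) = leg n x ^ k"
  by (induction k) (simp_all add: leg_mult[OF q] assms Fq_ext_power)

text \<open>For y nonzero, a square root z always exists in the closure, and it lies in the field
  exactly if z^(q^n - 1) = y^((q^n - 1)/2) is 1.\<close>

lemma card_square_roots:
  fixes y :: "'a::{field,finite} alg_closure"
  assumes q: "odd CARD('a)" "n > 0" and y: "y \<in> Fq_ext n"
  shows "int (card {z \<in> Fq_ext n. z\<^sup>2 = y}) = 1 + leg n y"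
proof (cases "y = 0")
  case True
  have "{z \<in> Fq_ext n. z\<^sup>2 = y} = {0}" using True by auto
  thus ?thesis using True q by simp
next
  case False
  let ?e = "(CARD('a) ^ n - 1) div 2"
  obtain z where z: "z\<^sup>2 = y" using nth_root_exists[of 2 y] by auto
  hence z0: "z \<noteq> 0" using False by auto
  have sols: "w\<^sup>2 = y \<longleftrightarrow> w = z \<or> w = -z" for w using z by (auto simp: power2_eq_iff)
  have "z \<noteq> -z"
  proof
    assume "z = -z"
    hence "2 * z = 0" by (metis add.right_inverse mult_2)
    thus False using z0 two_neq_0_ac[OF q(1)] by simp
  qed
  have "y ^ ?e = z ^ (CARD('a) ^ n - 1)"
    using half_exponent(1)[OF q] by (simp flip: z power_mult)
  moreover have "z * z ^ (CARD('a) ^ n - 1) = frobpow n z"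
    by (simp flip: power_Suc)
  ultimately have "z * y ^ ?e = frobpow n z" by simp
  hence iff: "z \<in> Fq_ext n \<longleftrightarrow> y ^ ?e = 1" using z0 by (auto simp: Fq_ext_iff)
  show ?thesis
  proof (cases "y ^ ?e = 1")
    case True
    hence "{z \<in> Fq_ext n. z\<^sup>2 = y} = {z, -z}"
      using sols iff Fq_ext_closed(5)[of z n] by auto
    thus ?thesis using \<open>z \<noteq> -z\<close> True by (simp add: leg_def sgnc_def)
  next
    case ne: False
    hence "{z \<in> Fq_ext n. z\<^sup>2 = y} = {}"
      using sols iff Fq_ext_closed(5)[of "-z" n] by auto
    moreover have "y ^ ?e = -1" using power_half_cases[OF q y False] ne by blast
    ultimately show ?thesis using minus_one_neq_one_ac[OF q(1)] by (simp add: leg_def sgnc_def del: Collect_empty_eq)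
  qed
qed

lemma sum_squares:
  fixes G :: "'a::{field,finite} alg_closure \<Rightarrow> int"
  assumes q: "odd CARD('a)" "n > 0"
  shows "(\<Sum>z\<in>Fq_ext n. G (z\<^sup>2)) = (\<Sum>y\<in>Fq_ext n. (1 + leg n y) * G y)"
proof -
  have fin: "finite (Fq_ext n :: 'a alg_closure set)" by (rule finite_Fq_ext[OF q(2)])
  have "(\<Sum>z\<in>Fq_ext n. G (z\<^sup>2)) = (\<Sum>y\<in>Fq_ext n. \<Sum>z | z \<in> Fq_ext n \<and> z\<^sup>2 = y. G (z\<^sup>2))"
    by (rule sum.group[symmetric]) (use fin Fq_ext_closed(3) in \<open>auto simp: power2_eq_square\<close>)
  also have "\<dots> = (\<Sum>y\<in>Fq_ext n. (1 + leg n y) * G y)"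
  proof (rule sum.cong)
    fix y :: "'a alg_closure" assume y: "y \<in> Fq_ext n"
    have "(\<Sum>z | z \<in> Fq_ext n \<and> z\<^sup>2 = y. G (z\<^sup>2)) = (\<Sum>z | z \<in> Fq_ext n \<and> z\<^sup>2 = y. G y)"
      by (rule sum.cong) auto
    thus "(\<Sum>z | z \<in> Fq_ext n \<and> z\<^sup>2 = y. G (z\<^sup>2)) = (1 + leg n y) * G y"
      using card_square_roots[OF q y] by simp
  qed simp
  finally show ?thesis .
qed

lemma sum_leg:
  assumes q: "odd CARD('a::{field,finite})" "n > 0"
  shows "(\<Sum>y\<in>(Fq_ext n :: 'a alg_closure set). leg n y) = 0"
  using sum_squares[OF q, of "\<lambda>_. 1"] by (simp add: sum.distrib)

section \<open>Resultants, Jacobi symbols and quadratic reciprocity\<close>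

definition rs :: "'a::{field,finite} poly \<Rightarrow> 'a poly \<Rightarrow> 'a alg_closure" where
  "rs Q f = (\<Prod>b\<in>#proots (map_poly to_ac Q). ev f b)"

definition jac :: "'a::{field,finite} poly \<Rightarrow> 'a poly \<Rightarrow> int" where
  "jac f Q = leg 1 (rs Q f)"

text \<open>\<open>rs Q f\<close> is the resultant of \<open>Q\<close> and \<open>f\<close> and \<open>jac f Q\<close> is the Jacobi symbol \<open>(f/Q)\<close>,
  both for monic \<open>Q\<close>.\<close>

lemma rs_mult_num: "rs Q (f * g) = rs Q f * rs Q g"
  by (simp add: rs_def prod_mset.distrib)

lemma rs_mult_den: "Q \<noteq> 0 \<Longrightarrow> R \<noteq> 0 \<Longrightarrow> rs (Q * R) f = rs Q f * rs R f"
  by (simp add: rs_def map_to_ac_mult proots_mult)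

lemma rs_one [simp]: "rs Q 1 = 1" "rs 1 f = 1"
  by (simp_all add: rs_def)

lemma rs_const: "rs Q [:c:] = to_ac c ^ degree Q"
  using proots_factorization(2)[of "map_poly to_ac Q"]
  by (cases "Q = 0") (simp_all add: rs_def)

lemma rs_cong:
  assumes "Q \<noteq> 0" "Q dvd f - g"
  shows "rs Q f = rs Q g"
proof -
  have "ev f b = ev g b" if "b \<in># proots (map_poly to_ac Q)" for b
  proof -
    have "ev Q b = 0" using that assms by (simp add: ev_def)
    moreover obtain h where "f - g = Q * h" using assms by (elim dvdE)
    ultimately have "ev (f - g) b = 0" by simp
    thus ?thesis by simp
  qed
  thus ?thesis unfolding rs_def by (intro arg_cong[where f = prod_mset] image_mset_cong) auto
qed

text \<open>The roots of P are the conjugates of x, so the resultant is the norm of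
  \<open>ev f x\<close> down to the base field.\<close>

lemma rs_irreducible:
  fixes x :: "'a::{field,finite} alg_closure"
  assumes P: "monic_irreducible P" "ev P x = 0"
  shows "rs P f = ev f x ^ (\<Sum>i<degree P. CARD('a) ^ i)"
proof -
  have "proots (map_poly to_ac P) = (\<Sum>i<degree P. {#frobpow i x#})"
    unfolding orbit_factorization[OF P] by (subst proots_prod) auto
  moreover have "(\<Prod>b\<in>#(\<Sum>i<k. {#frobpow i x#}). ev f b) = (\<Prod>i<k. ev f (frobpow i x))" for k
    by (induction k) simp_all
  ultimately have "rs P f = (\<Prod>i<degree P. ev f (frobpow i x))" by (simp add: rs_def)
  also have "\<dots> = ev f x ^ (\<Sum>i<degree P. CARD('a) ^ i)"
    by (simp add: ev_frobpow power_sum)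
  finally show ?thesis .
qed

lemma root_in_Fq_ext:
  fixes x :: "'a::{field,finite} alg_closure"
  assumes P: "monic_irreducible P" "ev P x = 0"
  shows "x \<in> Fq_ext (degree P)"
  using in_Fq_ext_iff_degree_dvd[OF P] by simp

text \<open>The exponents multiply: (1 + q + ... + q^(m-1)) (q - 1)/2 = (q^m - 1)/2. Hence the
  quadratic character of the norm is the quadratic character of the extension.\<close>

lemma jac_irreducible:
  fixes x :: "'a::{field,finite} alg_closure"
  assumes q: "odd CARD('a)" and P: "monic_irreducible P" "ev P x = 0"
  shows "jac f P = leg (degree P) (ev f x)"
proof -
  let ?q = "CARD('a)" and ?m = "degree P"
  have m: "?m > 0" using monic_irreducibleD[OF P(1)] by auto
  have "(?q - 1) * (\<Sum>i<?m. ?q ^ i) = ?q ^ ?m - 1"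
  proof -
    have "int ((?q - 1) * (\<Sum>i<?m. ?q ^ i)) = (int ?q - 1) * (\<Sum>i<?m. int ?q ^ i)"
      using card_field_gt_1[where ?'a='a] by (simp add: of_nat_diff)
    also have "\<dots> = int ?q ^ ?m - 1" by (rule power_diff_1_eq[symmetric])
    also have "\<dots> = int (?q ^ ?m - 1)"
      using card_field_gt_1[where ?'a='a] by (simp add: of_nat_diff)
    finally show ?thesis by (simp only: of_nat_eq_iff)
  qed
  moreover have "2 * ((\<Sum>i<?m. ?q ^ i) * ((?q ^ 1 - 1) div 2)) = (2 * ((?q ^ 1 - 1) div 2)) * (\<Sum>i<?m. ?q ^ i)"
    by (simp only: mult_ac)
  ultimately have "2 * ((\<Sum>i<?m. ?q ^ i) * ((?q ^ 1 - 1) div 2)) = 2 * ((?q ^ ?m - 1) div 2)"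
    using half_exponent(1)[OF q m] half_exponent(1)[OF q zero_less_Suc[of 0, folded One_nat_def]] by (simp only: power_one_right)
  hence "(\<Sum>i<?m. ?q ^ i) * ((?q ^ 1 - 1) div 2) = (?q ^ ?m - 1) div 2" by simp
  thus ?thesis
    unfolding jac_def leg_def rs_irreducible[OF P] by (simp flip: power_mult)
qed

lemma rs_in_Fq_ext:
  fixes Q :: "'a::{field,finite} poly"
  assumes "lead_coeff Q = 1"
  shows "rs Q f \<in> Fq_ext 1"
  using assms
proof (induction Q rule: monic_induct)
  case (mult P g)
  note Pd = monic_irreducibleD[OF mult(1)]
  obtain x where x: "ev P x = 0" using exists_root[OF mult(1)] .
  let ?y = "ev f x" and ?S = "\<Sum>i<degree P. CARD('a) ^ i"
  have "rs P f \<in> Fq_ext 1"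
  proof (cases "?y = 0")
    case False
    have y: "frobpow (degree P) ?y = ?y"
      using ev_in_Fq_ext[OF root_in_Fq_ext[OF mult(1) x], of f] by (simp add: Fq_ext_iff)
    \<comment> \<open>Raising the norm y^(1 + q + ... + q^(m-1)) to the q-th power trades a factor y
      for y^(q^m), and these two agree.\<close>
    have "1 + CARD('a) * ?S = (\<Sum>i<Suc (degree P). CARD('a) ^ i)"
      unfolding sum.lessThan_Suc_shift by (simp add: sum_distrib_left)
    hence "?y * (?y ^ ?S) ^ CARD('a) = ?y ^ ?S * frobpow (degree P) ?y"
      by (simp add: mult.commute add.commute flip: power_mult power_add power_Suc)
    hence "(?y ^ ?S) ^ CARD('a) = ?y ^ ?S" using False y by simp
    thus ?thesis by (simp add: Fq_ext_iff rs_irreducible[OF mult(1) x])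
  next
    case True
    have "?S > 0" using Pd(5) card_field_gt_1[where ?'a='a] by (intro sum_pos) auto
    thus ?thesis using True by (simp add: rs_irreducible[OF mult(1) x] power_0_left del: sum_eq_0_iff)
  qed
  moreover have "rs (P * g) f = rs P f * rs g f"
    using Pd mult by (intro rs_mult_den) auto
  ultimately show ?case using mult Fq_ext_closed(3) by metis
qed simp

lemma jac_mult_num:
  fixes Q :: "'a::{field,finite} poly"
  assumes "odd CARD('a)" "lead_coeff Q = 1"
  shows "jac (f * g) Q = jac f Q * jac g Q"
  unfolding jac_def rs_mult_num using assms by (intro leg_mult rs_in_Fq_ext) auto

lemma jac_mult_den:
  fixes Q :: "'a::{field,finite} poly"
  assumes "odd CARD('a)" "lead_coeff Q = 1" "lead_coeff R = 1"
  shows "jac f (Q * R) = jac f Q * jac f R"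
proof -
  have "rs (Q * R) f = rs Q f * rs R f" using assms by (intro rs_mult_den) auto
  thus ?thesis unfolding jac_def
    using leg_mult[OF assms(1) zero_less_Suc[of 0, folded One_nat_def] rs_in_Fq_ext[OF assms(2)] rs_in_Fq_ext[OF assms(3)], of f f] by simp
qed

lemma jac_one [simp]: "jac 1 Q = 1" "jac f 1 = 1"
  by (simp_all add: jac_def)

lemma jac_cases: "jac f Q = 0 \<or> jac f Q = 1 \<or> jac f Q = -1"
  unfolding jac_def by (rule leg_cases)

lemma abs_jac_le_1: "\<bar>jac f Q\<bar> \<le> 1"
  using jac_cases[of f Q] by auto

lemma jac_const: "odd CARD('a) \<Longrightarrow> jac [:c:] Q = leg 1 (to_ac (c::'a::{field,finite})) ^ degree Q"
  unfolding jac_def rs_const by (intro leg_power) simp_all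

lemma jac_cong: "Q \<noteq> 0 \<Longrightarrow> Q dvd f - g \<Longrightarrow> jac f Q = jac g Q"
  by (simp add: jac_def rs_cong)

lemma jac_mod: "Q \<noteq> 0 \<Longrightarrow> jac (f mod Q) Q = jac f Q"
  by (intro jac_cong) (simp_all add: mod_eq_dvd_iff[symmetric])

lemma jac_eq_0_iff:
  fixes P :: "'a::{field,finite} poly"
  assumes "odd CARD('a)" "monic_irreducible P"
  shows "jac f P = 0 \<longleftrightarrow> P dvd f"
proof -
  obtain x where x: "ev P x = 0" using exists_root[OF assms(2)] .
  show ?thesis
    using assms monic_irreducibleD(5)[OF assms(2)]
    by (simp add: jac_irreducible[OF assms(1,2) x] leg_eq_0_iff ev_eq_0_iff_dvd[OF assms(2) x])
qed

lemma ev_prod_roots: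
  assumes "lead_coeff f = 1"
  shows "ev f b = (\<Prod>a\<in>#proots (map_poly to_ac f). b - a)"
proof -
  have nz: "map_poly to_ac f \<noteq> 0" using assms by auto
  have l: "lead_coeff (map_poly to_ac f) = 1" using assms by (simp add: coeff_map_poly)
  have "poly (\<Prod>a\<in>#A. [:-a, 1:]) b = (\<Prod>a\<in>#A. b - a)" for A :: "'a alg_closure multiset"
    by (induction A) (simp_all add: algebra_simps)
  thus ?thesis
    unfolding ev_def using proots_factorization(1)[OF nz] l by (metis smult_1_left)
qed

text \<open>Both resultants are products of differences over all pairs of roots; each of the
  \<open>degree f * degree Q\<close> factors changes sign.\<close>

lemma rs_swap:
  assumes "lead_coeff f = 1" "lead_coeff Q = 1"
  shows "rs Q f = (-1) ^ (degree f * degree Q) * rs f Q"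
proof -
  let ?F = "proots (map_poly to_ac f)" and ?Q = "proots (map_poly to_ac Q)"
  have "f \<noteq> 0" "Q \<noteq> 0" using assms by auto
  hence sizes: "size ?F = degree f" "size ?Q = degree Q"
    using proots_factorization(2)[of "map_poly to_ac f"] proots_factorization(2)[of "map_poly to_ac Q"]
    by auto
  have neg: "(\<Prod>b\<in>#B. b - a) = (-1) ^ size B * (\<Prod>b\<in>#B. a - b)" for a :: "'a alg_closure" and B
    by (induction B) (simp_all add: algebra_simps)
  have "rs Q f = (\<Prod>b\<in>#?Q. \<Prod>a\<in>#?F. b - a)"
    unfolding rs_def ev_prod_roots[OF assms(1)] ..
  also have "\<dots> = (\<Prod>a\<in>#?F. \<Prod>b\<in>#?Q. b - a)" by (rule prod_mset.swap)
  also have "\<dots> = (\<Prod>a\<in>#?F. (-1) ^ size ?Q * ev Q a)"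
    by (simp add: neg ev_prod_roots[OF assms(2)])
  also have "\<dots> = (-1) ^ (degree f * degree Q) * rs f Q"
    unfolding rs_def by (simp add: prod_mset.distrib sizes flip: power_mult) (simp add: mult.commute)
  finally show ?thesis .
qed

lemma jac_recip:
  fixes Q :: "'a::{field,finite} poly"
  assumes "odd CARD('a)" "lead_coeff f = 1" "lead_coeff Q = 1"
  shows "jac f Q = leg 1 (-1 :: 'a alg_closure) ^ (degree f * degree Q) * jac Q f"
proof -
  have m1: "(-1 :: 'a alg_closure) \<in> Fq_ext 1" by (rule Fq_ext_closed(5)) (rule Fq_ext_0_1)+
  have "leg 1 ((-1) ^ (degree f * degree Q) * rs f Q) = leg 1 ((-1 :: 'a alg_closure) ^ (degree f * degree Q)) * leg 1 (rs f Q)"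
    using assms m1 by (intro leg_mult Fq_ext_power rs_in_Fq_ext) simp_all
  also have "leg 1 ((-1 :: 'a alg_closure) ^ (degree f * degree Q)) = leg 1 (-1 :: 'a alg_closure) ^ (degree f * degree Q)"
    using assms m1 by (intro leg_power) simp_all
  finally show ?thesis
    unfolding jac_def rs_swap[OF assms(2,3)] .
qed

section \<open>Point counts\<close>

text \<open>The sum of Lambda(f) (Q/f) over monic f of degree n, written as a sum over points;
  \<open>charsum_eq\<close> gives the form with prime powers.\<close>

definition charsum :: "nat \<Rightarrow> 'a::{field,finite} poly \<Rightarrow> int" where
  "charsum n Q = (\<Sum>x\<in>Fq_ext n. leg n (ev Q x))"

text \<open>With k = n div m, the exponent (q^n - 1)/2 is (q^m - 1)/2 times S, a sum of k odd
  numbers. So S has the parity of k, and only the parity matters for a power of 1 or -1.\<close>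

lemma leg_extend:
  fixes y :: "'a::{field,finite} alg_closure"
  assumes q: "odd CARD('a)" and n: "n > 0" "m dvd n" and y: "y \<in> Fq_ext m"
  shows "leg n y = leg m y ^ (n div m)"
proof (cases "y = 0")
  case True
  have "m > 0" using n dvd_pos_nat by blast
  thus ?thesis using True q n by (auto simp: power_0_left dvd_div_eq_0_iff)
next
  case False
  let ?q = "CARD('a)" and ?k = "n div m"
  have m: "m > 0" using n dvd_pos_nat by blast
  have nk: "n = m * ?k" using n by simp
  define S where "S = (\<Sum>i<?k. (?q ^ m) ^ i)"
  have "int ((?q ^ m - 1) * S) = (int ?q ^ m - 1) * (\<Sum>i<?k. (int ?q ^ m) ^ i)"
    using card_field_gt_1[where ?'a='a] by (simp add: of_nat_diff S_def)
  also have "\<dots> = (int ?q ^ m) ^ ?k - 1" by (rule power_diff_1_eq[symmetric])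
  also have "\<dots> = int (?q ^ n - 1)"
    using card_field_gt_1[where ?'a='a] nk by (simp add: of_nat_diff flip: power_mult)
  finally have "(?q ^ m - 1) * S = ?q ^ n - 1" by (simp only: of_nat_eq_iff)
  hence "2 * ((?q ^ m - 1) div 2 * S) = 2 * ((?q ^ n - 1) div 2)"
    using half_exponent(1)[OF q m] half_exponent(1)[OF q n(1)] by (metis mult.assoc)
  hence e: "(?q ^ m - 1) div 2 * S = (?q ^ n - 1) div 2" by simp
  have "even S \<longleftrightarrow> even ?k"
  proof -
    have "even (\<Sum>i<k. (?q ^ m) ^ i) \<longleftrightarrow> even k" for k by (induction k) (use q in auto)
    thus ?thesis by (simp add: S_def)
  qed
  hence par: "(-1) ^ S = (-1 :: 'a alg_closure) ^ ?k" "(-1) ^ S = (-1 :: int) ^ ?k"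
    by (cases "even S"; simp)+
  have "leg n y = sgnc ((y ^ ((?q ^ m - 1) div 2)) ^ S)"
    unfolding leg_def e[symmetric] by (simp add: power_mult)
  also have "\<dots> = leg m y ^ ?k"
    using power_half_cases[OF q m y False]
  proof
    assume *: "y ^ ((?q ^ m - 1) div 2) = -1"
    hence "leg m y = -1" using minus_one_neq_one_ac[OF q] by (simp add: leg_def sgnc_def)
    moreover have "sgnc ((-1 :: 'a alg_closure) ^ k) = (-1) ^ k" for k
      using minus_one_neq_one_ac[OF q] by (cases "even k") (auto simp: sgnc_def)
    ultimately show ?thesis using * par by simp
  qed (simp add: leg_def sgnc_def)
  finally show ?thesis .
qed

lemma charsum_eq:
  fixes Q :: "'a::{field,finite} poly"
  assumes q: "odd CARD('a)" and n: "n > 0"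
  shows "charsum n Q = (\<Sum>P\<in>irreds n. int (degree P) * jac Q P ^ (n div degree P))"
  unfolding charsum_def
proof (rule sum_Fq_ext[OF n])
  fix P :: "'a poly" and x assume P: "P \<in> irreds n" "ev P x = 0"
  hence Pi: "monic_irreducible P" and d: "degree P dvd n" by (auto simp: irreds_def)
  show "leg n (ev Q x) = jac Q P ^ (n div degree P)"
    using leg_extend[OF q n d ev_in_Fq_ext[OF root_in_Fq_ext[OF Pi P(2)]]]
    by (simp add: jac_irreducible[OF q Pi P(2)])
qed

section \<open>Residues modulo a monic irreducible\<close>

lemma ev_mod:
  assumes "ev P x = 0"
  shows "ev (f mod P) x = ev f x"
proof -
  have "ev f x = ev (f div P) x * ev P x + ev (f mod P) x"
    by (metis div_mult_mod_eq ev_simps(1,2))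
  thus ?thesis using assms by simp
qed

text \<open>Evaluation at a root identifies the residues modulo \<open>P\<close> with a field: it is
  injective because a difference of low degree divisible by \<open>P\<close> is 0, and surjective by
  counting.\<close>

lemma bij_ev:
  fixes x :: "'a::{field,finite} alg_closure"
  assumes P: "monic_irreducible P" "ev P x = 0"
  shows "bij_betw (\<lambda>f. ev f x) (polys_lt (degree P)) (Fq_ext (degree P))"
proof -
  note Pd = monic_irreducibleD[OF P(1)]
  have inj: "inj_on (\<lambda>f. ev f x) (polys_lt (degree P))"
  proof (rule inj_onI)
    fix f g assume fg: "f \<in> polys_lt (degree P)" "g \<in> polys_lt (degree P)" "ev f x = ev g x"
    hence "P dvd f - g" using ev_eq_0_iff_dvd[OF P, of "f - g"] by simp
    moreover have "f - g \<in> polys_lt (degree P)" using fg polys_lt_closed by blast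
    ultimately show "f = g" by (metis dvd_imp_degree_le eq_iff_diff_eq_0 not_less polys_lt_iff)
  qed
  moreover have "(\<lambda>f. ev f x) ` polys_lt (degree P) \<subseteq> Fq_ext (degree P)"
    using ev_in_Fq_ext[OF root_in_Fq_ext[OF P]] by auto
  moreover have "card ((\<lambda>f. ev f x) ` polys_lt (degree P)) = card (Fq_ext (degree P) :: 'a alg_closure set)"
    using inj Pd(5) by (simp add: card_image card_polys_lt card_Fq_ext)
  ultimately show ?thesis
    using card_subset_eq[OF finite_Fq_ext[OF Pd(5)]] unfolding bij_betw_def by blast
qed

lemma sum_jac_irreducible:
  fixes P :: "'a::{field,finite} poly"
  assumes q: "odd CARD('a)" and P: "monic_irreducible P"
  shows "(\<Sum>f\<in>polys_lt (degree P). jac f P) = 0"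
proof -
  obtain x where x: "ev P x = 0" using exists_root[OF P] .
  have "(\<Sum>f\<in>polys_lt (degree P). jac f P) = (\<Sum>f\<in>polys_lt (degree P). leg (degree P) (ev f x))"
    by (simp add: jac_irreducible[OF q P x])
  also have "\<dots> = (\<Sum>y\<in>(Fq_ext (degree P) :: 'a alg_closure set). leg (degree P) y)"
    using sum.reindex_bij_betw[OF bij_ev[OF P x], of "leg (degree P)"] .
  also have "\<dots> = 0" by (rule sum_leg[OF q monic_irreducibleD(5)[OF P]])
  finally show ?thesis .
qed

lemma exists_nonresidue:
  fixes P :: "'a::{field,finite} poly"
  assumes q: "odd CARD('a)" and P: "monic_irreducible P"
  obtains f where "f \<in> polys_lt (degree P)" "jac f P = -1"
proof (rule ccontr)
  assume "\<not> thesis"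
  hence nonneg: "jac f P \<ge> 0" if "f \<in> polys_lt (degree P)" for f
    using that jac_cases[of f P] \<open>\<And>f. f \<in> polys_lt (degree P) \<Longrightarrow> jac f P = -1 \<Longrightarrow> thesis\<close> by auto
  have "1 \<in> polys_lt (degree P)" using monic_irreducibleD(5)[OF P] by (simp add: polys_lt_iff)
  moreover have "jac 1 P = 0"
    using sum_nonneg_0[of "polys_lt (degree P)" "\<lambda>f. jac f P" 1] nonneg sum_jac_irreducible[OF q P] calculation
    by simp
  ultimately show False by simp
qed

text \<open>The count of square roots, transported to residues. It later turns a Gauss sum into a
  sum over the values of a quadratic form.\<close>

lemma sum_squares_mod:
  fixes P :: "'a::{field,finite} poly" and G :: "'a poly \<Rightarrow> int"
  assumes q: "odd CARD('a)" and P: "monic_irreducible P"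
  shows "(\<Sum>f\<in>polys_lt (degree P). G (f\<^sup>2 mod P)) = (\<Sum>y\<in>polys_lt (degree P). (1 + jac y P) * G y)"
proof -
  note Pd = monic_irreducibleD[OF P]
  obtain x where x: "ev P x = 0" using exists_root[OF P] .
  note bij = bij_ev[OF P x]
  let ?V = "polys_lt (degree P) :: 'a poly set" and ?e = "\<lambda>f. ev f x"
  define H where "H = G \<circ> the_inv_into ?V ?e"
  have H: "H (ev f x) = G f" if "f \<in> ?V" for f
    using that the_inv_into_f_f[OF bij_betw_imp_inj_on[OF bij]] by (simp add: H_def)
  have "(\<Sum>f\<in>?V. G (f\<^sup>2 mod P)) = (\<Sum>f\<in>?V. H ((ev f x)\<^sup>2))"
  proof (rule sum.cong)
    fix f :: "'a poly"
    show "G (f\<^sup>2 mod P) = H ((ev f x)\<^sup>2)"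
      using H[of "f\<^sup>2 mod P"] Pd(4) ev_mod[OF x, of "f\<^sup>2"] by simp
  qed simp
  also have "\<dots> = (\<Sum>z\<in>Fq_ext (degree P). H (z\<^sup>2))"
    using sum.reindex_bij_betw[OF bij, of "\<lambda>z. H (z\<^sup>2)"] .
  also have "\<dots> = (\<Sum>z\<in>Fq_ext (degree P). (1 + leg (degree P) z) * H z)"
    by (rule sum_squares[OF q Pd(5)])
  also have "\<dots> = (\<Sum>y\<in>?V. (1 + leg (degree P) (ev y x)) * H (ev y x))"
    using sum.reindex_bij_betw[OF bij, of "\<lambda>z. (1 + leg (degree P) z) * H z"] by (rule sym)
  also have "\<dots> = (\<Sum>y\<in>?V. (1 + jac y P) * G y)"
    by (rule sum.cong) (simp_all add: H jac_irreducible[OF q P x])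
  finally show ?thesis .
qed

section \<open>L-functions of quadratic characters\<close>

text \<open>Coefficients of the L-function of the symbols (Q/f), the form tied to point counts.
  \<open>jsum\<close> has \<open>Q\<close> as modulus instead, where orthogonality applies;
  \<open>lcoef_eq_jsum\<close> relates the two by reciprocity.\<close>

definition lcoef :: "'a::{field,finite} poly \<Rightarrow> nat \<Rightarrow> int" where
  "lcoef Q k = (\<Sum>f\<in>monics k. jac Q f)"

definition jsum :: "'a::{field,finite} poly \<Rightarrow> nat \<Rightarrow> int" where
  "jsum Q k = (\<Sum>f\<in>monics k. jac f Q)"

lemma lcoef_eq_jsum:
  fixes Q :: "'a::{field,finite} poly"
  assumes "odd CARD('a)" "lead_coeff Q = 1"
  shows "lcoef Q k = leg 1 (-1 :: 'a alg_closure) ^ (k * degree Q) * jsum Q k"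
proof -
  have "jac Q f = leg 1 (-1 :: 'a alg_closure) ^ (k * degree Q) * jac f Q" if "f \<in> monics k" for f
    using jac_recip[OF assms(1,2), of f] that by (auto simp: monics_def mult.commute)
  thus ?thesis unfolding lcoef_def jsum_def sum_distrib_left by (intro sum.cong) auto
qed

lemma lcoef_0 [simp]: "lcoef Q 0 = 1"
  by (simp add: lcoef_def)

lemma jsum_0 [simp]: "jsum Q 0 = 1"
  by (simp add: jsum_def)

abbreviation irr_le :: "nat \<Rightarrow> 'a::{field,finite} poly set" where
  "irr_le k \<equiv> {P. monic_irreducible P \<and> degree P \<le> k}"

section \<open>Multiplicities of irreducible factors\<close>

definition pmult :: "'a::{field,finite} poly \<Rightarrow> 'a poly \<Rightarrow> nat" where
  "pmult P f = (SOME m. \<exists>g. f = P ^ m * g \<and> \<not> P dvd g)"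

lemma pmult_decompose_ex:
  fixes P :: "'a::{field,finite} poly"
  assumes P: "monic_irreducible P" and "f \<noteq> 0"
  shows "\<exists>m g. f = P ^ m * g \<and> \<not> P dvd g"
  using assms(2)
proof (induction "degree f" arbitrary: f rule: less_induct)
  case less
  show ?case
  proof (cases "P dvd f")
    case True
    then obtain h where h: "f = P * h" by (elim dvdE)
    hence "h \<noteq> 0" using less.prems by auto
    moreover from this have "degree h < degree f"
      using monic_irreducibleD(4,5)[OF P] by (simp add: h degree_mult_eq)
    ultimately obtain m g where "h = P ^ m * g" "\<not> P dvd g" using less.hyps by blast
    thus ?thesis using h by (intro exI[of _ "Suc m"] exI[of _ g]) simp
  qed (intro exI[of _ 0] exI[of _ f], simp)
qed

lemma pmult_decompose:
  assumes "monic_irreducible P" "f \<noteq> 0"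
  obtains g where "f = P ^ pmult P f * g" "\<not> P dvd g"
  using someI_ex[OF pmult_decompose_ex[OF assms]] that unfolding pmult_def by blast

lemma power_dvd_iff_le_pmult:
  assumes P: "monic_irreducible P" and f: "f \<noteq> 0"
  shows "P ^ n dvd f \<longleftrightarrow> n \<le> pmult P f"
proof -
  obtain g where g: "f = P ^ pmult P f * g" "\<not> P dvd g" using pmult_decompose[OF assms] .
  have P0: "P \<noteq> 0" using monic_irreducibleD[OF P] by simp
  show ?thesis
  proof
    assume "P ^ n dvd f"
    show "n \<le> pmult P f"
    proof (rule ccontr)
      assume "\<not> n \<le> pmult P f"
      hence "P ^ Suc (pmult P f) dvd P ^ n" by (intro le_imp_power_dvd) simp
      hence "P ^ pmult P f * P dvd P ^ pmult P f * g"
        using \<open>P ^ n dvd f\<close> g(1) dvd_trans by (metis power_Suc2)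
      thus False using g(2) P0 by simp
    qed
  next
    assume "n \<le> pmult P f"
    thus "P ^ n dvd f" by (subst g(1)) (intro dvd_mult2 le_imp_power_dvd)
  qed
qed

lemma pmult_eqI:
  assumes P: "monic_irreducible P" and g: "\<not> P dvd g"
  shows "pmult P (P ^ m * g) = m"
proof -
  have P0: "P \<noteq> 0" "g \<noteq> 0" using monic_irreducibleD[OF P] g by auto
  hence "P ^ n dvd P ^ m * g \<longleftrightarrow> n \<le> pmult P (P ^ m * g)" for n
    by (intro power_dvd_iff_le_pmult[OF P]) simp
  moreover have "P ^ m dvd P ^ m * g" by simp
  moreover have "\<not> P ^ Suc m dvd P ^ m * g" using P0 g by (simp only: power_Suc2 dvd_mult_cancel_left) simp
  ultimately show ?thesis by (meson le_antisym not_less_eq_eq)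
qed

lemma pmult_eq_0:
  assumes "monic_irreducible P" "\<not> P dvd g"
  shows "pmult P g = 0"
  using pmult_eqI[OF assms, of 0] by simp

lemma pmult_mult:
  assumes P: "monic_irreducible P" and "f \<noteq> 0" "g \<noteq> 0"
  shows "pmult P (f * g) = pmult P f + pmult P g"
proof -
  obtain a where a: "f = P ^ pmult P f * a" "\<not> P dvd a" using pmult_decompose assms by blast
  obtain b where b: "g = P ^ pmult P g * b" "\<not> P dvd b" using pmult_decompose assms by blast
  have "f * g = P ^ (pmult P f + pmult P g) * (a * b)"
    by (subst a(1), subst b(1)) (simp add: power_add mult_ac)
  moreover have "\<not> P dvd a * b"
    using a b monic_irreducibleD(3)[OF P] prime_elem_dvd_multD by blast
  ultimately show ?thesis using pmult_eqI[OF P] by metis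
qed

lemma pmult_irreducible:
  fixes P :: "'a::{field,finite} poly"
  assumes "monic_irreducible P" "monic_irreducible R"
  shows "pmult P R = (if P = R then 1 else 0)"
proof (cases "P = R")
  case True
  have "\<not> P dvd 1" using monic_irreducibleD(2)[OF assms(1)] irreducible_not_unit by blast
  thus ?thesis using pmult_eqI[OF assms(1), of 1 1] True by simp
next
  case False
  hence "\<not> P dvd R" using monic_irreducible_dvd_eq assms by blast
  thus ?thesis using False by (simp add: pmult_eq_0[OF assms(1)])
qed

lemma degree_eq_sum_pmult:
  fixes f :: "'a::{field,finite} poly"
  assumes "lead_coeff f = 1" "degree f \<le> k"
  shows "degree f = (\<Sum>P\<in>irr_le k. pmult P f * degree P)"
  using assms
proof (induction f rule: monic_induct)
  case one
  have "pmult P 1 = 0" if "monic_irreducible P" for P :: "'a poly"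
    using irreducible_not_unit monic_irreducibleD(2)[OF that] by (intro pmult_eq_0[OF that]) blast
  thus ?case by simp
next
  case (mult R g)
  note Rd = monic_irreducibleD[OF mult(1)]
  have g0: "g \<noteq> 0" using mult by auto
  have deg: "degree (R * g) = degree R + degree g" using Rd g0 by (simp add: degree_mult_eq)
  have "(\<Sum>P\<in>irr_le k. pmult P (R * g) * degree P)
      = (\<Sum>P\<in>irr_le k. (if P = R then degree R else 0) + pmult P g * degree P)"
  proof (rule sum.cong)
    fix P :: "'a poly" assume "P \<in> irr_le k"
    hence P: "monic_irreducible P" by simp
    have "pmult P (R * g) = pmult P R + pmult P g"
      using Rd g0 by (intro pmult_mult[OF P]) auto
    thus "pmult P (R * g) * degree P = (if P = R then degree R else 0) + pmult P g * degree P"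
      by (simp add: pmult_irreducible[OF P mult(1)])
  qed simp
  also have "\<dots> = degree R + degree g"
    using mult deg by (simp add: sum.distrib sum.delta[OF finite_irreds_le])
  finally show ?case by (simp add: deg)
qed

lemma jac_power_den:
  fixes P :: "'a::{field,finite} poly"
  assumes "odd CARD('a)" "lead_coeff P = 1"
  shows "jac f (P ^ e) = jac f P ^ e"
  using assms by (induction e) (simp_all add: jac_mult_den lead_coeff_power)

lemma sum_multiples_irreducible_power:
  fixes Q P :: "'a::{field,finite} poly"
  assumes q: "odd CARD('a)" and P: "lead_coeff P = 1"
  shows "(\<Sum>f | f \<in> monics k \<and> P ^ e dvd f. jac Q f)
    = (if e * degree P \<le> k then jac Q P ^ e * lcoef Q (k - e * degree P) else 0)"
proof -
  have P0: "P \<noteq> 0" using P by auto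
  have Pe: "P ^ e \<in> monics (e * degree P)"
    using P P0 monics_degree[of "P ^ e"] lead_coeff_power[of P e] by (simp add: degree_power_eq)
  have Pel: "lead_coeff (P ^ e) = 1" using P by (simp add: lead_coeff_power)
  have Pe0: "P ^ e \<noteq> 0" using P0 by simp
  show ?thesis
  proof (cases "e * degree P \<le> k")
    case True
    have "{f. f \<in> monics k \<and> P ^ e dvd f} = (\<lambda>g. P ^ e * g) ` monics (k - e * degree P)"
    proof (intro equalityI subsetI)
      fix f assume "f \<in> {f. f \<in> monics k \<and> P ^ e dvd f}"
      then obtain g where g: "f = P ^ e * g" and f: "f \<in> monics k" by (auto elim: dvdE)
      have "lead_coeff g = 1" using f Pel unfolding g by (auto simp: monics_def intro: monic_cofactor)
      moreover have "k = degree (P ^ e) + degree g"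
        using f g Pe0 monics_nonzero[OF f] by (auto simp: monics_def degree_mult_eq)
      hence "degree g = k - e * degree P" using Pe by (simp add: monics_def)
      ultimately show "f \<in> (\<lambda>g. P ^ e * g) ` monics (k - e * degree P)" using g by (auto simp: monics_def)
    next
      fix f assume "f \<in> (\<lambda>g. P ^ e * g) ` monics (k - e * degree P)"
      thus "f \<in> {f. f \<in> monics k \<and> P ^ e dvd f}" using monics_mult[OF Pe, of _ "k - e * degree P"] True by auto
    qed
    moreover have "inj_on (\<lambda>g. P ^ e * g) (monics (k - e * degree P))"
      using P0 by (auto simp: inj_on_def)
    ultimately have "(\<Sum>f | f \<in> monics k \<and> P ^ e dvd f. jac Q f)
        = (\<Sum>g\<in>monics (k - e * degree P). jac Q (P ^ e * g))"
      by (simp add: sum.reindex)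
    also have "\<dots> = (\<Sum>g\<in>monics (k - e * degree P). jac Q P ^ e * jac Q g)"
      using q P Pel by (intro sum.cong) (auto simp: jac_mult_den jac_power_den monics_def)
    finally show ?thesis using True by (simp add: lcoef_def sum_distrib_left)
  next
    case False
    have "\<not> P ^ e dvd f" if "f \<in> monics k" for f
      using dvd_imp_degree_le[of "P ^ e" f] that Pe False monics_nonzero[OF that] by (auto simp: monics_def)
    hence "{f. f \<in> monics k \<and> P ^ e dvd f} = {}" by blast
    thus ?thesis using False by (simp only: sum.empty if_False)
  qed
qed

text \<open>Newton's identities for the L-series. The factor k is expanded as the sum of
  \<open>degree P\<close> over all pairs (P, e) with \<open>P ^ e dvd f\<close>; exchanging sums and
  dividing out \<open>P ^ e\<close> leaves prime powers of degree m = e * degree P, which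
  \<open>charsum_eq\<close> collects into \<open>charsum m Q\<close>.\<close>

lemma lcoef_recurrence:
  fixes Q :: "'a::{field,finite} poly"
  assumes q: "odd CARD('a)"
  shows "int k * lcoef Q k = (\<Sum>m=1..k. charsum m Q * lcoef Q (k - m))"
proof -
  let ?F = "\<lambda>P m. int (degree P) * (jac Q P ^ (m div degree P) * lcoef Q (k - m))"
  have fin: "finite (irr_le k :: 'a poly set)" by (rule finite_irreds_le)
  have "int k * lcoef Q k = (\<Sum>f\<in>monics k. \<Sum>P\<in>irr_le k. \<Sum>e\<in>{1..k}.
          if P ^ e dvd f then int (degree P) * jac Q f else 0)"
    unfolding lcoef_def sum_distrib_left
  proof (rule sum.cong)
    fix f :: "'a poly" assume f: "f \<in> monics k"
    hence f0: "f \<noteq> 0" by (rule monics_nonzero)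
    have "(\<Sum>e\<in>{1..k}. if P ^ e dvd f then int (degree P) * jac Q f else 0)
        = int (pmult P f * degree P) * jac Q f" if P: "P \<in> irr_le k" for P
    proof -
      note Pd = monic_irreducibleD[of P]
      have iff: "P ^ e dvd f \<longleftrightarrow> e \<le> pmult P f" for e
        using f0 P by (intro power_dvd_iff_le_pmult) auto
      hence "P ^ pmult P f dvd f" by blast
      hence "degree (P ^ pmult P f) \<le> k"
        using dvd_imp_degree_le f0 f by (auto simp: monics_def)
      hence "pmult P f * degree P \<le> k" using P Pd by (simp add: degree_power_eq)
      moreover have "pmult P f * 1 \<le> pmult P f * degree P"
        using P Pd by (intro mult_left_mono) (auto simp: Suc_le_eq)
      ultimately have "pmult P f \<le> k" by linarith
      hence "{e \<in> {1..k}. e \<le> pmult P f} = {1..pmult P f}" by auto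
      thus ?thesis by (simp add: iff flip: sum.inter_filter)
    qed
    hence "(\<Sum>P\<in>irr_le k. \<Sum>e\<in>{1..k}. if P ^ e dvd f then int (degree P) * jac Q f else 0)
        = (\<Sum>P\<in>irr_le k. int (pmult P f * degree P) * jac Q f)"
      by (rule sum.cong[OF refl])
    also have "\<dots> = int (\<Sum>P\<in>irr_le k. pmult P f * degree P) * jac Q f"
      by (simp only: sum_distrib_right of_nat_sum)
    also have "(\<Sum>P\<in>irr_le k. pmult P f * degree P) = k"
      using degree_eq_sum_pmult[of f k] f by (auto simp: monics_def)
    finally show "int k * jac Q f
        = (\<Sum>P\<in>irr_le k. \<Sum>e\<in>{1..k}. if P ^ e dvd f then int (degree P) * jac Q f else 0)" ..
  qed simp
  also have "\<dots> = (\<Sum>P\<in>irr_le k. \<Sum>e\<in>{1..k}. \<Sum>f\<in>monics k.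
          if P ^ e dvd f then int (degree P) * jac Q f else 0)"
    by (subst sum.swap, rule sum.cong[OF refl], rule sum.swap)
  also have "\<dots> = (\<Sum>P\<in>irr_le k. \<Sum>e\<in>{1..k}. if e * degree P \<le> k then ?F P (e * degree P) else 0)"
  proof (intro sum.cong refl)
    fix P :: "'a poly" and e assume P: "P \<in> irr_le k"
    have "(\<Sum>f\<in>monics k. if P ^ e dvd f then int (degree P) * jac Q f else 0)
        = int (degree P) * (\<Sum>f | f \<in> monics k \<and> P ^ e dvd f. jac Q f)"
      by (simp add: sum_distrib_left flip: sum.inter_filter)
    also have "\<dots> = (if e * degree P \<le> k then ?F P (e * degree P) else 0)"
      using P monic_irreducibleD(1,5)[of P] by (subst sum_multiples_irreducible_power[OF q]) auto
    finally show "(\<Sum>f\<in>monics k. if P ^ e dvd f then int (degree P) * jac Q f else 0)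
        = (if e * degree P \<le> k then ?F P (e * degree P) else 0)" .
  qed
  also have "\<dots> = (\<Sum>P\<in>irr_le k. \<Sum>m\<in>{1..k}. if degree P dvd m then ?F P m else 0)"
  proof (rule sum.cong)
    fix P :: "'a poly" assume "P \<in> irr_le k"
    hence d: "degree P > 0" using monic_irreducibleD(5)[of P] by auto
    have "(\<Sum>e | e \<in> {1..k} \<and> e * degree P \<le> k. ?F P (e * degree P)) = (\<Sum>m | m \<in> {1..k} \<and> degree P dvd m. ?F P m)"
      by (rule sum.reindex_bij_witness[of _ "\<lambda>m. m div degree P" "\<lambda>e. e * degree P"])
         (use d in \<open>auto simp: Suc_le_eq div_greater_zero_iff dvd_imp_le intro: order_trans[OF div_le_dividend]\<close>)
    thus "(\<Sum>e\<in>{1..k}. if e * degree P \<le> k then ?F P (e * degree P) else 0)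
        = (\<Sum>m\<in>{1..k}. if degree P dvd m then ?F P m else 0)"
      by (simp only: sum.inter_filter finite_atLeastAtMost)
  qed simp
  also have "\<dots> = (\<Sum>m\<in>{1..k}. \<Sum>P\<in>irr_le k. if degree P dvd m then ?F P m else 0)"
    by (rule sum.swap)
  also have "\<dots> = (\<Sum>m\<in>{1..k}. charsum m Q * lcoef Q (k - m))"
  proof (rule sum.cong)
    fix m assume m: "m \<in> {1..k}"
    have "{P \<in> irr_le k. degree P dvd m} = (irreds m :: 'a poly set)"
      using m dvd_imp_le[of _ m] order_trans[of _ m k] by (fastforce simp: irreds_def)
    hence "(\<Sum>P\<in>irr_le k. if degree P dvd m then ?F P m else 0) = (\<Sum>P\<in>irreds m. ?F P m)"
      using fin by (simp flip: sum.inter_filter)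
    also have "\<dots> = charsum m Q * lcoef Q (k - m)"
      using m by (simp add: charsum_eq[OF q] sum_distrib_right mult.assoc)
    finally show "(\<Sum>P\<in>irr_le k. if degree P dvd m then ?F P m else 0) = charsum m Q * lcoef Q (k - m)" .
  qed simp
  finally show ?thesis .
qed

subsection \<open>Vanishing of the high coefficients\<close>

text \<open>\<open>jac u Q \<noteq> 0\<close> plays the part of coprimality: no irreducible factor
  of Q divides u, so the factors can be cancelled one at a time.\<close>

lemma dvd_mult_coprime_jac:
  fixes Q :: "'a::{field,finite} poly"
  assumes q: "odd CARD('a)" and Q: "lead_coeff Q = 1"
  shows "jac u Q \<noteq> 0 \<Longrightarrow> Q dvd u * h \<Longrightarrow> Q dvd h"
  using Q
proof (induction Q arbitrary: h rule: monic_induct)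
  case (mult P g)
  note Pd = monic_irreducibleD[OF mult(1)]
  have j: "jac u P \<noteq> 0" "jac u g \<noteq> 0"
    using mult.prems(1) jac_mult_den[OF q Pd(1) mult(2)] by auto
  have "P dvd u * h" using mult.prems(2) dvd_mult_left by blast
  moreover have "\<not> P dvd u" using j(1) jac_eq_0_iff[OF q mult(1)] by blast
  ultimately have "P dvd h" using Pd(3) prime_elem_dvd_multD by blast
  then obtain h' where h': "h = P * h'" by (elim dvdE)
  have "u * h = P * (u * h')" by (simp only: h' mult.left_commute)
  hence "P * g dvd P * (u * h')" using mult.prems(2) by (simp only:)
  hence "g dvd u * h'" using Pd(4) dvd_times_left_cancel_iff by blast
  hence "g dvd h'" by (rule mult.IH[OF j(2)])
  thus ?case unfolding h' by (rule mult_dvd_mono[OF dvd_refl])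
qed simp

lemma sum_residues_mult:
  fixes Q :: "'a::{field,finite} poly"
  assumes q: "odd CARD('a)" and Q: "lead_coeff Q = 1" and u: "jac u Q \<noteq> 0"
  shows "(\<Sum>f\<in>polys_lt (degree Q). G ((u * f) mod Q)) = (\<Sum>f\<in>polys_lt (degree Q). G f)"
proof -
  have Q0: "Q \<noteq> 0" using Q by auto
  let ?V = "polys_lt (degree Q) :: 'a poly set" and ?m = "\<lambda>f. (u * f) mod Q"
  have "inj_on ?m ?V"
  proof (rule inj_onI)
    fix f g assume fg: "f \<in> ?V" "g \<in> ?V" "?m f = ?m g"
    hence "Q dvd u * (f - g)" by (simp add: mod_eq_dvd_iff algebra_simps)
    hence "Q dvd f - g" using dvd_mult_coprime_jac[OF q Q u] by blast
    hence "f mod Q = g mod Q" by (simp add: mod_eq_dvd_iff)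
    thus "f = g" using fg by (simp add: mod_eq_self)
  qed
  moreover have "?m ` ?V \<subseteq> ?V" using Q0 by auto
  ultimately have "bij_betw ?m ?V ?V"
    by (simp add: bij_betw_def endo_inj_surj)
  thus ?thesis by (rule sum.reindex_bij_betw)
qed

text \<open>Multiplication by u permutes the residues and changes the sign of every symbol.\<close>

lemma sum_jac_residues:
  fixes Q :: "'a::{field,finite} poly"
  assumes q: "odd CARD('a)" and Q: "lead_coeff Q = 1" and u: "jac u Q = -1"
  shows "(\<Sum>f\<in>polys_lt (degree Q). jac f Q) = 0"
proof -
  have Q0: "Q \<noteq> 0" using Q by auto
  have "(\<Sum>f\<in>polys_lt (degree Q). jac f Q) = (\<Sum>f\<in>polys_lt (degree Q). jac ((u * f) mod Q) Q)"
    using u by (intro sum_residues_mult[OF q Q, symmetric]) simp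
  also have "\<dots> = - (\<Sum>f\<in>polys_lt (degree Q). jac f Q)"
    using Q0 u by (simp add: jac_mod jac_mult_num[OF q Q] sum_negf)
  finally show ?thesis by simp
qed

lemma bij_residues_monics:
  fixes Q :: "'a::{field,finite} poly"
  assumes Q: "lead_coeff Q = 1" and k: "k \<ge> degree Q"
  shows "bij_betw (\<lambda>(h, r). Q * h + r) (monics (k - degree Q) \<times> polys_lt (degree Q)) (monics k)"
proof -
  let ?N = "degree Q" and ?g = "\<lambda>(h, r). Q * h + r"
  let ?D = "monics (k - ?N) \<times> polys_lt ?N :: ('a poly \<times> 'a poly) set"
  have Q0: "Q \<noteq> 0" using Q by auto
  have inj: "inj_on ?g ?D"
  proof (rule inj_onI, clarify)
    fix h r h' r' :: "'a poly"
    assume *: "r \<in> polys_lt ?N" "r' \<in> polys_lt ?N" "Q * h + r = Q * h' + r'"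
    hence "(Q * h + r) mod Q = (Q * h' + r') mod Q" by simp
    hence "r mod Q = r' mod Q" by (simp only: mod_mult_self4)
    hence "r = r'" using * by (simp add: mod_eq_self)
    thus "h = h' \<and> r = r'" using * Q0 by simp
  qed
  have "?g ` ?D \<subseteq> monics k"
  proof (intro subsetI, elim imageE, clarify)
    fix h r :: "'a poly" assume h: "h \<in> monics (k - ?N)" and r: "r \<in> polys_lt ?N"
    have Qh: "Q * h \<in> monics k" using monics_mult[OF monics_degree[OF Q] h] k by simp
    have "r \<in> polys_lt k" using r k polys_lt_mono by blast
    hence "(Q * h - monom 1 k) + r \<in> polys_lt k"
      using Qh by (intro polys_lt_closed(1)) (simp_all add: in_monics_iff)
    thus "Q * h + r \<in> monics k" by (simp add: in_monics_iff algebra_simps)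
  qed
  moreover have "card (?g ` ?D) = card (monics k :: 'a poly set)"
    using k by (subst card_image[OF inj]) (simp add: card_cartesian_product card_monics card_polys_lt flip: power_add)
  ultimately have "?g ` ?D = monics k" by (intro card_subset_eq) simp_all
  thus ?thesis using inj by (simp add: bij_betw_def)
qed

text \<open>From degree deg Q on, monic polynomials are spread evenly over the residue classes
  modulo Q, so the sum is a multiple of the full residue sum.\<close>

lemma jsum_eq_0:
  fixes Q :: "'a::{field,finite} poly"
  assumes q: "odd CARD('a)" and Q: "lead_coeff Q = 1" and u: "jac u Q = -1" and k: "k \<ge> degree Q"
  shows "jsum Q k = 0"
proof -
  let ?N = "degree Q" and ?g = "\<lambda>(h, r). Q * h + r"
  have Q0: "Q \<noteq> 0" using Q by auto
  have "jsum Q k = (\<Sum>p\<in>monics (k - ?N) \<times> polys_lt ?N. jac (?g p) Q)"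
    unfolding jsum_def by (rule sum.reindex_bij_betw[OF bij_residues_monics[OF Q k], symmetric])
  also have "\<dots> = (\<Sum>(h :: 'a poly, r)\<in>monics (k - ?N) \<times> polys_lt ?N. jac r Q)"
    using Q0 by (auto intro!: sum.cong jac_cong)
  also have "\<dots> = (\<Sum>h\<in>(monics (k - ?N) :: 'a poly set). \<Sum>r\<in>polys_lt ?N. jac r Q)"
    by (rule sum.cartesian_product[symmetric])
  also have "\<dots> = 0" using sum_jac_residues[OF q Q u] by simp
  finally show ?thesis .
qed

text \<open>A Chinese remainder argument: \<open>1 + R * t\<close> runs through all residues modulo
  P, since R is invertible there, so some t makes it a nonresidue. The odd exponent preserves the
  sign in the symbol modulo \<open>P ^ e * R\<close>.\<close>

lemma exists_unit_minus_one:
  fixes P R :: "'a::{field,finite} poly"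
  assumes q: "odd CARD('a)" and P: "monic_irreducible P" and R: "lead_coeff R = 1" "\<not> P dvd R"
    and e: "odd e"
  obtains u where "R dvd u - 1" "jac u P = -1" "jac u (P ^ e * R) = -1"
proof -
  note Pd = monic_irreducibleD[OF P]
  let ?V = "polys_lt (degree P) :: 'a poly set" and ?m = "\<lambda>t. (1 + R * t) mod P"
  have "inj_on ?m ?V"
  proof (rule inj_onI)
    fix f g assume fg: "f \<in> ?V" "g \<in> ?V" "?m f = ?m g"
    hence "P dvd R * (f - g)" by (simp add: mod_eq_dvd_iff algebra_simps)
    hence "P dvd f - g" using Pd(3) R(2) prime_elem_dvd_multD by blast
    hence "f mod P = g mod P" by (simp add: mod_eq_dvd_iff)
    thus "f = g" using fg by (simp add: mod_eq_self)
  qed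
  moreover have "?m ` ?V \<subseteq> ?V" using Pd by auto
  ultimately have surj: "?m ` ?V = ?V" by (intro endo_inj_surj) auto
  obtain f where f: "f \<in> ?V" "jac f P = -1" using exists_nonresidue[OF q P] .
  hence "f \<in> ?m ` ?V" by (simp only: surj)
  then obtain t where t: "(1 + R * t) mod P = f" by auto
  let ?u = "1 + R * t"
  have uP: "jac ?u P = -1" using t f jac_mod[OF Pd(4), of ?u] by simp
  have "jac ?u R = jac 1 R" using R by (intro jac_cong) auto
  hence "jac ?u (P ^ e * R) = -1"
    using uP e Pd R by (simp add: jac_mult_den[OF q] jac_power_den[OF q] lead_coeff_power)
  thus ?thesis using that[of ?u] uP by simp
qed

text \<open>If all multiplicities were even, stripping factors P^2 one by one would exhibit Q as a
  square.\<close>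

lemma nonsquare_odd_pmult:
  fixes Q :: "'a::{field,finite} poly"
  assumes "lead_coeff Q = 1" "\<nexists>A. Q = A\<^sup>2"
  obtains P where "monic_irreducible P" "odd (pmult P Q)"
proof -
  have "(\<forall>P. monic_irreducible P \<longrightarrow> even (pmult P Q)) \<Longrightarrow> \<exists>A. Q = A\<^sup>2"
    using assms(1)
  proof (induction "degree Q" arbitrary: Q rule: less_induct)
    case less
    show ?case
    proof (cases "degree Q = 0")
      case True
      with less.prems have "Q \<in> monics 0" by (simp add: monics_def)
      thus ?thesis by (intro exI[of _ 1]) simp
    next
      case False
      then obtain P where P: "monic_irreducible P" "P dvd Q"
        using exists_monic_irreducible_factor by blast
      note Pd = monic_irreducibleD[OF P(1)]
      have Q0: "Q \<noteq> 0" using less.prems by auto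
      have "pmult P Q \<ge> 1"
        using power_dvd_iff_le_pmult[OF P(1) Q0, of 1] P by simp
      moreover have "even (pmult P Q)" using less.prems(1) P(1) by blast
      ultimately have "pmult P Q \<ge> 2" by presburger
      hence "P ^ 2 dvd Q" using power_dvd_iff_le_pmult[OF P(1) Q0] by blast
      then obtain g where g: "Q = P ^ 2 * g" by (elim dvdE)
      have g0: "g \<noteq> 0" using g Q0 by auto
      have lg: "lead_coeff g = 1"
        using less.prems(2) Pd(1) lead_coeff_power[of P 2] monic_cofactor[of "P ^ 2" g] by (simp add: g)
      have "degree g < degree Q" using Pd g0 by (simp add: g degree_mult_eq degree_power_eq)
      moreover have "even (pmult S g)" if "monic_irreducible S" for S
      proof -
        note Sd = monic_irreducibleD[OF that]
        have "pmult S Q = pmult S (P ^ 2) + pmult S g"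
          unfolding g using Pd g0 by (intro pmult_mult[OF that]) auto
        also have "pmult S (P ^ 2) = 2 * pmult S P"
          using Pd by (simp add: power2_eq_square pmult_mult[OF that])
        finally show ?thesis using less.prems(1) that by auto
      qed
      ultimately obtain A where "g = A\<^sup>2" using less.hyps lg by blast
      hence "Q = (P * A)\<^sup>2" using g by (simp add: power_mult_distrib)
      thus ?thesis ..
    qed
  qed
  thus ?thesis using assms that by blast
qed

lemma nonsquare_exists_minus_one:
  fixes Q :: "'a::{field,finite} poly"
  assumes q: "odd CARD('a)" and Q: "lead_coeff Q = 1" "\<nexists>A. Q = A\<^sup>2"
  obtains u where "jac u Q = -1"
proof -
  obtain P where P: "monic_irreducible P" and odd: "odd (pmult P Q)"
    using nonsquare_odd_pmult[OF Q] .
  note Pd = monic_irreducibleD[OF P]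
  have Q0: "Q \<noteq> 0" using Q by auto
  obtain R where R: "Q = P ^ pmult P Q * R" "\<not> P dvd R"
    using pmult_decompose[OF P Q0] .
  have "lead_coeff (P ^ pmult P Q) = 1" using Pd by (simp add: lead_coeff_power)
  hence "lead_coeff R = 1" using monic_cofactor[of "P ^ pmult P Q" R] Q R(1) by metis
  from exists_unit_minus_one[OF q P this R(2) odd] show ?thesis using that R(1) by metis
qed

lemma lcoef_eq_0:
  fixes Q :: "'a::{field,finite} poly"
  assumes "odd CARD('a)" "lead_coeff Q = 1" "\<nexists>A. Q = A\<^sup>2" "k \<ge> degree Q"
  shows "lcoef Q k = 0"
proof -
  obtain u where "jac u Q = -1" using nonsquare_exists_minus_one assms by blast
  thus ?thesis using jsum_eq_0 lcoef_eq_jsum assms by (metis mult_zero_right)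
qed

subsection \<open>Inverse roots\<close>

text \<open>Since the constant term is 1, no root is 0 and each linear factor can be normalised to 1
  - a X. If the degree is below \<open>d\<close>, the list is padded with a = 0.\<close>

lemma complex_poly_inverse_roots:
  fixes p :: "complex poly"
  assumes "coeff p 0 = 1" "degree p \<le> d"
  shows "\<exists>\<alpha>. p = (\<Prod>i<d. [:1, - \<alpha> i:])"
  using assms
proof (induction d arbitrary: p)
  case 0
  then obtain c where "p = [:c:]" by (auto elim: degree_eq_zeroE)
  thus ?case using 0 by (simp add: one_pCons)
next
  case (Suc d)
  show ?case
  proof (cases "degree p = 0")
    case True
    then obtain c where "p = [:c:]" by (auto elim: degree_eq_zeroE)
    hence "p = 1" using Suc by (simp add: one_pCons)
    thus ?thesis by (intro exI[of _ "\<lambda>_. 0"]) (simp add: one_pCons[symmetric])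
  next
    case False
    then obtain z where z: "poly p z = 0" using alg_closed_imp_poly_has_root[of p] by auto
    then obtain r where r: "p = [:-z, 1:] * r" by (auto simp: poly_eq_0_iff_dvd elim: dvdE)
    have z0: "z \<noteq> 0" using z Suc.prems(1) by (auto simp: poly_0_coeff_0)
    have r0: "r \<noteq> 0" using r Suc.prems by auto
    define r' where "r' = smult (-z) r"
    have "[:-z, 1:] = smult (-z) [:1, - (1 / z):]" using z0 by simp
    hence p: "p = [:1, - (1 / z):] * r'" unfolding r r'_def by (simp only: mult_smult_left mult_smult_right)
    have "degree p = 1 + degree r'" using z0 r0 by (simp add: p degree_mult_eq r'_def del: mult_pCons_left)
    moreover have "coeff r' 0 = 1" using Suc.prems(1) by (simp add: p coeff_mult)
    ultimately obtain \<alpha> where \<alpha>: "r' = (\<Prod>i<d. [:1, - \<alpha> i:])" using Suc by force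
    have "p = (\<Prod>i<Suc d. [:1, - (\<alpha>(d := 1 / z)) i:])" unfolding p \<alpha> by (simp add: mult.commute)
    thus ?thesis by blast
  qed
qed

lemma fps_log_deriv_unique:
  fixes F S T :: "complex fps"
  assumes "fps_X * fps_deriv F = S * F" "fps_X * fps_deriv F = T * F" "F \<noteq> 0"
  shows "S = T"
  using assms by simp

text \<open>The series a u / (1 - a u), that is, minus u times the logarithmic derivative of 1 - a
  u. Sums of such series have power sums as coefficients.\<close>

definition pow_fps :: "complex \<Rightarrow> complex fps" where
  "pow_fps a = Abs_fps (\<lambda>m. if m = 0 then 0 else a ^ m)"

lemma pow_fps_mult: "(1 - fps_const a * fps_X) * pow_fps a = fps_const a * fps_X"
proof -
  have "pow_fps a = fps_const a * fps_X * (1 + pow_fps a)"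
    by (rule fps_ext) (auto simp: pow_fps_def mult.assoc fps_X_mult_nth power_eq_if)
  thus ?thesis by (simp add: algebra_simps)
qed

lemma fps_log_deriv_prod:
  fixes \<alpha> :: "nat \<Rightarrow> complex"
  shows "fps_X * fps_deriv (\<Prod>i<d. 1 - fps_const (\<alpha> i) * fps_X)
    = (- (\<Sum>i<d. pow_fps (\<alpha> i))) * (\<Prod>i<d. 1 - fps_const (\<alpha> i) * fps_X)"
proof (induction d)
  case (Suc d)
  let ?F = "\<Prod>i<d. 1 - fps_const (\<alpha> i) * fps_X" and ?l = "1 - fps_const (\<alpha> d) * fps_X"
  have "fps_X * fps_deriv (?F * ?l) = (fps_X * fps_deriv ?F) * ?l - ?F * (fps_const (\<alpha> d) * fps_X)"
    by (simp add: algebra_simps)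
  also have "\<dots> = (fps_X * fps_deriv ?F) * ?l - ?F * (?l * pow_fps (\<alpha> d))"
    by (simp only: pow_fps_mult)
  also have "\<dots> = (- (\<Sum>i<Suc d. pow_fps (\<alpha> i))) * (?F * ?l)"
    unfolding Suc by (simp add: algebra_simps)
  finally show ?case by simp
qed simp

text \<open>u L'/L is computed twice. The recurrence gives the character sums as its coefficients;
  the factorisation of L, a polynomial of degree less than deg Q, gives minus the power sums of the
  inverse roots.\<close>

theorem exists_inverse_roots:
  fixes Q :: "'a::{field,finite} poly"
  assumes q: "odd CARD('a)" and Q: "lead_coeff Q = 1" "\<nexists>A. Q = A\<^sup>2"
  shows "\<exists>\<alpha>. Abs_fps (\<lambda>k. of_int (lcoef Q k)) = (\<Prod>i<degree Q - 1. 1 - fps_const (\<alpha> i) * fps_X :: complex fps)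
    \<and> (\<forall>m>0. of_int (charsum m Q) = - (\<Sum>i<degree Q - 1. \<alpha> i ^ m))"
proof -
  let ?d = "degree Q - 1"
  have dQ: "degree Q > 0"
  proof (rule ccontr)
    assume "\<not> degree Q > 0"
    hence "Q \<in> monics 0" using Q by (simp add: monics_def)
    hence "Q = 1\<^sup>2" by simp
    thus False using Q by blast
  qed
  define F :: "complex fps" where "F = Abs_fps (\<lambda>k. of_int (lcoef Q k))"
  define p :: "complex poly" where "p = (\<Sum>k<degree Q. monom (of_int (lcoef Q k)) k)"
  have coeff_p: "coeff p k = of_int (lcoef Q k)" for k
    using lcoef_eq_0[OF q Q, of k] by (simp add: p_def coeff_sum if_distrib cong: if_cong)
  have "degree p \<le> ?d"
    by (rule degree_le) (use lcoef_eq_0[OF q Q] dQ in \<open>auto simp: coeff_p\<close>)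
  then obtain \<alpha> where \<alpha>: "p = (\<Prod>i<?d. [:1, - \<alpha> i:])"
    using complex_poly_inverse_roots[of p ?d] coeff_p[of 0] by auto
  have "F = fps_of_poly p" by (rule fps_ext) (simp add: F_def coeff_p)
  also have "\<dots> = (\<Prod>i<?d. fps_of_poly [:1, - \<alpha> i:])" unfolding \<alpha> by (rule fps_of_poly_prod)
  also have "\<dots> = (\<Prod>i<?d. 1 - fps_const (\<alpha> i) * fps_X)"
    by (intro prod.cong refl) (simp add: fps_of_poly_pCons fps_of_poly_const fps_const_neg[symmetric] del: fps_const_neg)
  finally have F: "F = (\<Prod>i<?d. 1 - fps_const (\<alpha> i) * fps_X)" .
  define S :: "complex fps" where "S = Abs_fps (\<lambda>m. if m = 0 then 0 else of_int (charsum m Q))"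
  have "fps_X * fps_deriv F = S * F"
  proof (rule fps_ext)
    fix n
    have "(S * F) $ n = (\<Sum>m=0..n. (if m = 0 then 0 else of_int (charsum m Q)) * of_int (lcoef Q (n - m)))"
      by (simp add: fps_mult_nth S_def F_def)
    also have "\<dots> = (\<Sum>m=1..n. of_int (charsum m Q * lcoef Q (n - m)))"
      by (rule sum.mono_neutral_cong_right) auto
    also have "\<dots> = of_int (int n * lcoef Q n)"
      by (simp only: lcoef_recurrence[OF q] of_int_sum)
    also have "\<dots> = (fps_X * fps_deriv F) $ n" by (cases n) (simp_all add: F_def)
    finally show "(fps_X * fps_deriv F) $ n = (S * F) $ n" ..
  qed
  moreover have "fps_X * fps_deriv F = (- (\<Sum>i<?d. pow_fps (\<alpha> i))) * F"
    unfolding F by (rule fps_log_deriv_prod)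
  moreover have "F \<noteq> 0"
  proof
    assume "F = 0"
    hence "F $ 0 = 0" by simp
    thus False by (simp add: F_def)
  qed
  ultimately have "S = - (\<Sum>i<?d. pow_fps (\<alpha> i))" by (rule fps_log_deriv_unique)
  hence S: "fps_nth S m = fps_nth (- (\<Sum>i<?d. pow_fps (\<alpha> i))) m" for m by simp
  have "of_int (charsum m Q) = - (\<Sum>i<?d. \<alpha> i ^ m)" if "m > 0" for m
    using S[of m] that by (simp add: S_def fps_sum_nth pow_fps_def)
  thus ?thesis using F unfolding F_def by blast
qed

section \<open>The Riemann hypothesis for quadratic L-functions\<close>

lemma polys_linearly_dependent:
  fixes p :: "'i \<Rightarrow> 'k::field poly"
  assumes "finite I" "card I > D" "\<And>i j. i \<in> I \<Longrightarrow> j \<ge> D \<Longrightarrow> coeff (p i) j = 0"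
  shows "\<exists>c. (\<exists>i\<in>I. c i \<noteq> 0) \<and> (\<Sum>i\<in>I. smult (c i) (p i)) = 0"
  using assms
proof (induction D arbitrary: I p)
  case 0
  then obtain i where "i \<in> I" by (metis card.empty ex_in_conv less_nat_zero_code)
  moreover have "p j = 0" if "j \<in> I" for j using 0(3)[OF that] by (intro poly_eqI) simp
  ultimately show ?case by (intro exI[of _ "\<lambda>_. 1"]) auto
next
  case (Suc D)
  show ?case
  proof (cases "\<forall>i\<in>I. coeff (p i) D = 0")
    case True
    have "coeff (p i) j = 0" if "i \<in> I" "j \<ge> D" for i j
      using that True Suc.prems(3)[of i j] by (cases "j = D") auto
    thus ?thesis using Suc.IH[of I p] Suc.prems by auto
  next
    case False
    then obtain i0 where i0: "i0 \<in> I" "coeff (p i0) D \<noteq> 0" by blast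
    let ?a = "coeff (p i0) D"
    define p' where "p' = (\<lambda>i. p i - smult (coeff (p i) D / ?a) (p i0))"
    have "coeff (p' i) j = 0" if "i \<in> I - {i0}" "j \<ge> D" for i j
      using that i0 Suc.prems(3)[of i j] Suc.prems(3)[of i0 j] by (cases "j = D") (auto simp: p'_def)
    moreover have "card (I - {i0}) > D" using Suc.prems i0 by simp
    ultimately obtain c where c: "\<exists>i\<in>I - {i0}. c i \<noteq> 0" "(\<Sum>i\<in>I - {i0}. smult (c i) (p' i)) = 0"
      using Suc.IH[of "I - {i0}" p'] Suc.prems(1) by auto
    \<comment> \<open>The multiples of \<open>p i0\<close> subtracted from the other
      \<open>p i\<close> are compensated through the coefficient of \<open>p i0\<close>
      itself.\<close>
    let ?t = "- (\<Sum>i\<in>I - {i0}. c i * coeff (p i) D / ?a)"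
    define c' where "c' = c(i0 := ?t)"
    have "(\<Sum>i\<in>I. smult (c' i) (p i)) = smult ?t (p i0) + (\<Sum>i\<in>I - {i0}. smult (c i) (p i))"
      using i0 Suc.prems(1) by (subst sum.remove[of I i0]) (auto simp: c'_def)
    also have "\<dots> = (\<Sum>i\<in>I - {i0}. smult (c i) (p' i))"
      by (simp add: p'_def smult_diff_right sum_subtractf smult_sum)
    finally have "(\<Sum>i\<in>I. smult (c' i) (p i)) = 0" using c by simp
    moreover have "\<exists>i\<in>I. c' i \<noteq> 0" using c(1) by (auto simp: c'_def)
    ultimately show ?thesis by blast
  qed
qed

text \<open>
  Stepanov's method without derivatives. Since \<open>s\<close>-th powers are additive, a relation between
  \<open>s\<close>-th powers of monomials turns, after extracting \<open>s\<close>-th roots of the coefficients, into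
  a polynomial \<open>H\<close> of degree about \<open>s\<^sup>2/2\<close> vanishing at all points to be counted. That \<open>H \<noteq> 0\<close>
  follows by comparing orders of vanishing at \<open>0\<close> modulo \<open>s\<close>: here the odd order of \<open>Q\<close> enters.
\<close>

lemma order_0_coeff:
  fixes p :: "'k::field poly"
  assumes "p \<noteq> 0"
  shows "coeff p (order 0 p) \<noteq> 0"
proof -
  obtain r where r: "p = [:-0, 1:] ^ order 0 p * r" "\<not> [:-0, 1:] dvd r"
    using order_decomp[OF assms] by blast
  have "[:-0, 1:] ^ order 0 p = (monom 1 (order 0 p) :: 'k poly)" by (simp add: monom_altdef)
  hence "coeff p (order 0 p) = coeff (monom 1 (order 0 p) * r) (order 0 p)" using r(1) by simp
  also have "\<dots> = coeff r 0" by (simp add: coeff_monom_mult)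
  finally have "coeff p (order 0 p) = coeff r 0" .
  moreover have "coeff r 0 \<noteq> 0" using r(2) poly_eq_0_iff_dvd[of r 0] by (simp add: poly_0_coeff_0)
  ultimately show ?thesis by simp
qed

lemma order_power:
  fixes p :: "'k::field poly"
  assumes "p \<noteq> 0"
  shows "order x (p ^ n) = n * order x p"
  using assms by (induction n) (simp_all add: order_mult)

text \<open>Digits in base \<open>s\<close>: since a < m \<le> s, different pairs (a, b) give
  different exponents, so no two coefficients are merged.\<close>

lemma digits_sum_coeff:
  fixes d :: "nat \<Rightarrow> nat \<Rightarrow> 'k::field"
  assumes "m \<le> s"
  shows "coeff (\<Sum>(a, b)\<in>{..<m} \<times> {..<h}. monom (d a b) (a + s * b)) j
    = (if j mod s < m \<and> j div s < h then d (j mod s) (j div s) else 0)"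
proof (cases "s = 0")
  case False
  have "coeff (\<Sum>(a, b)\<in>{..<m} \<times> {..<h}. monom (d a b) (a + s * b)) j
      = (\<Sum>p\<in>{..<m} \<times> {..<h}. if p = (j mod s, j div s) then d (j mod s) (j div s) else 0)"
    unfolding coeff_sum
  proof (rule sum.cong)
    fix p assume p: "p \<in> {..<m} \<times> {..<h}"
    obtain a b where [simp]: "p = (a, b)" by (cases p)
    have a: "a < s" using p assms by auto
    have "a + s * b = j \<longleftrightarrow> a = j mod s \<and> b = j div s"
    proof
      assume "a + s * b = j"
      thus "a = j mod s \<and> b = j div s" using a by auto
    qed (simp add: mult.commute)
    thus "coeff (case p of (a, b) \<Rightarrow> monom (d a b) (a + s * b)) j
        = (if p = (j mod s, j div s) then d (j mod s) (j div s) else 0)"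
      by auto
  qed simp
  also have "\<dots> = (if j mod s < m \<and> j div s < h then d (j mod s) (j div s) else 0)"
    by (subst sum.delta) auto
  finally show ?thesis .
qed (use assms in auto)

lemma stepanov:
  fixes Q :: "'k::alg_closed_field poly" and s :: nat
  assumes frob: "\<And>x y :: 'k. (x + y) ^ s = x ^ s + y ^ s"
    and s: "odd s" "s \<ge> degree Q + 4" and Q: "Q \<noteq> 0" "odd (order 0 Q)"
  shows "finite {x. x ^ s\<^sup>2 = x \<and> poly Q x ^ ((s\<^sup>2 - 1) div 2) = 1}"
    and "2 * card {x. x ^ s\<^sup>2 = x \<and> poly Q x ^ ((s\<^sup>2 - 1) div 2) = 1} \<le> s\<^sup>2 + (4 * degree Q + 1) * s"
proof -
  define N where "N = degree Q"
  \<comment> \<open>The height h is little more than s/2, because \<open>degree H\<close> is of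
    order s * h. There are (nA + nB) * h unknowns against D coefficients, and
    \<open>s \<ge> degree Q + 4\<close> makes the unknowns prevail. The cut nB = (s - N) div 2 keeps
    Q^e x^(s a + b) below degree D and leaves room for the shift of digits in the proof of
    \<open>H \<noteq> 0\<close>.\<close>
  define nA where "nA = (s + 1) div 2"
  define nB where "nB = (s - N) div 2"
  define h where "h = (s + 2 * N + 1) div 2"
  define e where "e = (s + 1) div 2"
  define D where "D = s * ((s - 1) div 2) + h + N"
  obtain k where k: "s = 2 * k + 1" using s(1) by (elim oddE)
  have kN: "2 * k + 1 \<ge> N + 4" using s(2) by (simp add: k N_def)
  have [simp]: "nA = k + 1" "e = k + 1" "h = k + N + 1" by (auto simp: nA_def e_def h_def k)
  have nB: "2 * nB \<ge> 2 * k - N" "2 * nB + N \<le> 2 * k + 1"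
    using kN unfolding nB_def k by presburger+
  define I where "I = {True} \<times> {..<nA} \<times> {..<h} \<union> {False} \<times> {..<nB} \<times> {..<h}"
  define W where "W = (\<lambda>t. if t then 1 else Q ^ e)"
  \<comment> \<open>At a point to be counted, x^(s^2) = x and Q(x)^((s^2 - 1)/2) = 1, so the s-th
    power of \<open>r i\<close> has the value of \<open>p i\<close>: the two digits of the exponent
    swap and Q^e is reproduced.\<close>
  define p where "p = (\<lambda>(t, a, b). W t * monom 1 (s * a + b))"
  define r where "r = (\<lambda>(t, a, b). W t * monom 1 (a + s * b))"
  have "finite I" by (simp add: I_def)
  have "card I = nA * h + nB * h"
    unfolding I_def by (subst card_Un_disjoint) (auto simp: card_cartesian_product)
  have D: "D = (2 * k + 1) * k + (k + N + 1) + N" by (simp add: D_def k)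
  have "card I > D"
  proof -
    have N: "int N \<ge> 0" "2 * int k \<ge> int N + 3" using kN by linarith+
    have nB': "2 * int nB \<ge> 2 * int k - int N" using nB(1) by linarith
    have "2 * int (card I) = (2 * int k + 2 + 2 * int nB) * (int k + int N + 1)"
      using \<open>card I = _\<close> by (simp add: algebra_simps)
    also have "\<dots> \<ge> (4 * int k + 2 - int N) * (int k + int N + 1)"
      using nB' N by (intro mult_right_mono) auto
    finally have 1: "2 * int (card I) \<ge> (4 * int k + 2 - int N) * (int k + int N + 1)" .
    have 2: "(4 * int k + 2 - int N) * (int k + int N + 1) - 2 * int D
        = 3 * (int N * int k) + 2 * int k - int N * int N - 3 * int N"
      unfolding D by (simp add: algebra_simps)
    have "int N * (2 * int k) \<ge> int N * (int N + 3)" using N by (intro mult_left_mono) auto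
    hence 3: "2 * (int N * int k) \<ge> int N * int N + 3 * int N" by (simp add: algebra_simps)
    have "int N * int k \<ge> 0" by simp
    hence "int (card I) > int D" using 1 2 3 N by linarith
    thus ?thesis by simp
  qed
  have degW: "degree (W t) \<le> (if t then 0 else N * e)" for t
    unfolding W_def using degree_power_eq[OF Q(1), of e] by (simp add: N_def mult.commute del: power_Suc)
  have degmon: "degree (W t * monom 1 j) \<le> degree (W t) + j" for t j
    by (intro order_trans[OF degree_mult_le] add_left_mono degree_monom_le)
  have cz: "coeff (p i) j = 0" if "i \<in> I" "j \<ge> D" for i j
  proof -
    obtain t a b where i: "i = (t, a, b)" by (cases i)
    have "degree (W t) + (s * a + b) < D"
    proof (cases t)
      case True
      hence "a \<le> k" "b < k + N + 1" using that by (auto simp: i I_def)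
      hence "s * a \<le> (2 * k + 1) * k" unfolding k by (intro mult_left_mono) auto
      thus ?thesis using degW[of t] True \<open>b < _\<close> by (simp add: D)
    next
      case False
      hence a: "a + 1 \<le> nB" and b: "b < k + N + 1" using that by (auto simp: i I_def)
      have "2 * (s * a) + 2 * s + (2 * k + 1) * N = (2 * k + 1) * (2 * (a + 1) + N)"
        by (simp add: k algebra_simps)
      also have "\<dots> \<le> (2 * k + 1) * (2 * k + 1)" using a nB by (intro mult_left_mono) auto
      finally have "2 * (s * a) + 2 * (N * e) + s \<le> 2 * ((2 * k + 1) * k) + N"
        by (simp add: k algebra_simps)
      hence "s * a + N * e \<le> (2 * k + 1) * k + N" using kN k by linarith
      thus ?thesis using degW[of t] False b by (simp add: D)
    qed
    hence "degree (p i) < D"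
      using degmon[of t "s * a + b"] by (simp add: p_def i)
    thus ?thesis using that by (intro coeff_eq_0) simp
  qed
  obtain c where c: "\<exists>i\<in>I. c i \<noteq> 0" "(\<Sum>i\<in>I. smult (c i) (p i)) = 0"
    using polys_linearly_dependent[of I D p, OF \<open>finite I\<close> \<open>card I > D\<close> cz] by auto
  have "\<exists>y. y ^ s = c i" for i using nth_root_exists[of s "c i"] k by auto
  then obtain d where d: "\<And>i. d i ^ s = c i" by metis
  define H where "H = (\<Sum>i\<in>I. smult (d i) (r i))"
  define A where "A = (\<Sum>(a, b)\<in>{..<nA} \<times> {..<h}. monom (d (True, a, b)) (a + s * b))"
  define B where "B = (\<Sum>(a, b)\<in>{..<nB} \<times> {..<h}. monom (d (False, a, b)) (a + s * b))"
  have H_eq: "H = A + Q ^ e * B"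
  proof -
    have "H = (\<Sum>i\<in>{True} \<times> {..<nA} \<times> {..<h}. smult (d i) (r i)) + (\<Sum>i\<in>{False} \<times> {..<nB} \<times> {..<h}. smult (d i) (r i))"
      unfolding H_def I_def by (intro sum.union_disjoint) auto
    also have "(\<Sum>i\<in>{True} \<times> {..<nA} \<times> {..<h}. smult (d i) (r i)) = A"
      unfolding A_def
      by (rule sum.reindex_bij_witness[of _ "\<lambda>(a, b). (True, a, b)" "\<lambda>(t, a, b). (a, b)"])
         (auto simp: r_def W_def smult_monom)
    also have "(\<Sum>i\<in>{False} \<times> {..<nB} \<times> {..<h}. smult (d i) (r i)) = Q ^ e * B"
      unfolding B_def sum_distrib_left
      by (rule sum.reindex_bij_witness[of _ "\<lambda>(a, b). (False, a, b)" "\<lambda>(t, a, b). (a, b)"])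
         (auto simp: r_def W_def smult_monom mult_smult_right[symmetric] simp del: mult_smult_right)
    finally show ?thesis .
  qed
  have nAs: "nA \<le> s" and nBs: "nB \<le> s" using k nB by auto
  have cA: "coeff A j = (if j mod s < nA \<and> j div s < h then d (True, j mod s, j div s) else 0)" for j
    unfolding A_def using digits_sum_coeff[OF nAs, of "\<lambda>a b. d (True, a, b)" h j] by simp
  have cB: "coeff B j = (if j mod s < nB \<and> j div s < h then d (False, j mod s, j div s) else 0)" for j
    unfolding B_def using digits_sum_coeff[OF nBs, of "\<lambda>a b. d (False, a, b)" h j] by simp
  have H0: "H \<noteq> 0"
  proof
    assume "H = 0"
    hence AB: "A = - (Q ^ e * B)" using H_eq by (simp add: eq_neg_iff_add_eq_0)
    have "B = 0"
    proof (rule ccontr)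
      assume B0: "B \<noteq> 0"
      have A0: "A \<noteq> 0" using AB B0 Q by simp
      obtain w where w: "order 0 Q = 2 * w + 1" using Q(2) by (elim oddE)
      have "2 * w + 1 \<le> N" using order_degree[OF Q(1), of 0] by (simp add: w N_def)
      have "order 0 A = order 0 (Q ^ e * B)" using AB by simp
      also have "\<dots> = e * order 0 Q + order 0 B"
        using B0 Q(1) order_power[OF Q(1), of 0 e] by (subst order_mult) (auto simp del: power_Suc)
      \<comment> \<open>Half of an odd order: with e = (s + 1)/2 the lowest base-s digit of this
        shift is w + k + 1. Adding the lowest digit of the order of B causes no carry, so the order
        of A would have lowest digit at least k + 1, whereas A only has digits up to k.\<close>
      also have "e * order 0 Q = w * s + (w + (k + 1))" by (simp add: w k algebra_simps)
      finally have oA: "order 0 A = w * s + (w + (k + 1) + order 0 B)" by simp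
      have mA: "order 0 A mod s < k + 1" using order_0_coeff[OF A0] by (auto simp: cA split: if_splits)
      have mB: "order 0 B mod s < nB" using order_0_coeff[OF B0] by (auto simp: cB split: if_splits)
      have lt: "w + (k + 1) + order 0 B mod s < s"
        using mB nB \<open>2 * w + 1 \<le> N\<close> k by linarith
      have "order 0 A mod s = (w + (k + 1) + order 0 B mod s) mod s"
        unfolding oA mod_mult_self3 by (rule mod_add_right_eq[symmetric])
      also have "\<dots> = w + (k + 1) + order 0 B mod s" using lt by simp
      finally show False using mA by simp
    qed
    hence "A = 0" using AB by simp
    have "d i = 0" if "i \<in> I" for i
    proof -
      obtain t a b where i: "i = (t, a, b)" by (cases i)
      show ?thesis
      proof (cases t)
        case True
        hence "a < nA" "b < h" using that by (auto simp: i I_def)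
        thus ?thesis using arg_cong[OF \<open>A = 0\<close>, of "\<lambda>q. coeff q (a + s * b)"] nAs True
          by (simp add: cA i)
      next
        case False
        hence "a < nB" "b < h" using that by (auto simp: i I_def)
        thus ?thesis using arg_cong[OF \<open>B = 0\<close>, of "\<lambda>q. coeff q (a + s * b)"] nBs False
          by (simp add: cB i)
      qed
    qed
    hence "c i = 0" if "i \<in> I" for i using d[of i] that k by auto
    thus False using c(1) by blast
  qed
  have degH: "degree H \<le> s * h + N * s"
    unfolding H_def
  proof (rule degree_sum_le[OF \<open>finite I\<close>])
    fix i assume i: "i \<in> I"
    obtain t a b where i': "i = (t, a, b)" by (cases i)
    have ab: "a < s" "b + 1 \<le> h" using i nAs nBs by (auto simp: i' I_def)
    have "s * b + s \<le> s * h" using ab(2) mult_le_mono2[of "b + 1" h s] by simp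
    hence "a + s * b \<le> s * h" using ab by linarith
    moreover have "degree (W t) \<le> N * s" using degW[of t] k by (auto intro: order_trans split: if_splits)
    ultimately have "degree (r i) \<le> s * h + N * s"
      using degmon[of t "a + s * b"] by (simp add: r_def i')
    thus "degree (smult (d i) (r i)) \<le> s * h + N * s"
      using degree_smult_le order_trans by blast
  qed
  have frob_sum: "(\<Sum>i\<in>I. f i) ^ s = (\<Sum>i\<in>I. f i ^ s)" for f :: "_ \<Rightarrow> 'k"
    using \<open>finite I\<close> by (induction I rule: finite_induct) (use k frob in \<open>auto simp: power_0_left\<close>)
  have root: "poly H x = 0" if x: "x ^ s\<^sup>2 = x" "poly Q x ^ ((s\<^sup>2 - 1) div 2) = 1" for x
  proof -
    have ri: "poly (r i) x ^ s = poly (p i) x" for i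
    proof -
      obtain t a b where i: "i = (t, a, b)" by (cases i)
      have "e * s = (s\<^sup>2 - 1) div 2 + e" by (simp add: k power2_eq_square)
      hence "(poly Q x ^ e) ^ s = poly Q x ^ ((s\<^sup>2 - 1) div 2 + e)" by (simp only: power_mult[symmetric])
      hence "(poly Q x ^ e) ^ s = poly Q x ^ e" using x(2) by (simp add: power_add)
      hence "poly (W t) x ^ s = poly (W t) x" by (simp add: W_def)
      moreover have "(x ^ (a + s * b)) ^ s = x ^ (s * a + b)"
      proof -
        have "(x ^ (a + s * b)) ^ s = x ^ (s * a) * (x ^ s\<^sup>2) ^ b"
          by (simp add: power2_eq_square algebra_simps flip: power_mult power_add)
        thus ?thesis using x(1) by (simp add: power_add)
      qed
      ultimately show ?thesis by (simp add: i r_def p_def poly_monom power_mult_distrib)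
    qed
    have "poly H x ^ s = (\<Sum>i\<in>I. (d i * poly (r i) x) ^ s)"
      unfolding H_def poly_sum poly_smult by (rule frob_sum)
    also have "\<dots> = poly (\<Sum>i\<in>I. smult (c i) (p i)) x"
      by (simp add: power_mult_distrib ri d poly_sum)
    finally have "poly H x ^ s = 0" using c(2) by simp
    thus ?thesis by simp
  qed
  let ?S = "{x. x ^ s\<^sup>2 = x \<and> poly Q x ^ ((s\<^sup>2 - 1) div 2) = 1}"
  have sub: "?S \<subseteq> {x. poly H x = 0}" using root by auto
  show fin: "finite ?S" using finite_subset[OF sub poly_roots_finite[OF H0]] .
  have "card ?S \<le> card {x. poly H x = 0}" using sub poly_roots_finite[OF H0] by (rule card_mono[rotated])
  also have "\<dots> \<le> degree H" using H0 by (rule card_poly_roots_bound)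
  also have "\<dots> \<le> s * h + N * s" by (rule degH)
  finally have "2 * card ?S \<le> 2 * (s * h + N * s)" by simp
  also have "\<dots> = s\<^sup>2 + (4 * N + 1) * s" by (simp add: k power2_eq_square algebra_simps)
  finally show "2 * card ?S \<le> s\<^sup>2 + (4 * degree Q + 1) * s" by (simp add: N_def)
qed

lemma order_pcompose_shift:
  fixes Q :: "'k::field poly"
  assumes "Q \<noteq> 0"
  shows "order 0 (Q \<circ>\<^sub>p [:x0, 1:]) = order x0 Q"
proof -
  obtain r where r: "Q = [:-x0, 1:] ^ order x0 Q * r" "\<not> [:-x0, 1:] dvd r"
    using order_decomp[OF assms] by blast
  have "([:-x0, 1:] ^ n) \<circ>\<^sub>p [:x0, 1:] = [:-0, 1:] ^ n" for n
    by (induction n) (simp_all add: pcompose_mult pcompose_pCons pcompose_1 del: mult_pCons_left)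
  hence Q: "Q \<circ>\<^sub>p [:x0, 1:] = [:-0, 1:] ^ order x0 Q * (r \<circ>\<^sub>p [:x0, 1:])"
    by (subst r(1)) (simp only: pcompose_mult)
  have "poly (r \<circ>\<^sub>p [:x0, 1:]) 0 \<noteq> 0"
    using r(2) by (simp add: poly_pcompose poly_eq_0_iff_dvd)
  hence "order 0 (r \<circ>\<^sub>p [:x0, 1:]) = 0" "r \<circ>\<^sub>p [:x0, 1:] \<noteq> 0"
    by (auto intro: order_0I)
  thus ?thesis unfolding Q by (subst order_mult) (simp_all add: order_power_n_n del: minus_zero)
qed

text \<open>Translation by \<open>x0\<close>, an element of the field, moves the root of odd order
  to 0 and permutes the points.\<close>

lemma stepanov_shift:
  fixes Q :: "'a::{field,finite} alg_closure poly"
  assumes q: "odd CARD('a)" and s: "s = CARD('a) ^ m" "s \<ge> degree Q + 4"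
    and Q: "Q \<noteq> 0" "odd (order x0 Q)" and x0: "x0 \<in> Fq_ext (2 * m)"
  shows "2 * card {x \<in> Fq_ext (2 * m). poly Q x ^ ((CARD('a) ^ (2 * m) - 1) div 2) = 1}
    \<le> s\<^sup>2 + (4 * degree Q + 1) * s"
proof -
  let ?Q = "Q \<circ>\<^sub>p [:x0, 1:]"
  have s2: "s\<^sup>2 = CARD('a) ^ (2 * m)" by (simp add: s power_mult[symmetric] mult.commute)
  have deg: "degree ?Q = degree Q" by (simp add: degree_pcompose)
  have "?Q \<noteq> 0" using Q(1) by (simp add: pcompose_eq_0_iff)
  have "bij_betw (\<lambda>y. y + x0) {y. y ^ s\<^sup>2 = y \<and> poly ?Q y ^ ((s\<^sup>2 - 1) div 2) = 1}
      {x \<in> Fq_ext (2 * m). poly Q x ^ ((CARD('a) ^ (2 * m) - 1) div 2) = 1}"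
    by (rule bij_betw_byWitness[of _ "\<lambda>x. x - x0"])
       (use x0 in \<open>auto simp: s2 poly_pcompose Fq_ext_iff frobpow_add frobpow_diff algebra_simps\<close>)
  hence "card {x \<in> Fq_ext (2 * m). poly Q x ^ ((CARD('a) ^ (2 * m) - 1) div 2) = 1}
      = card {y. y ^ s\<^sup>2 = y \<and> poly ?Q y ^ ((s\<^sup>2 - 1) div 2) = 1}"
    by (rule bij_betw_same_card[symmetric])
  moreover have "2 * card {y. y ^ s\<^sup>2 = y \<and> poly ?Q y ^ ((s\<^sup>2 - 1) div 2) = 1} \<le> s\<^sup>2 + (4 * degree ?Q + 1) * s"
    using q s Q \<open>?Q \<noteq> 0\<close>
    by (intro stepanov(2)) (simp_all add: frobpow_add order_pcompose_shift degree_pcompose)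
  ultimately show ?thesis by (simp only: deg)
qed

text \<open>Upper bounds suffice: Stepanov bounds the points where the half power is 1 and, after a
  twist, those where it is -1. These two sets and the zeros of \<open>Q\<close> fill a field of s^2
  elements, so each upper bound yields a lower bound for the other set.\<close>

lemma charsum_bound_stepanov:
  fixes Q :: "'a::{field,finite} poly"
  assumes q: "odd CARD('a)" and m: "m > 0" "CARD('a) ^ m \<ge> degree Q + 4"
    and Q: "Q \<noteq> 0" "odd (order x0 (map_poly to_ac Q))" and x0: "x0 \<in> Fq_ext (2 * m)"
  shows "\<bar>charsum (2 * m) Q\<bar> \<le> (5 * int (degree Q) + 1) * int CARD('a) ^ m"
proof -
  let ?n = "2 * m" and ?Q = "map_poly to_ac Q" and ?N = "degree Q"
  let ?K = "Fq_ext ?n :: 'a alg_closure set" and ?e = "(CARD('a) ^ (2 * m) - 1) div 2"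
  define s where "s = CARD('a) ^ m"
  have n: "?n > 0" using m by simp
  have fin: "finite ?K" by (rule finite_Fq_ext[OF n])
  have s2: "card ?K = s\<^sup>2" using card_Fq_ext[OF n, where ?'a='a] by (simp add: s_def power_mult[symmetric] mult.commute)
  have e0: "?e > 0" using half_exponent(2)[OF q n] .
  define Sp where "Sp = {x \<in> ?K. poly ?Q x ^ ?e = 1}"
  define Sm where "Sm = {x \<in> ?K. poly ?Q x ^ ?e = -1}"
  define Z where "Z = {x \<in> ?K. poly ?Q x = 0}"
  have ne: "(1 :: 'a alg_closure) \<noteq> -1" using minus_one_neq_one_ac[OF q] by metis
  have part: "?K = Sp \<union> Sm \<union> Z"
    using power_half_cases[OF q n Fq_ext_poly] by (auto simp: Sp_def Sm_def Z_def)
  have disj: "Sp \<inter> Sm = {}" "(Sp \<union> Sm) \<inter> Z = {}"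
    using ne e0 by (auto simp: Sp_def Sm_def Z_def power_0_left)
  have fins: "finite Sp" "finite Sm" "finite Z" using fin by (auto simp: Sp_def Sm_def Z_def)
  have cK: "s\<^sup>2 = card Sp + card Sm + card Z"
    unfolding s2[symmetric] by (subst part) (use disj fins in \<open>simp add: card_Un_disjoint\<close>)
  have cZ: "card Z \<le> ?N"
  proof -
    have "card Z \<le> card {x. poly ?Q x = 0}"
      using Q(1) by (intro card_mono poly_roots_finite) (auto simp: Z_def)
    also have "\<dots> \<le> ?N" using card_poly_roots_bound[of ?Q] Q(1) by simp
    finally show ?thesis .
  qed
  have "2 * card Sp \<le> s\<^sup>2 + (4 * degree ?Q + 1) * s"
    unfolding Sp_def using m Q by (intro stepanov_shift[OF q s_def _ _ _ x0]) (simp_all add: s_def)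
  hence bp: "2 * card Sp \<le> s\<^sup>2 + (4 * ?N + 1) * s" by simp
  \<comment> \<open>Multiplying \<open>Q\<close> by c exchanges the half powers 1 and -1 and keeps
    the order at \<open>x0\<close>.\<close>
  obtain c :: "'a alg_closure" where c: "c ^ ?e = -1" using nth_root_exists[OF e0] by blast
  have c0: "c \<noteq> 0" using c e0 by (auto simp: power_0_left)
  have "2 * card {x \<in> ?K. poly (smult c ?Q) x ^ ?e = 1} \<le> s\<^sup>2 + (4 * degree (smult c ?Q) + 1) * s"
    using m Q c0 by (intro stepanov_shift[OF q s_def _ _ _ x0]) (simp_all add: s_def order_smult)
  moreover have "{x \<in> ?K. poly (smult c ?Q) x ^ ?e = 1} = Sm"
  proof -
    have "poly (smult c ?Q) x ^ ?e = - (poly ?Q x ^ ?e)" for x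
      unfolding poly_smult power_mult_distrib c by (rule mult_minus1)
    moreover have "- y = 1 \<longleftrightarrow> y = -1" for y :: "'a alg_closure"
      by (metis minus_minus)
    ultimately show ?thesis by (simp only: Sm_def)
  qed
  ultimately have bm: "2 * card Sm \<le> s\<^sup>2 + (4 * ?N + 1) * s" using c0 by simp
  have "charsum ?n Q = (\<Sum>x\<in>Sp. leg ?n (ev Q x)) + (\<Sum>x\<in>Sm. leg ?n (ev Q x)) + (\<Sum>x\<in>Z. leg ?n (ev Q x))"
    unfolding charsum_def by (subst part) (use disj fins in \<open>simp add: sum.union_disjoint\<close>)
  also have "(\<Sum>x\<in>Sp. leg ?n (ev Q x)) = (\<Sum>x\<in>Sp. 1)"
    by (intro sum.cong refl) (auto simp: Sp_def leg_def sgnc_def ev_def)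
  also have "(\<Sum>x\<in>Sm. leg ?n (ev Q x)) = (\<Sum>x\<in>Sm. -1)"
    by (intro sum.cong refl) (use ne in \<open>auto simp: Sm_def leg_def sgnc_def ev_def\<close>)
  also have "(\<Sum>x\<in>Z. leg ?n (ev Q x)) = 0"
    using leg_0[OF q n] by (intro sum.neutral) (auto simp: Z_def ev_def)
  finally have "charsum ?n Q = int (card Sp) - int (card Sm)" by simp
  moreover have "int (2 * card Sp) \<le> int (s\<^sup>2) + (4 * int ?N + 1) * int s"
    using of_nat_mono[OF bp, where ?'a = int] by (simp add: algebra_simps)
  moreover have "int (2 * card Sm) \<le> int (s\<^sup>2) + (4 * int ?N + 1) * int s"
    using of_nat_mono[OF bm, where ?'a = int] by (simp add: algebra_simps)
  moreover have "int (s\<^sup>2) = int (card Sp) + int (card Sm) + int (card Z)" using cK by simp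
  moreover have "int (card Z) \<le> int ?N * int s"
  proof -
    have "?N * 1 \<le> ?N * s" using m by (intro mult_left_mono) (auto simp: s_def)
    hence "card Z \<le> ?N * s" using cZ by linarith
    thus ?thesis by (simp flip: of_nat_mult)
  qed
  ultimately have "\<bar>charsum ?n Q\<bar> \<le> (4 * int ?N + 1) * int s + int ?N * int s" by linarith
  also have "\<dots> = (5 * int ?N + 1) * int CARD('a) ^ m" by (simp add: s_def algebra_simps)
  finally show ?thesis .
qed

text \<open>A polynomial g vanishing at all other values of \<beta> extracts
  \<open>\<beta> i0\<close>, with its multiplicity, from the power sums. So its j-th power is at
  most a constant times R^j for all large j, which fails for modulus above R.\<close>

lemma power_sum_bound_imp_norm_le:
  fixes \<beta> :: "nat \<Rightarrow> complex"
  assumes R: "R > 0" and bound: "\<And>j. j \<ge> J \<Longrightarrow> cmod (\<Sum>i<d. \<beta> i ^ j) \<le> C * R ^ j" and i0: "i0 < d"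
  shows "cmod (\<beta> i0) \<le> R"
proof (rule ccontr)
  assume "\<not> cmod (\<beta> i0) \<le> R"
  hence gt: "cmod (\<beta> i0) / R > 1" using R by simp
  define T where "T = \<beta> ` {..<d} - {\<beta> i0}"
  define g where "g = (\<Prod>t\<in>T. [:-t, 1:])"
  have fT: "finite T" by (simp add: T_def)
  have g0: "poly g (\<beta> i0) \<noteq> 0" using fT by (auto simp: g_def poly_prod T_def)
  have gz: "poly g (\<beta> i) = 0" if "i < d" "\<beta> i \<noteq> \<beta> i0" for i
    using fT that by (auto simp: g_def poly_prod T_def)
  define M where "M = card {i. i < d \<and> \<beta> i = \<beta> i0}"
  have M: "M \<ge> 1" using i0 by (auto simp: M_def card_gt_0_iff Suc_le_eq)
  define C' where "C' = (\<Sum>k\<le>degree g. cmod (coeff g k) * (C * R ^ k))"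
  have main: "cmod (poly g (\<beta> i0)) * cmod (\<beta> i0) ^ j \<le> C' * R ^ j" if j: "j \<ge> J" for j
  proof -
    have "(\<Sum>i<d. poly g (\<beta> i) * \<beta> i ^ j) = (\<Sum>i | i < d \<and> \<beta> i = \<beta> i0. poly g (\<beta> i0) * \<beta> i0 ^ j)"
      by (rule sum.mono_neutral_cong_right) (auto simp: gz)
    also have "\<dots> = of_nat M * (poly g (\<beta> i0) * \<beta> i0 ^ j)" by (simp add: M_def)
    finally have eq1: "(\<Sum>i<d. poly g (\<beta> i) * \<beta> i ^ j) = of_nat M * (poly g (\<beta> i0) * \<beta> i0 ^ j)" .
    have "(\<Sum>i<d. poly g (\<beta> i) * \<beta> i ^ j) = (\<Sum>i<d. \<Sum>k\<le>degree g. coeff g k * \<beta> i ^ (k + j))"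
      by (simp add: poly_altdef sum_distrib_right power_add mult.assoc)
    also have "\<dots> = (\<Sum>k\<le>degree g. coeff g k * (\<Sum>i<d. \<beta> i ^ (k + j)))"
      by (subst sum.swap) (simp add: sum_distrib_left)
    finally have eq2: "(\<Sum>i<d. poly g (\<beta> i) * \<beta> i ^ j) = (\<Sum>k\<le>degree g. coeff g k * (\<Sum>i<d. \<beta> i ^ (k + j)))" .
    have "1 * (cmod (poly g (\<beta> i0)) * cmod (\<beta> i0) ^ j) \<le> real M * (cmod (poly g (\<beta> i0)) * cmod (\<beta> i0) ^ j)"
      using M by (intro mult_right_mono) auto
    also have "\<dots> = cmod (\<Sum>i<d. poly g (\<beta> i) * \<beta> i ^ j)"
      unfolding eq1 by (simp add: norm_mult norm_power)
    also have "\<dots> \<le> (\<Sum>k\<le>degree g. cmod (coeff g k) * cmod (\<Sum>i<d. \<beta> i ^ (k + j)))"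
      unfolding eq2 by (rule order_trans[OF norm_sum]) (simp add: norm_mult)
    also have "\<dots> \<le> (\<Sum>k\<le>degree g. cmod (coeff g k) * (C * R ^ (k + j)))"
      using j by (intro sum_mono mult_left_mono bound) auto
    also have "\<dots> = C' * R ^ j" by (simp add: C'_def sum_distrib_right power_add mult.assoc)
    finally show ?thesis by simp
  qed
  obtain n where n: "C' / cmod (poly g (\<beta> i0)) < (cmod (\<beta> i0) / R) ^ n"
    using real_arch_pow[OF gt] by blast
  let ?j = "max n J"
  have "(cmod (\<beta> i0) / R) ^ n \<le> (cmod (\<beta> i0) / R) ^ ?j" using gt by (intro power_increasing) auto
  also have "\<dots> = cmod (\<beta> i0) ^ ?j / R ^ ?j" by (rule power_divide)
  also have "\<dots> \<le> C' / cmod (poly g (\<beta> i0))"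
    using main[of ?j] g0 R by (simp add: field_simps)
  finally show False using n by simp
qed

text \<open>The point count applies over fields with q^(2 m) elements that contain the root
  \<open>x0\<close> of odd order; taking m a multiple of t = deg P ensures this. The power sums
  bounded are therefore those of the powers \<alpha>^(2 t), and a bound for these is one for
  \<alpha>.\<close>

theorem inverse_roots_bound:
  fixes Q :: "'a::{field,finite} poly" and \<alpha> :: "nat \<Rightarrow> complex"
  assumes q: "odd CARD('a)" and Q: "lead_coeff Q = 1" "\<nexists>A. Q = A\<^sup>2"
    and \<alpha>: "\<And>m. m > 0 \<Longrightarrow> of_int (charsum m Q) = - (\<Sum>i<d. \<alpha> i ^ m)" and i: "i < d"
  shows "cmod (\<alpha> i) \<le> sqrt (real CARD('a))"
proof -
  have Q0: "Q \<noteq> 0" using Q by auto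
  obtain P where P: "monic_irreducible P" and odd: "odd (pmult P Q)"
    using nonsquare_odd_pmult[OF Q] .
  note Pd = monic_irreducibleD[OF P]
  obtain R where R: "Q = P ^ pmult P Q * R" "\<not> P dvd R" using pmult_decompose[OF P Q0] .
  obtain x0 where x0: "ev P x0 = 0" using exists_root[OF P] .
  \<comment> \<open>The conjugates of x0 are distinct, so x0 is a simple root of P, and its order in
    Q is the multiplicity of P.\<close>
  have "order x0 (map_poly to_ac P) = 1"
  proof -
    have "order x0 (map_poly to_ac P) \<noteq> 0" using x0 Pd by (simp add: order_root ev_def)
    moreover have "\<not> order x0 (map_poly to_ac P) \<ge> 2"
    proof
      have "proots (map_poly to_ac P) = (\<Sum>i<degree P. {#frobpow i x0#})"
        unfolding orbit_factorization[OF P x0] by (subst proots_prod) auto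
      moreover have "count (\<Sum>i<degree P. {#frobpow i x0#}) x0 = (\<Sum>i<degree P. if i = 0 then 1 else 0)"
      proof -
        have "frobpow i x0 = x0 \<longleftrightarrow> i = 0" if "i < degree P" for i
          using inj_on_eq_iff[OF orbit_inj[OF P x0], of i 0] that by auto
        hence "(\<Sum>i<degree P. count {#frobpow i x0#} x0) = (\<Sum>i<degree P. if i = 0 then 1 else 0)"
          by (intro sum.cong) auto
        thus ?thesis by (simp only: count_sum)
      qed
      ultimately have "count (proots (map_poly to_ac P)) x0 \<le> 1" by simp
      moreover assume "order x0 (map_poly to_ac P) \<ge> 2"
      ultimately show False using Pd by simp
    qed
    ultimately show ?thesis by linarith
  qed
  moreover have R0: "R \<noteq> 0" using R by auto
  moreover have "order x0 (map_poly to_ac R) = 0"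
    using R(2) ev_eq_0_iff_dvd[OF P x0, of R] by (intro order_0I) (simp add: ev_def)
  moreover have mp: "map_poly to_ac (P ^ k) = map_poly to_ac P ^ k" for k
    by (induction k) (simp_all add: map_to_ac_mult)
  ultimately have "order x0 (map_poly to_ac Q) = pmult P Q"
    using Pd by (subst R(1)) (simp add: map_to_ac_mult order_mult order_power)
  hence oddord: "odd (order x0 (map_poly to_ac Q))" using odd by simp
  let ?t = "degree P" and ?q = "CARD('a)"
  let ?\<beta> = "\<lambda>i. \<alpha> i ^ (2 * ?t)" and ?R = "real ?q ^ ?t" and ?C = "real (5 * degree Q + 1)"
  have "cmod (?\<beta> i) \<le> ?R"
  proof (rule power_sum_bound_imp_norm_le[where \<beta> = ?\<beta> and R = ?R and J = "degree Q + 4" and d = d and C = ?C])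
    show "?R > 0" "i < d" using i by simp_all
    fix j assume j: "j \<ge> degree Q + 4"
    let ?m = "?t * j"
    have m: "?m > 0" using j Pd by simp
    have "degree Q + 4 \<le> j" by (rule j)
    also have "j \<le> ?m" using Pd by (cases ?t) auto
    also have "?m \<le> ?q ^ ?m"
    proof -
      have "?m < 2 ^ ?m" by (rule less_exp)
      also have "\<dots> \<le> ?q ^ ?m" using card_field_gt_1[where ?'a='a] by (intro power_mono) auto
      finally show ?thesis by simp
    qed
    finally have large: "?q ^ ?m \<ge> degree Q + 4" .
    have "x0 \<in> Fq_ext (2 * ?m)" using in_Fq_ext_iff_degree_dvd[OF P x0] by simp
    from charsum_bound_stepanov[OF q m large Q0 oddord this]
    have "real_of_int \<bar>charsum (2 * ?m) Q\<bar> \<le> real_of_int ((5 * int (degree Q) + 1) * int ?q ^ ?m)"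
      by (simp only: of_int_le_iff)
    also have "\<dots> = ?C * ?R ^ j" by (simp add: power_mult)
    finally have *: "real_of_int \<bar>charsum (2 * ?m) Q\<bar> \<le> ?C * ?R ^ j" .
    have "(\<Sum>i<d. ?\<beta> i ^ j) = - of_int (charsum (2 * ?m) Q)"
      using \<alpha>[of "2 * ?m"] m by (simp flip: power_mult add: mult.assoc)
    hence "cmod (\<Sum>i<d. ?\<beta> i ^ j) = real_of_int \<bar>charsum (2 * ?m) Q\<bar>" by simp
    thus "cmod (\<Sum>i<d. ?\<beta> i ^ j) \<le> ?C * ?R ^ j" using * by simp
  qed
  moreover have "?R = sqrt (real ?q) ^ (2 * ?t)" by (simp only: power_mult) simp
  ultimately have "cmod (\<alpha> i) ^ (2 * ?t) \<le> sqrt (real ?q) ^ (2 * ?t)"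
    by (simp only: norm_power)
  thus ?thesis using Pd(5) power_mono_iff[of "cmod (\<alpha> i)" "sqrt (real ?q)" "2 * ?t"] by simp
qed

corollary charsum_bound:
  fixes Q :: "'a::{field,finite} poly"
  assumes q: "odd CARD('a)" and Q: "lead_coeff Q = 1" "\<nexists>A. Q = A\<^sup>2" and m: "m > 0"
  shows "\<bar>real_of_int (charsum m Q)\<bar> \<le> real (degree Q) * sqrt (real CARD('a)) ^ m"
proof -
  obtain \<alpha> where \<alpha>: "\<And>m. m > 0 \<Longrightarrow> of_int (charsum m Q) = - (\<Sum>i<degree Q - 1. \<alpha> i ^ m :: complex)"
    using exists_inverse_roots[OF q Q] by blast
  have "\<bar>real_of_int (charsum m Q)\<bar> = cmod (of_int (charsum m Q))" by simp
  also have "\<dots> = cmod (\<Sum>i<degree Q - 1. \<alpha> i ^ m)" by (simp add: \<alpha>[OF m])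
  also have "\<dots> \<le> (\<Sum>i<degree Q - 1. cmod (\<alpha> i) ^ m)"
    by (rule order_trans[OF norm_sum]) (simp add: norm_power)
  also have "\<dots> \<le> (\<Sum>i<degree Q - 1. sqrt (real CARD('a)) ^ m)"
    using inverse_roots_bound[OF q Q \<alpha>] by (intro sum_mono power_mono) auto
  also have "\<dots> \<le> real (degree Q) * sqrt (real CARD('a)) ^ m"
    by (simp add: mult_right_mono)
  finally show ?thesis .
qed

section \<open>The functional equation\<close>

text \<open>
  The coefficient functional \<open>tau\<close> plays the role of the trace form on residues modulo \<open>Q\<close>.
  A function \<open>\<kappa>\<close> of mean zero on the ground field replaces an additive character: the
  Kronecker-type kernel \<open>kap_even\<close> if \<open>deg Q\<close> is even, the quadratic character \<open>kap_odd\<close> if it is odd.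
\<close>

definition tau :: "'a::{field,finite} poly \<Rightarrow> 'a poly \<Rightarrow> 'a" where
  "tau Q y = coeff (y mod Q) (degree Q - 1)"

definition gsum :: "('a \<Rightarrow> int) \<Rightarrow> 'a::{field,finite} poly \<Rightarrow> 'a poly \<Rightarrow> int" where
  "gsum \<kappa> Q h = (\<Sum>y\<in>polys_lt (degree Q). jac y Q * \<kappa> (tau Q (h * y)))"

text \<open>The sum of all nontrivial additive characters of the ground field, evaluated at
  \<open>c\<close>.\<close>

definition kap_even :: "'a::{field,finite} \<Rightarrow> int" where
  "kap_even c = (if c = 0 then int CARD('a) - 1 else -1)"

definition kap_odd :: "'a::{field,finite} \<Rightarrow> int" where
  "kap_odd c = leg 1 (to_ac c)"

lemma sum_kap_even: "(\<Sum>c\<in>UNIV. kap_even (c :: 'a::{field,finite})) = 0"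
proof -
  have "(\<Sum>c\<in>UNIV. kap_even (c :: 'a)) = (\<Sum>c\<in>(UNIV :: 'a set). (if c = 0 then int CARD('a) else 0) - 1)"
    by (intro sum.cong) (auto simp: kap_even_def)
  thus ?thesis by (simp add: sum_subtractf)
qed

lemma Fq_ext_1: "Fq_ext 1 = range (to_ac :: 'a::{field,finite} \<Rightarrow> _)"
  using in_range_to_ac_iff by (auto simp: Fq_ext_def)

lemma sum_kap_odd:
  assumes "odd CARD('a)"
  shows "(\<Sum>c\<in>UNIV. kap_odd (c :: 'a::{field,finite})) = 0"
proof -
  have "(\<Sum>c\<in>UNIV. kap_odd (c :: 'a)) = (\<Sum>y\<in>range (to_ac :: 'a \<Rightarrow> _). leg 1 y)"
    by (subst sum.reindex) (auto simp: kap_odd_def inj_to_ac)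
  thus ?thesis using sum_leg[OF assms, of 1] by (simp only: Fq_ext_1)
qed

lemma tau_add: "tau Q (f + g) = tau Q f + tau Q g"
  by (simp add: tau_def poly_mod_add_left)

lemma tau_smult: "tau Q (smult c f) = c * tau Q f"
  by (simp add: tau_def mod_smult_left)

lemma tau_mod: "tau Q (f mod Q) = tau Q f"
  by (simp add: tau_def)

lemma tau_small: "f \<in> polys_lt (degree Q) \<Longrightarrow> tau Q f = coeff f (degree Q - 1)"
  by (simp add: tau_def mod_eq_self)

lemma polys_lt_mult: "f \<in> polys_lt a \<Longrightarrow> g \<in> polys_lt b \<Longrightarrow> f * g \<in> polys_lt (a + b - 1)"
  by (cases "f = 0 \<or> g = 0") (auto simp: polys_lt_iff degree_mult_eq)

text \<open>Translating f by multiples of h0, where l is 1, adds each constant to \<open>l f\<close>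
  once; averaging over the translations brings in the full sum of \<kappa>.\<close>

lemma sum_linear_functional:
  fixes l :: "'a::{field,finite} poly \<Rightarrow> 'a" and \<kappa> :: "'a \<Rightarrow> int"
  assumes l: "\<And>f g. l (f + g) = l f + l g" "\<And>c f. l (smult c f) = c * l f"
    and \<kappa>: "(\<Sum>c\<in>UNIV. \<kappa> c) = 0" and h: "h \<in> polys_lt k" "l h \<noteq> 0"
  shows "(\<Sum>f\<in>polys_lt k. \<kappa> (l f + c)) = 0"
proof -
  let ?V = "polys_lt k :: 'a poly set" and ?S = "\<Sum>f\<in>polys_lt k. \<kappa> (l f + c)"
  define h0 where "h0 = smult (inverse (l h)) h"
  have h0: "h0 \<in> ?V" "l h0 = 1" using h by (auto simp: h0_def l polys_lt_closed)
  have ldiff: "l (f - smult a h0) = l f - a" for f a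
    using l(1)[of "f - smult a h0" "smult a h0"] h0 by (simp add: l(2) algebra_simps)
  have shift: "?S = (\<Sum>f\<in>?V. \<kappa> (a + (l f + c)))" for a
    by (rule sum.reindex_bij_witness[of _ "\<lambda>f. f + smult a h0" "\<lambda>f. f - smult a h0"])
       (use h0 in \<open>simp_all add: polys_lt_closed ldiff add.commute\<close>)
  have "(\<Sum>a\<in>(UNIV :: 'a set). ?S) = (\<Sum>a\<in>UNIV. \<Sum>f\<in>?V. \<kappa> (a + (l f + c)))"
    by (rule sum.cong[OF refl]) (rule shift)
  also have "\<dots> = (\<Sum>f\<in>?V. \<Sum>a\<in>UNIV. \<kappa> (a + (l f + c)))" by (rule sum.swap)
  also have "\<dots> = (\<Sum>f\<in>?V. 0)"
  proof (intro sum.cong refl)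
    fix f
    have "(\<Sum>a\<in>UNIV. \<kappa> (a + (l f + c))) = (\<Sum>a\<in>UNIV. \<kappa> a)"
      by (rule sum.reindex_bij_witness[of _ "\<lambda>a. a - (l f + c)" "\<lambda>a. a + (l f + c)"]) auto
    thus "(\<Sum>a\<in>UNIV. \<kappa> (a + (l f + c))) = 0" using \<kappa> by simp
  qed
  finally show ?thesis by simp
qed

text \<open>For products of degree below deg Q, \<open>tau\<close> reads the top coefficient. A
  monomial of complementary degree thus detects the leading coefficient of y, while products of
  lower degree never reach the top.\<close>

lemma tau_orthogonal:
  fixes Q :: "'a::{field,finite} poly"
  assumes k: "k \<le> degree Q" and y: "y \<in> polys_lt (degree Q)" and N: "degree Q > 0"
  shows "(\<forall>h\<in>polys_lt k. tau Q (h * y) = 0) \<longleftrightarrow> y \<in> polys_lt (degree Q - k)"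
proof
  assume y': "y \<in> polys_lt (degree Q - k)"
  show "\<forall>h\<in>polys_lt k. tau Q (h * y) = 0"
  proof
    fix h :: "'a poly" assume "h \<in> polys_lt k"
    hence "h * y \<in> polys_lt (degree Q - 1)" using polys_lt_mult[of h k y "degree Q - k"] y' k by simp
    moreover from this have "h * y \<in> polys_lt (degree Q)" by (rule polys_lt_mono[rotated]) simp
    ultimately show "tau Q (h * y) = 0" by (simp add: tau_small) (simp add: polys_lt_def)
  qed
next
  assume *: "\<forall>h\<in>polys_lt k. tau Q (h * y) = 0"
  show "y \<in> polys_lt (degree Q - k)"
  proof (rule ccontr)
    assume "y \<notin> polys_lt (degree Q - k)"
    hence y0: "y \<noteq> 0" and d: "degree y \<ge> degree Q - k" "degree y < degree Q"
      using y by (auto simp: polys_lt_iff)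
    let ?i = "degree Q - 1 - degree y"
    let ?h = "monom 1 ?i :: 'a poly"
    have "?h \<in> polys_lt k" using d k by (auto simp: polys_lt_iff degree_monom_eq)
    hence z: "tau Q (?h * y) = 0" using * by blast
    have "?h * y \<in> polys_lt (degree Q)"
      using d y0 by (simp add: polys_lt_iff degree_mult_eq degree_monom_eq)
    hence "tau Q (?h * y) = coeff y (degree y)"
      using d by (simp add: tau_small coeff_monom_mult)
    thus False using z y0 by simp
  qed
qed

lemma sum_kernel_tau:
  fixes Q :: "'a::{field,finite} poly"
  assumes k: "k \<le> degree Q" and y: "y \<in> polys_lt (degree Q)" and N: "degree Q > 0"
    and \<kappa>: "(\<Sum>c\<in>UNIV. \<kappa> c) = 0"
  shows "(\<Sum>h\<in>polys_lt k. \<kappa> (tau Q (h * y) + c))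
    = (if y \<in> polys_lt (degree Q - k) then int CARD('a) ^ k * \<kappa> c else 0)"
proof (cases "y \<in> polys_lt (degree Q - k)")
  case True
  hence "\<forall>h\<in>polys_lt k. tau Q (h * y) = 0" using tau_orthogonal[OF k y N] by blast
  hence "(\<Sum>h\<in>polys_lt k. \<kappa> (tau Q (h * y) + c)) = (\<Sum>h\<in>(polys_lt k :: 'a poly set). \<kappa> c)"
    by (intro sum.cong) auto
  thus ?thesis using True by (simp add: card_polys_lt)
next
  case False
  then obtain h where "h \<in> polys_lt k" "tau Q (h * y) \<noteq> 0" using tau_orthogonal[OF k y N] by blast
  hence "(\<Sum>h\<in>polys_lt k. \<kappa> (tau Q (h * y) + c)) = 0"
    using \<kappa> by (intro sum_linear_functional) (auto simp: tau_add tau_smult ring_distribs)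
  thus ?thesis using False by simp
qed

lemma gsum_unit:
  fixes Q :: "'a::{field,finite} poly"
  assumes q: "odd CARD('a)" and Q: "lead_coeff Q = 1" and h: "jac h Q \<noteq> 0"
  shows "gsum \<kappa> Q h = jac h Q * gsum \<kappa> Q 1"
proof -
  have Q0: "Q \<noteq> 0" using Q by auto
  have "gsum \<kappa> Q 1 = (\<Sum>y\<in>polys_lt (degree Q). jac ((h * y) mod Q) Q * \<kappa> (tau Q ((h * y) mod Q)))"
    using sum_residues_mult[OF q Q h, of "\<lambda>y. jac y Q * \<kappa> (tau Q y)"] by (simp add: gsum_def)
  also have "\<dots> = jac h Q * gsum \<kappa> Q h"
    by (simp add: gsum_def jac_mod[OF Q0] tau_mod jac_mult_num[OF q Q] sum_distrib_left mult.assoc)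
  finally show ?thesis using jac_cases[of h Q] h by auto
qed

lemma jac_eq_0_common_factor:
  fixes Q :: "'a::{field,finite} poly"
  assumes q: "odd CARD('a)" and Q: "lead_coeff Q = 1" and h: "jac h Q = 0"
  obtains P where "monic_irreducible P" "P dvd Q" "P dvd h"
proof -
  have "jac h Q = 0 \<Longrightarrow> \<exists>P. monic_irreducible P \<and> P dvd Q \<and> P dvd h"
    using Q
  proof (induction Q rule: monic_induct)
    case (mult P g)
    have "jac h P = 0 \<or> jac h g = 0"
      using mult.prems jac_mult_den[OF q monic_irreducibleD(1)[OF mult(1)] mult(2)] by simp
    thus ?case
    proof
      assume "jac h P = 0"
      thus ?thesis using jac_eq_0_iff[OF q mult(1)] mult(1) by (metis dvd_triv_left)
    next
      assume "jac h g = 0"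
      thus ?thesis using mult.IH by (metis dvd_mult)
    qed
  qed simp
  thus ?thesis using that h by blast
qed

text \<open>Primitivity of the character. For a common factor P of Q and h there is u with u = 1
  modulo Q/P and symbol -1. Then Q divides h (u - 1), so replacing y by u y fixes the kernel values
  and negates the symbols.\<close>

lemma gsum_nonunit:
  fixes Q :: "'a::{field,finite} poly"
  assumes q: "odd CARD('a)" and Q: "lead_coeff Q = 1" "squarefree Q" and h: "jac h Q = 0"
  shows "gsum \<kappa> Q h = 0"
proof -
  have Q0: "Q \<noteq> 0" using Q by auto
  obtain P where P: "monic_irreducible P" "P dvd Q" "P dvd h"
    using jac_eq_0_common_factor[OF q Q(1) h] .
  then obtain R where R: "Q = P * R" by (elim dvdE)
  have "\<not> P dvd R"
  proof
    assume "P dvd R"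
    hence "P ^ 2 dvd Q" by (simp add: R power2_eq_square)
    hence "is_unit P" using Q(2) squarefreeD by blast
    thus False using monic_irreducibleD(2)[OF P(1)] irreducible_not_unit by blast
  qed
  moreover have "lead_coeff R = 1" using Q(1) monic_irreducibleD(1)[OF P(1)] unfolding R by (rule monic_cofactor)
  ultimately obtain u where u: "R dvd u - 1" "jac u (P ^ 1 * R) = -1"
    using exists_unit_minus_one[OF q P(1), of R 1] by auto
  have ju: "jac u Q = -1" using u(2) by (simp add: R)
  have "Q dvd h * (u - 1)" unfolding R using P(3) u(1) by (rule mult_dvd_mono)
  hence dv: "Q dvd h * (u - 1) * y" for y by (rule dvd_mult2)
  have eq: "tau Q (h * (u * y)) = tau Q (h * y)" for y
  proof -
    have "h * (u * y) - h * y = h * (u - 1) * y" by (simp add: algebra_simps)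
    hence "h * (u * y) mod Q = h * y mod Q" using dv[of y] by (simp only: mod_eq_dvd_iff)
    thus ?thesis by (simp only: tau_def)
  qed
  have "tau Q (h * (f mod Q)) = tau Q (h * f)" for f
    by (simp add: tau_def mod_mult_right_eq)
  hence "gsum \<kappa> Q h = (\<Sum>y\<in>polys_lt (degree Q). jac ((u * y) mod Q) Q * \<kappa> (tau Q (h * (u * y))))"
    using sum_residues_mult[OF q Q(1), of u "\<lambda>y. jac y Q * \<kappa> (tau Q (h * y))"] ju by (simp add: gsum_def)
  also have "\<dots> = - gsum \<kappa> Q h"
    by (simp add: gsum_def jac_mod[OF Q0] jac_mult_num[OF q Q(1)] ju eq sum_negf)
  finally show ?thesis by simp
qed

lemma gsum_eq:
  fixes Q :: "'a::{field,finite} poly"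
  assumes "odd CARD('a)" "lead_coeff Q = 1" "squarefree Q"
  shows "gsum \<kappa> Q h = jac h Q * gsum \<kappa> Q 1"
proof (cases "jac h Q = 0")
  case True
  thus ?thesis using gsum_nonunit[OF assms True, of \<kappa>] by simp
qed (rule gsum_unit[OF assms(1,2)])

lemma jac_0:
  assumes "odd CARD('a)" "degree Q > 0"
  shows "jac (0 :: 'a::{field,finite} poly) Q = 0"
proof -
  have "jac [:0:] Q = leg 1 (to_ac (0::'a)) ^ degree Q" by (rule jac_const[OF assms(1)])
  thus ?thesis using assms by (simp add: power_0_left)
qed

lemma jac_smult:
  fixes Q :: "'a::{field,finite} poly"
  assumes "odd CARD('a)" "lead_coeff Q = 1"
  shows "jac (smult c f) Q = kap_odd c ^ degree Q * jac f Q"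
  using jac_mult_num[OF assms, of "[:c:]" f] jac_const[OF assms(1), of c Q] by (simp add: kap_odd_def)

lemma kap_odd_0: "odd CARD('a) \<Longrightarrow> kap_odd (0 :: 'a::{field,finite}) = 0"
  by (simp add: kap_odd_def)

lemma kap_odd_square:
  assumes "odd CARD('a)" "(c :: 'a::{field,finite}) \<noteq> 0"
  shows "kap_odd c ^ 2 = 1"
  using leg_cases[of 1 "to_ac c"] leg_eq_0_iff[OF assms(1), of 1 "to_ac c"] assms(2)
  by (auto simp: kap_odd_def)

lemma sum_polys_lt_Suc:
  fixes F :: "'a::{field,finite} poly \<Rightarrow> int"
  shows "(\<Sum>f\<in>polys_lt (Suc k). F f)
    = (\<Sum>f\<in>polys_lt k. F f) + (\<Sum>c\<in>UNIV - {0}. \<Sum>f\<in>monics k. F (smult c f))"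
proof -
  let ?T = "(\<lambda>(c, f). smult c f) ` ((UNIV - {0}) \<times> monics k) :: 'a poly set"
  have "polys_lt (Suc k) = polys_lt k \<union> ?T"
  proof (intro equalityI subsetI)
    fix f :: "'a poly" assume f: "f \<in> polys_lt (Suc k)"
    show "f \<in> polys_lt k \<union> ?T"
    proof (cases "f \<in> polys_lt k")
      case False
      hence d: "f \<noteq> 0" "degree f = k" using f by (auto simp: polys_lt_iff)
      moreover from this have "coeff f k \<noteq> 0" using leading_coeff_neq_0 by blast
      ultimately have "smult (inverse (lead_coeff f)) f \<in> monics k" by (simp add: monics_def)
      hence "f \<in> ?T" using d by (intro image_eqI[of _ _ "(lead_coeff f, smult (inverse (lead_coeff f)) f)"]) auto
      thus ?thesis ..
    qed simp
  next
    fix f :: "'a poly" assume "f \<in> polys_lt k \<union> ?T"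
    thus "f \<in> polys_lt (Suc k)" using polys_lt_mono[of k "Suc k" f] by (auto simp: polys_lt_iff monics_def)
  qed
  moreover have "polys_lt k \<inter> ?T = {}" by (auto simp: polys_lt_iff monics_def split: if_splits)
  ultimately have "(\<Sum>f\<in>polys_lt (Suc k). F f) = (\<Sum>f\<in>polys_lt k. F f) + (\<Sum>f\<in>?T. F f)"
    by (simp add: sum.union_disjoint)
  also have "(\<Sum>f\<in>?T. F f) = (\<Sum>(c, f)\<in>(UNIV - {0}) \<times> monics k. F (smult c f))"
  proof (subst sum.reindex)
    show "inj_on (\<lambda>(c, f). smult c f) ((UNIV - {0 :: 'a}) \<times> monics k)"
    proof (rule inj_onI)
      fix x y :: "'a \<times> 'a poly"
      assume xy: "x \<in> (UNIV - {0}) \<times> monics k" "y \<in> (UNIV - {0}) \<times> monics k"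
        and eq: "(case x of (c, f) \<Rightarrow> smult c f) = (case y of (c, f) \<Rightarrow> smult c f)"
      obtain a f b g where [simp]: "x = (a, f)" "y = (b, g)" by (cases x, cases y)
      have "coeff f k = 1" "coeff g k = 1" using xy by (auto simp: monics_def)
      hence "a = b" using arg_cong[OF eq, of "\<lambda>p. coeff p k"] by simp
      thus "x = y" using xy eq by (auto simp: smult_cancel)
    qed
  qed (auto intro: sum.cong)
  also have "\<dots> = (\<Sum>c\<in>UNIV - {0}. \<Sum>f\<in>monics k. F (smult c f))"
    by (rule sum.cartesian_product[symmetric])
  finally show ?thesis .
qed

text \<open>For even degree and nonsquare Q the L-function modulo Q vanishes at u = 1;
  \<open>jpart Q (Suc k)\<close> is the coefficient of u^k after division by 1 - u.\<close>

definition jpart :: "'a::{field,finite} poly \<Rightarrow> nat \<Rightarrow> int" where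
  "jpart Q k = (\<Sum>j<k. jsum Q j)"

lemma card_nonzero: "int (card (UNIV - {0 :: 'a::{field,finite}})) = int CARD('a) - 1"
  using card_field_gt_1[where ?'a='a] by (simp add: card_Diff_singleton of_nat_diff)

lemma sum_jac_polys_lt:
  fixes Q :: "'a::{field,finite} poly"
  assumes q: "odd CARD('a)" and Q: "lead_coeff Q = 1" and N: "even (degree Q)" "degree Q > 0"
  shows "(\<Sum>f\<in>polys_lt k. jac f Q) = (int CARD('a) - 1) * jpart Q k"
proof (induction k)
  case 0
  show ?case using jac_0[OF q N(2)] by (simp add: jpart_def)
next
  case (Suc k)
  have one: "kap_odd c ^ degree Q = 1" if "c \<noteq> 0" for c :: 'a
    using kap_odd_square[OF q that] N(1) by (auto elim!: evenE simp: power_mult)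
  have "(\<Sum>c\<in>UNIV - {0}. \<Sum>f\<in>monics k. jac (smult c f) Q) = (\<Sum>c\<in>UNIV - {0 :: 'a}. jsum Q k)"
    unfolding jsum_def by (intro sum.cong refl) (simp add: jac_smult[OF q Q] one)
  also have "\<dots> = (int CARD('a) - 1) * jsum Q k" using card_nonzero[where ?'a='a] by simp
  finally show ?case unfolding sum_polys_lt_Suc Suc.IH by (simp add: jpart_def algebra_simps)
qed

text \<open>The sum of \<open>gsum kap_even Q h\<close> over h in \<open>polys_lt k\<close> is
  evaluated in two ways: \<open>gsum_eq\<close> pulls out the Gauss sum, and orthogonality restricts
  y to \<open>polys_lt (degree Q - k)\<close>. In even degree the symbol ignores nonzero scalars, so
  both sides reduce to monic polynomials times q - 1.\<close>

lemma functional_equation_even: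
  fixes Q :: "'a::{field,finite} poly"
  assumes q: "odd CARD('a)" and Q: "lead_coeff Q = 1" "squarefree Q"
    and N: "even (degree Q)" "degree Q > 0" and k: "k \<le> degree Q"
  shows "gsum kap_even Q 1 * jpart Q k = (int CARD('a) - 1) * int CARD('a) ^ k * jpart Q (degree Q - k)"
proof -
  let ?N = "degree Q" and ?q = "int CARD('a)"
  have q1: "?q - 1 \<noteq> 0" using card_field_gt_1[where ?'a='a] by simp
  have "(?q - 1) * (gsum kap_even Q 1 * jpart Q k) = (\<Sum>h\<in>polys_lt k. jac h Q * gsum kap_even Q 1)"
    by (simp add: sum_jac_polys_lt[OF q Q(1) N] algebra_simps flip: sum_distrib_right)
  also have "\<dots> = (\<Sum>h\<in>polys_lt k. gsum kap_even Q h)"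
    by (intro sum.cong refl) (rule gsum_eq[OF q Q, symmetric])
  also have "\<dots> = (\<Sum>y\<in>polys_lt ?N. \<Sum>h\<in>polys_lt k. jac y Q * kap_even (tau Q (h * y) + 0))"
    unfolding gsum_def by (subst sum.swap) simp
  also have "\<dots> = (\<Sum>y\<in>polys_lt ?N. if y \<in> polys_lt (?N - k) then jac y Q * (?q ^ k * (?q - 1)) else 0)"
    by (intro sum.cong refl)
       (simp only: sum_kernel_tau[OF k _ N(2) sum_kap_even] flip: sum_distrib_left,
        simp add: kap_even_def)
  also have "\<dots> = (\<Sum>y\<in>polys_lt (?N - k). jac y Q * (?q ^ k * (?q - 1)))"
    by (rule sum.mono_neutral_cong_right) (auto intro: polys_lt_mono[of "?N - k"])
  also have "\<dots> = (?q - 1) * ((?q - 1) * ?q ^ k * jpart Q (?N - k))"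
    by (simp add: sum_jac_polys_lt[OF q Q(1) N] flip: sum_distrib_right)
  finally show ?thesis using q1 by simp
qed

text \<open>As in even degree, but \<open>h\<close> runs over monic polynomials, whose leading term
  contributes the shift \<open>tau Q (?x * y)\<close> in the kernel. In odd degree the symbol of a
  scalar is its quadratic character, which \<open>kap_odd\<close> of the leading coefficient of y
  compensates.\<close>

lemma functional_equation_odd:
  fixes Q :: "'a::{field,finite} poly"
  assumes q: "odd CARD('a)" and Q: "lead_coeff Q = 1" "squarefree Q"
    and N: "odd (degree Q)" and k: "k < degree Q"
  shows "gsum kap_odd Q 1 * jsum Q k = (int CARD('a) - 1) * int CARD('a) ^ k * jsum Q (degree Q - 1 - k)"
proof -
  let ?N = "degree Q" and ?q = "int CARD('a)" and ?x = "monom 1 k :: 'a poly"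
  have N0: "?N > 0" using k by simp
  have "gsum kap_odd Q 1 * jsum Q k = (\<Sum>h\<in>monics k. jac h Q * gsum kap_odd Q 1)"
    by (subst mult.commute) (simp add: jsum_def sum_distrib_right)
  also have "\<dots> = (\<Sum>h\<in>monics k. gsum kap_odd Q h)"
    by (intro sum.cong refl) (rule gsum_eq[OF q Q, symmetric])
  also have "\<dots> = (\<Sum>h\<in>polys_lt k. gsum kap_odd Q (?x + h))"
    unfolding monics_eq_image by (subst sum.reindex) (auto simp: inj_on_def)
  also have "\<dots> = (\<Sum>y\<in>polys_lt ?N. \<Sum>h\<in>polys_lt k. jac y Q * kap_odd (tau Q (h * y) + tau Q (?x * y)))"
    unfolding gsum_def by (subst sum.swap) (simp add: ring_distribs tau_add add.commute)
  also have "\<dots> = (\<Sum>y\<in>polys_lt ?N. if y \<in> polys_lt (?N - k) then jac y Q * (?q ^ k * kap_odd (tau Q (?x * y))) else 0)"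
    using k by (intro sum.cong refl)
       (simp only: sum_kernel_tau[OF less_imp_le _ N0 sum_kap_odd[OF q]] flip: sum_distrib_left, simp)
  also have "\<dots> = (\<Sum>y\<in>polys_lt (?N - k). jac y Q * (?q ^ k * kap_odd (tau Q (?x * y))))"
    by (rule sum.mono_neutral_cong_right) (auto intro: polys_lt_mono[of "?N - k"])
  also have "\<dots> = (\<Sum>y\<in>polys_lt (Suc (?N - 1 - k)). ?q ^ k * (jac y Q * kap_odd (coeff y (?N - 1 - k))))"
  proof (rule sum.cong)
    show "polys_lt (?N - k) = polys_lt (Suc (?N - 1 - k))" using k by (simp add: Suc_diff_Suc)
    fix y :: "'a poly" assume "y \<in> polys_lt (Suc (?N - 1 - k))"
    moreover have "?x \<in> polys_lt (Suc k)" by (simp add: polys_lt_iff degree_monom_eq)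
    ultimately have "?x * y \<in> polys_lt ?N"
      using polys_lt_mult[of ?x "Suc k" y "Suc (?N - 1 - k)"] k by simp
    hence "tau Q (?x * y) = coeff y (?N - 1 - k)"
      using k by (simp add: tau_small coeff_monom_mult)
    thus "jac y Q * (?q ^ k * kap_odd (tau Q (?x * y))) = ?q ^ k * (jac y Q * kap_odd (coeff y (?N - 1 - k)))"
      by simp
  qed
  also have "\<dots> = (\<Sum>c\<in>UNIV - {0 :: 'a}. \<Sum>f\<in>monics (?N - 1 - k). ?q ^ k * jac f Q)"
  proof -
    have "(\<Sum>y\<in>polys_lt (?N - 1 - k). ?q ^ k * (jac y Q * kap_odd (coeff y (?N - 1 - k)))) = 0"
      using q by (intro sum.neutral) (auto simp: polys_lt_def kap_odd_def)
    moreover have jj: "jac (smult c f) Q * kap_odd (coeff (smult c f) (?N - 1 - k)) = jac f Q"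
      if "c \<noteq> 0" "f \<in> monics (?N - 1 - k)" for c f
    proof -
      have "even (Suc ?N)" using N by simp
      then obtain j where j: "Suc ?N = 2 * j" by (elim evenE)
      have "kap_odd c ^ Suc ?N = 1"
        unfolding j power_mult kap_odd_square[OF q that(1)] by simp
      moreover have "coeff f (?N - 1 - k) = 1" using that(2) by (auto simp: monics_def)
      ultimately show ?thesis by (simp add: jac_smult[OF q Q(1)] mult_ac)
    qed
    moreover have "(\<Sum>c\<in>UNIV - {0 :: 'a}. \<Sum>f\<in>monics (?N - 1 - k). ?q ^ k * (jac (smult c f) Q * kap_odd (coeff (smult c f) (?N - 1 - k))))
        = (\<Sum>c\<in>UNIV - {0 :: 'a}. \<Sum>f\<in>monics (?N - 1 - k). ?q ^ k * jac f Q)"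
      by (intro sum.cong refl arg_cong2[where f = times] jj) auto
    ultimately show ?thesis unfolding sum_polys_lt_Suc by (simp only: add_0)
  qed
  also have "\<dots> = (?q - 1) * ?q ^ k * jsum Q (?N - 1 - k)"
    using card_nonzero[where ?'a='a] by (simp add: jsum_def sum_distrib_left mult.assoc)
  finally show ?thesis .
qed

text \<open>
  For irreducible \<open>P\<close> the sum is \<open>\<Sum> \<kappa> (tau (f\<^sup>2))\<close>, and \<open>f \<mapsto> tau (f\<^sup>2)\<close> is a hyperbolic
  quadratic form with the isotropic subspace of polynomials of degree below \<open>deg P / 2\<close>.
\<close>

lemma bij_split_polys_lt:
  "bij_betw (\<lambda>(w, v). w + monom 1 k * v) (polys_lt k \<times> polys_lt l) (polys_lt (k + l) :: 'a::{field,finite} poly set)"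
proof -
  let ?g = "\<lambda>(w, v). w + monom 1 k * v" and ?D = "polys_lt k \<times> polys_lt l :: ('a poly \<times> 'a poly) set"
  have inj: "inj_on ?g ?D"
  proof (rule inj_onI, clarify)
    fix w v w' v' :: "'a poly"
    assume w: "w \<in> polys_lt k" "w' \<in> polys_lt k" and eq: "w + monom 1 k * v = w' + monom 1 k * v'"
    have low: "coeff (w + monom 1 k * v) i = (if i < k then coeff w i else coeff v (i - k))"
      if "w \<in> polys_lt k" for w v :: "'a poly" and i
      using that by (auto simp: polys_lt_def coeff_monom_mult)
    have "coeff w i = coeff w' i" for i
    proof (cases "i < k")
      case True
      thus ?thesis using arg_cong[OF eq, of "\<lambda>p. coeff p i"] by (simp only: low[OF w(1)] low[OF w(2)] if_True)
    qed (use w in \<open>simp add: polys_lt_def\<close>)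
    moreover have "coeff v i = coeff v' i" for i
      using arg_cong[OF eq, of "\<lambda>p. coeff p (i + k)"] by (simp only: low[OF w(1)] low[OF w(2)]) simp
    ultimately show "w = w' \<and> v = v'" by (auto intro: poly_eqI)
  qed
  have "?g ` ?D \<subseteq> polys_lt (k + l)"
  proof (intro subsetI, elim imageE, clarify)
    fix w v :: "'a poly" assume wv: "w \<in> polys_lt k" "v \<in> polys_lt l"
    thus "w + monom 1 k * v \<in> polys_lt (k + l)" by (auto simp: polys_lt_def coeff_monom_mult)
  qed
  moreover have "card (?g ` ?D) = card (polys_lt (k + l) :: 'a poly set)"
    by (subst card_image[OF inj]) (simp add: card_cartesian_product card_polys_lt power_add)
  ultimately have "?g ` ?D = polys_lt (k + l)" by (intro card_subset_eq) simp_all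
  thus ?thesis using inj by (simp add: bij_betw_def)
qed

lemma gsum_irreducible:
  fixes P :: "'a::{field,finite} poly"
  assumes q: "odd CARD('a)" and P: "monic_irreducible P" and \<kappa>: "(\<Sum>c\<in>UNIV. \<kappa> c) = 0"
    and k: "k = degree P div 2"
  shows "gsum \<kappa> P 1 = int CARD('a) ^ k * (if even (degree P) then \<kappa> 0 else (\<Sum>c\<in>UNIV. \<kappa> (c\<^sup>2)))"
proof -
  note Pd = monic_irreducibleD[OF P]
  let ?N = "degree P"
  have kN: "k \<le> ?N" "2 * k \<le> ?N" "?N \<le> 2 * k + 1" using k by auto
  let ?x = "monom 1 k :: 'a poly"
  have two: "(2 :: 'a) \<noteq> 0" by (rule two_neq_0_field[OF q])
  \<comment> \<open>The kernel sums to 0 over all residues, so the symbol may be replaced by one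
    plus the symbol, the number of square roots.\<close>
  have "(\<Sum>y\<in>polys_lt ?N. \<kappa> (tau P (y * 1) + 0)) = 0"
    using sum_kernel_tau[of ?N P 1 \<kappa> 0] Pd \<kappa> by (simp add: polys_lt_iff)
  hence "gsum \<kappa> P 1 = (\<Sum>y\<in>polys_lt ?N. (1 + jac y P) * \<kappa> (tau P y))"
    by (simp add: gsum_def algebra_simps sum.distrib)
  also have "\<dots> = (\<Sum>f\<in>polys_lt ?N. \<kappa> (tau P (f\<^sup>2)))"
    using sum_squares_mod[OF q P, of "\<lambda>y. \<kappa> (tau P y)"] by (simp add: tau_mod)
  also have "\<dots> = (\<Sum>p\<in>polys_lt k \<times> polys_lt (?N - k). \<kappa> (tau P ((case p of (w, v) \<Rightarrow> w + ?x * v)\<^sup>2)))"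
    using sum.reindex_bij_betw[OF bij_split_polys_lt[of k "?N - k"], of "\<lambda>f. \<kappa> (tau P (f\<^sup>2))"] kN by simp
  also have "\<dots> = (\<Sum>w\<in>polys_lt k. \<Sum>v\<in>polys_lt (?N - k). \<kappa> (tau P ((w + ?x * v)\<^sup>2)))"
    unfolding sum.cartesian_product by (intro sum.cong) auto
  also have "\<dots> = (\<Sum>v\<in>polys_lt (?N - k). \<Sum>w\<in>polys_lt k. \<kappa> (tau P ((w + ?x * v)\<^sup>2)))"
    by (rule sum.swap)
  \<comment> \<open>The part w is isotropic, since w^2 has degree below N - 1, so the form is affine
    in w. Summing over w leaves only the v with 2 x^k v orthogonal to \<open>polys_lt k\<close>: v =
    0 for even degree, the constants for odd degree.\<close>
  also have "\<dots> = (\<Sum>v\<in>polys_lt (?N - k). if v \<in> polys_lt (?N - 2 * k) then int CARD('a) ^ k * \<kappa> (tau P ((?x * v)\<^sup>2)) else 0)"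
  proof (rule sum.cong)
    fix v :: "'a poly" assume v: "v \<in> polys_lt (?N - k)"
    let ?y = "smult 2 (?x * v)"
    have x: "?x \<in> polys_lt (Suc k)" by (simp add: polys_lt_iff degree_monom_eq)
    have y: "?y \<in> polys_lt ?N"
      using polys_lt_closed(4) polys_lt_mult[OF x v] kN by simp
    have "\<kappa> (tau P ((w + ?x * v)\<^sup>2)) = \<kappa> (tau P (w * ?y) + tau P ((?x * v)\<^sup>2))" if w: "w \<in> polys_lt k" for w
    proof -
      have ww: "w * w \<in> polys_lt (k + k - 1)" by (rule polys_lt_mult[OF w w])
      have "w * w \<in> polys_lt ?N" using polys_lt_mono[OF _ ww] kN by simp
      moreover have "coeff (w * w) (?N - 1) = 0" using ww kN by (simp add: polys_lt_def)
      ultimately have "tau P (w * w) = 0" by (simp add: tau_small)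
      moreover have "(w + ?x * v)\<^sup>2 = w * w + (w * ?y + (?x * v)\<^sup>2)"
      proof -
        have "?y = 2 * (?x * v)" by (simp add: numeral_poly)
        thus ?thesis by (simp only: power2_eq_square) (simp add: algebra_simps)
      qed
      ultimately show ?thesis by (simp add: tau_add)
    qed
    hence "(\<Sum>w\<in>polys_lt k. \<kappa> (tau P ((w + ?x * v)\<^sup>2))) = (\<Sum>w\<in>polys_lt k. \<kappa> (tau P (w * ?y) + tau P ((?x * v)\<^sup>2)))"
      by (rule sum.cong[OF refl])
    also have "\<dots> = (if ?y \<in> polys_lt (?N - k) then int CARD('a) ^ k * \<kappa> (tau P ((?x * v)\<^sup>2)) else 0)"
      by (rule sum_kernel_tau[OF kN(1) y Pd(5) \<kappa>])
    also have "?y \<in> polys_lt (?N - k) \<longleftrightarrow> v \<in> polys_lt (?N - 2 * k)"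
    proof (cases "v = 0")
      case False
      hence "?x * v \<noteq> 0" by simp
      moreover have "degree (?x * v) = k + degree v" using False by (simp add: degree_mult_eq degree_monom_eq)
      moreover have "k + degree v < ?N - k \<longleftrightarrow> degree v < ?N - 2 * k" by arith
      ultimately show ?thesis using two False by (simp add: polys_lt_iff)
    qed simp
    finally show "(\<Sum>w\<in>polys_lt k. \<kappa> (tau P ((w + ?x * v)\<^sup>2)))
        = (if v \<in> polys_lt (?N - 2 * k) then int CARD('a) ^ k * \<kappa> (tau P ((?x * v)\<^sup>2)) else 0)" .
  qed simp
  also have "\<dots> = (\<Sum>v\<in>polys_lt (?N - 2 * k). int CARD('a) ^ k * \<kappa> (tau P ((?x * v)\<^sup>2)))"
    by (rule sum.mono_neutral_cong_right) (auto intro: polys_lt_mono[of "?N - 2 * k"])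
  also have "\<dots> = int CARD('a) ^ k * (if even ?N then \<kappa> 0 else (\<Sum>c\<in>UNIV. \<kappa> (c\<^sup>2)))"
  proof (cases "even ?N")
    case True
    hence "?N - 2 * k = 0" using k by simp
    thus ?thesis using True by (simp add: tau_def)
  next
    case False
    hence N: "?N = 2 * k + 1" using k by simp
    have V1: "polys_lt 1 = (\<lambda>c. [:c:]) ` (UNIV :: 'a set)"
      using polys_lt_Suc[of 0, where ?'a='a] by auto
    have "tau P ((?x * [:c:])\<^sup>2) = c\<^sup>2" for c
    proof -
      have "(?x * [:c:])\<^sup>2 = monom (c\<^sup>2) (2 * k)"
        by (simp add: power2_eq_square smult_monom mult_monom mult_2)
      moreover have "monom (c\<^sup>2) (2 * k) \<in> polys_lt ?N" by (simp add: polys_lt_def N)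
      ultimately show ?thesis by (simp add: tau_small N)
    qed
    hence "(\<Sum>v\<in>polys_lt 1. int CARD('a) ^ k * \<kappa> (tau P ((?x * v)\<^sup>2))) = (\<Sum>c\<in>UNIV. int CARD('a) ^ k * \<kappa> (c\<^sup>2))"
      unfolding V1 by (subst sum.reindex) (auto simp: inj_on_def)
    thus ?thesis using False N by (simp add: sum_distrib_left)
  qed
  finally show ?thesis .
qed

lemma squarefree_irreducible:
  assumes "monic_irreducible P"
  shows "squarefree P"
proof (rule squarefreeI)
  fix x assume "x ^ 2 dvd P"
  then obtain r where "P = x ^ 2 * r" by (elim dvdE)
  hence "P = x * (x * r)" by (simp add: power2_eq_square mult.assoc)
  hence "is_unit x \<or> is_unit (x * r)" using monic_irreducibleD(2)[OF assms] irreducibleD by blast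
  thus "is_unit x" using is_unit_mult_iff by blast
qed

text \<open>The Gauss sum modulo an irreducible \<open>P\<close> is known exactly, so no sign
  remains undetermined; the main terms of the average over \<open>P\<close> depend on this.\<close>

theorem functional_equation_irreducible_even:
  fixes P :: "'a::{field,finite} poly"
  assumes q: "odd CARD('a)" and P: "monic_irreducible P" "even (degree P)" and k: "k \<le> degree P"
  shows "int CARD('a) ^ (degree P div 2) * jpart P k = int CARD('a) ^ k * jpart P (degree P - k)"
proof -
  note Pd = monic_irreducibleD[OF P(1)]
  have q1: "int CARD('a) - 1 \<noteq> 0" using card_field_gt_1[where ?'a='a] by simp
  have "gsum kap_even P 1 = int CARD('a) ^ (degree P div 2) * (int CARD('a) - 1)"
    using gsum_irreducible[OF q P(1) sum_kap_even refl] P(2) kap_even_def[of "0 :: 'a"] by simp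
  hence "(int CARD('a) - 1) * (int CARD('a) ^ (degree P div 2) * jpart P k)
      = (int CARD('a) - 1) * (int CARD('a) ^ k * jpart P (degree P - k))"
    using functional_equation_even[OF q Pd(1) squarefree_irreducible[OF P(1)] P(2) Pd(5) k] by (simp add: mult_ac)
  thus ?thesis using q1 by simp
qed

theorem functional_equation_irreducible_odd:
  fixes P :: "'a::{field,finite} poly"
  assumes q: "odd CARD('a)" and P: "monic_irreducible P" "odd (degree P)" and k: "k < degree P"
  shows "int CARD('a) ^ (degree P div 2) * jsum P k = int CARD('a) ^ k * jsum P (degree P - 1 - k)"
proof -
  note Pd = monic_irreducibleD[OF P(1)]
  have q1: "int CARD('a) - 1 \<noteq> 0" using card_field_gt_1[where ?'a='a] by simp
  have sq: "kap_odd (c\<^sup>2) = (if c = 0 then 0 else 1)" for c :: 'a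
  proof (cases "c = 0")
    case False
    have "kap_odd (c\<^sup>2) = leg 1 (to_ac c ^ 2)" by (simp add: kap_odd_def)
    also have "\<dots> = leg 1 (to_ac c) ^ 2" by (rule leg_power[OF q]) simp_all
    finally show ?thesis using kap_odd_square[OF q False] False by (simp add: kap_odd_def)
  qed (simp add: kap_odd_def q)
  have "(\<Sum>c\<in>(UNIV :: 'a set). kap_odd (c\<^sup>2)) = int CARD('a) - 1"
  proof -
    have "(\<Sum>c\<in>(UNIV :: 'a set). kap_odd (c\<^sup>2)) = (\<Sum>c\<in>UNIV - {0 :: 'a}. 1)"
      by (rule sum.mono_neutral_cong_right) (auto simp: sq kap_odd_0[OF q])
    thus ?thesis using card_nonzero[where ?'a='a] by simp
  qed
  hence "gsum kap_odd P 1 = int CARD('a) ^ (degree P div 2) * (int CARD('a) - 1)"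
    using gsum_irreducible[OF q P(1) sum_kap_odd[OF q] refl] P(2) by simp
  hence "(int CARD('a) - 1) * (int CARD('a) ^ (degree P div 2) * jsum P k)
      = (int CARD('a) - 1) * (int CARD('a) ^ k * jsum P (degree P - 1 - k))"
    using functional_equation_odd[OF q Pd(1) squarefree_irreducible[OF P(1)] P(2) k] by (simp add: mult_ac)
  thus ?thesis using q1 by simp
qed

section \<open>The zeta function of a hyperelliptic curve\<close>

lemma squarefree_not_square:
  fixes Q :: "'a::{field,finite} poly"
  assumes "squarefree Q" "degree Q > 0"
  shows "\<nexists>A. Q = A\<^sup>2"
proof
  assume "\<exists>A. Q = A\<^sup>2"
  then obtain A where A: "Q = A\<^sup>2" ..
  hence "A ^ 2 dvd Q" by simp
  hence "is_unit A" by (rule squarefreeD[OF assms(1)])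
  hence "is_unit Q" unfolding A power2_eq_square by (simp only: is_unit_mult_iff)
  moreover have "Q \<noteq> 0" using assms by auto
  ultimately show False using assms(2) by (simp add: is_unit_iff_degree)
qed

lemma norm_eq_of_prod_norm_eq:
  fixes \<beta> :: "nat \<Rightarrow> complex"
  assumes le: "\<And>i. i < d \<Longrightarrow> cmod (\<beta> i) \<le> r" and r: "r > 0"
    and eq: "(\<Prod>i<d. cmod (\<beta> i)) = r ^ d" and i: "i < d"
  shows "cmod (\<beta> i) = r"
proof -
  have "(\<Prod>j\<in>{..<d} - {i}. cmod (\<beta> j)) \<le> (\<Prod>j\<in>{..<d} - {i}. r)"
    using le by (intro prod_mono) auto
  also have "\<dots> = r ^ (d - 1)" using i by simp
  finally have rest: "(\<Prod>j\<in>{..<d} - {i}. cmod (\<beta> j)) \<le> r ^ (d - 1)" .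
  have "r * r ^ (d - 1) = r ^ d" using i by (simp flip: power_Suc)
  also have "\<dots> = cmod (\<beta> i) * (\<Prod>j\<in>{..<d} - {i}. cmod (\<beta> j))"
    unfolding eq[symmetric] using i by (intro prod.remove) auto
  also have "\<dots> \<le> cmod (\<beta> i) * r ^ (d - 1)" using rest by (intro mult_left_mono) auto
  finally have "r \<le> cmod (\<beta> i)" using r by simp
  thus ?thesis using le[OF i] by simp
qed

text \<open>As \<open>fps_nth S 0 = 0\<close>, comparing coefficients expresses n times the n-th
  coefficient through earlier ones.\<close>

lemma fps_ode_unique:
  fixes F G S :: "complex fps"
  assumes F: "fps_X * fps_deriv F = S * F" and G: "fps_X * fps_deriv G = S * G"
    and S: "fps_nth S 0 = 0" and eq: "fps_nth F 0 = fps_nth G 0"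
  shows "F = G"
proof (rule fps_ext)
  have rec: "of_nat n * fps_nth H n = (\<Sum>i=1..n. fps_nth S i * fps_nth H (n - i))"
    if "fps_X * fps_deriv H = S * H" for H n
  proof -
    have "fps_nth (fps_X * fps_deriv H) n = of_nat n * fps_nth H n" by (cases n) auto
    moreover have "fps_nth (S * H) n = (\<Sum>i=0..n. fps_nth S i * fps_nth H (n - i))" by (rule fps_mult_nth)
    moreover have "\<dots> = (\<Sum>i=1..n. fps_nth S i * fps_nth H (n - i))"
      by (simp add: sum.atLeast_Suc_atMost S)
    ultimately show ?thesis using that by simp
  qed
  fix n
  show "fps_nth F n = fps_nth G n"
  proof (induction n rule: less_induct)
    case (less n)
    show ?case
    proof (cases "n = 0")
      case False
      have "of_nat n * fps_nth F n = of_nat n * fps_nth G n"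
        unfolding rec[OF F] rec[OF G] using less.IH by (intro sum.cong) auto
      thus ?thesis using False by simp
    qed (simp add: eq)
  qed
qed

text \<open>Over each x lie 1 + leg points. With leading coefficient 1 in degree 2 g + 2, the points
  at infinity are the two solutions of v^2 = 1.\<close>

lemma num_points_eq:
  fixes Q :: "'a::{field,finite} poly"
  assumes q: "odd CARD('a)" and Q: "lead_coeff Q = 1" "degree Q = 2 * g + 2" and m: "m > 0"
  shows "int (num_points Q m) = int CARD('a) ^ m + charsum m Q + 2"
proof -
  let ?K = "Fq_ext m :: 'a alg_closure set"
  have fin: "finite ?K" by (rule finite_Fq_ext[OF m])
  have "affine_points Q m = (SIGMA x:?K. {y \<in> ?K. y\<^sup>2 = ev Q x})"
    by (auto simp: affine_points_def ev_def)
  hence "int (card (affine_points Q m)) = (\<Sum>x\<in>?K. int (card {y \<in> ?K. y\<^sup>2 = ev Q x}))"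
    using fin by (simp add: card_SigmaI)
  also have "\<dots> = (\<Sum>x\<in>?K. 1 + leg m (ev Q x))"
    by (intro sum.cong refl card_square_roots[OF q m] ev_in_Fq_ext)
  also have "\<dots> = int CARD('a) ^ m + charsum m Q"
    using card_Fq_ext[OF m, where ?'a='a] by (simp add: sum.distrib charsum_def)
  finally have "int (card (affine_points Q m)) = int CARD('a) ^ m + charsum m Q" .
  moreover have "infinite_points Q m = {v \<in> ?K. v\<^sup>2 = 1}"
    using Q by (simp add: infinite_points_def hyp_genus_def)
  hence "int (card (infinite_points Q m)) = 2"
    using card_square_roots[OF q m, of 1] by simp
  ultimately show ?thesis by (simp add: num_points_def)
qed

definition zeta_den :: "nat \<Rightarrow> complex fps" where
  "zeta_den q = (1 - fps_X) * (1 - fps_const (of_nat q) * fps_X)"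

lemma zeta_den_log_deriv:
  "fps_X * fps_deriv (zeta_den q) = - (pow_fps 1 + pow_fps (of_nat q)) * zeta_den q"
proof -
  let ?a = "\<lambda>i::nat. if i = 0 then 1 else of_nat q :: complex"
  have "zeta_den q = (\<Prod>i<2. 1 - fps_const (?a i) * fps_X)"
    by (simp add: zeta_den_def numeral_2_eq_2)
  moreover have "pow_fps 1 + pow_fps (of_nat q) = (\<Sum>i<2. pow_fps (?a i))"
    by (simp add: numeral_2_eq_2)
  ultimately show ?thesis using fps_log_deriv_prod[of ?a 2] by simp
qed

lemma zeta_den_nth_0: "fps_nth (zeta_den q) 0 = 1"
  by (simp add: zeta_den_def)

lemma hyp_zeta_nth_0: "fps_nth (hyp_zeta Q) 0 = 1"
  by (simp add: hyp_zeta_def)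

lemma hyp_zeta_log_deriv:
  "fps_X * fps_deriv (hyp_zeta Q) = Abs_fps (\<lambda>m. if m = 0 then 0 else of_nat (num_points Q m)) * hyp_zeta Q"
proof -
  define S :: "complex fps" where "S = Abs_fps (\<lambda>m. if m = 0 then 0 else of_nat (num_points Q m) / of_nat m)"
  have Z: "hyp_zeta Q = fps_compose (fps_exp 1) S" by (simp add: hyp_zeta_def S_def)
  have "fps_nth S 0 = 0" by (simp add: S_def)
  hence "fps_deriv (fps_compose (fps_exp 1) S) = fps_compose (fps_deriv (fps_exp 1)) S * fps_deriv S"
    by (rule fps_compose_deriv)
  hence "fps_X * fps_deriv (hyp_zeta Q) = (fps_X * fps_deriv S) * hyp_zeta Q"
    by (simp add: Z mult_ac)
  also have "fps_X * fps_deriv S = Abs_fps (\<lambda>m. if m = 0 then 0 else of_nat (num_points Q m))"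
    by (rule fps_ext) (auto simp: S_def fps_X_mult_nth)
  finally show ?thesis .
qed

lemma hyp_zeta_den_log_deriv:
  "fps_X * fps_deriv (hyp_zeta Q * zeta_den q)
    = (Abs_fps (\<lambda>m. if m = 0 then 0 else of_nat (num_points Q m)) - (pow_fps 1 + pow_fps (of_nat q)))
      * (hyp_zeta Q * zeta_den q)"
proof -
  have "fps_X * fps_deriv (hyp_zeta Q * zeta_den q)
      = (fps_X * fps_deriv (hyp_zeta Q)) * zeta_den q + hyp_zeta Q * (fps_X * fps_deriv (zeta_den q))"
    by (simp add: algebra_simps)
  also have "\<dots> = (Abs_fps (\<lambda>m. if m = 0 then 0 else of_nat (num_points Q m)) - (pow_fps 1 + pow_fps (of_nat q)))
      * (hyp_zeta Q * zeta_den q)"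
    unfolding hyp_zeta_log_deriv zeta_den_log_deriv by (simp add: algebra_simps)
  finally show ?thesis .
qed

text \<open>Of the 2 g + 1 inverse roots one is 1, the trivial zero in even degree. The remaining 2
  g have modulus at most sqrt q, and the functional equation makes the product of their moduli q^g,
  so each modulus is exactly sqrt q. The zeta function is then recognised by its logarithmic
  derivative and constant term.\<close>

theorem exists_unitarized_frobenius:
  fixes Q :: "'a::{field,finite} poly"
  assumes q: "odd CARD('a)" and Q: "Q \<in> monic_squarefree (2 * g + 2)"
  shows "\<exists>\<Theta>. is_unitarized_frobenius Q \<Theta>"
proof -
  have Qm: "lead_coeff Q = 1" and Qs: "squarefree Q" and N: "degree Q = 2 * g + 2"
    using Q by (auto simp: monic_squarefree_def)
  have N': "even (degree Q)" "degree Q > 0" by (auto simp: N)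
  have nsq: "\<nexists>A. Q = A\<^sup>2" by (rule squarefree_not_square[OF Qs N'(2)])
  let ?q = "CARD('a)"
  have q1: "?q > 1" by (rule card_field_gt_1)
  obtain \<alpha> where F: "Abs_fps (\<lambda>k. of_int (lcoef Q k)) = (\<Prod>i<2 * g + 1. 1 - fps_const (\<alpha> i) * fps_X :: complex fps)"
    and \<alpha>: "\<And>m. m > 0 \<Longrightarrow> of_int (charsum m Q) = - (\<Sum>i<2 * g + 1. \<alpha> i ^ m)"
    using exists_inverse_roots[OF q Qm nsq] by (auto simp: N)
  \<comment> \<open>The degree of Q is even, so the reciprocity sign is raised to an even
    power.\<close>
  have lj: "lcoef Q k = jsum Q k" for k
  proof -
    have "leg 1 (-1 :: 'a alg_closure) \<noteq> 0" by (subst leg_eq_0_iff[OF q]) auto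
    hence "leg 1 (-1 :: 'a alg_closure) ^ 2 = 1" using leg_cases[of 1 "-1 :: 'a alg_closure"] by auto
    moreover have "k * degree Q = 2 * (k * (g + 1))" by (simp add: N)
    ultimately have "leg 1 (-1 :: 'a alg_closure) ^ (k * degree Q) = 1" by (simp only: power_mult) simp
    thus ?thesis using lcoef_eq_jsum[OF q Qm, of k] by simp
  qed
  define p :: "complex poly" where "p = (\<Prod>i<2 * g + 1. [:1, - \<alpha> i:])"
  have "fps_of_poly p = (\<Prod>i<2 * g + 1. 1 - fps_const (\<alpha> i) * fps_X)"
    unfolding p_def fps_of_poly_prod
    by (intro prod.cong refl) (simp add: fps_of_poly_pCons fps_of_poly_const fps_const_neg[symmetric] del: fps_const_neg)
  hence "fps_of_poly p = Abs_fps (\<lambda>k. of_int (jsum Q k))" using F lj by simp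
  hence coeff_p: "coeff p k = of_int (jsum Q k)" for k
    by (metis fps_of_poly_nth fps_nth_Abs_fps)
  \<comment> \<open>The full residue sum is q - 1 times the value of the L-function at u = 1, which
    gives the trivial zero.\<close>
  have "(\<Sum>f\<in>polys_lt (degree Q). jac f Q) = 0"
    using nonsquare_exists_minus_one[OF q Qm nsq] sum_jac_residues[OF q Qm] by blast
  hence part0: "jpart Q (degree Q) = 0"
    using sum_jac_polys_lt[OF q Qm N', of "degree Q"] q1 by simp
  have "degree p \<le> 2 * g + 1"
    unfolding p_def by (rule order_trans[OF degree_prod_sum_le]) (auto intro!: order_trans[OF sum_bounded_above[where K = 1]])
  hence "(\<Sum>k\<le>degree p. coeff p k) = (\<Sum>k\<le>2 * g + 1. coeff p k)"
    by (intro sum.mono_neutral_left) (auto simp: coeff_eq_0)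
  hence "poly p 1 = (\<Sum>k\<le>2 * g + 1. coeff p k)"
    by (simp add: poly_altdef)
  also have "\<dots> = of_int (jpart Q (degree Q))"
    by (simp add: coeff_p jpart_def N lessThan_Suc_atMost[symmetric])
  finally have "poly p 1 = 0" by (simp add: part0)
  hence "\<exists>i\<in>{..<2 * g + 1}. poly [:1, - \<alpha> i:] 1 = 0"
    unfolding p_def poly_prod by (simp only: prod_zero_iff finite_lessThan)
  then obtain i0 where i0: "i0 < 2 * g + 1" "\<alpha> i0 = 1" by auto
  \<comment> \<open>Puts the trivial inverse root 1 in the last place.\<close>
  define \<beta> where "\<beta> = \<alpha> \<circ> transpose i0 (2 * g)"
  have perm: "bij_betw (transpose i0 (2 * g)) {..<2 * g + 1} {..<2 * g + 1}"
    using i0 by (intro bij_betw_byWitness[of _ "transpose i0 (2 * g)"]) (auto simp: transpose_def)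
  have \<beta>last: "\<beta> (2 * g) = 1" using i0 by (simp add: \<beta>_def)
  have p_\<beta>: "p = (\<Prod>i<2 * g. [:1, - \<beta> i:]) * [:1, -1:]"
  proof -
    have "p = (\<Prod>i<2 * g + 1. [:1, - \<beta> i:])"
      unfolding p_def \<beta>_def o_def by (rule prod.reindex_bij_betw[OF perm, symmetric])
    thus ?thesis by (simp add: \<beta>last)
  qed
  have pow_\<beta>: "of_int (charsum m Q) = - (\<Sum>i<2 * g. \<beta> i ^ m) - 1" if "m > 0" for m
  proof -
    have "(\<Sum>i<2 * g + 1. \<alpha> i ^ m) = (\<Sum>i<2 * g + 1. \<beta> i ^ m)"
      unfolding \<beta>_def o_def by (rule sum.reindex_bij_betw[OF perm, of "\<lambda>i. \<alpha> i ^ m", symmetric])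
    thus ?thesis using \<alpha>[OF that] \<beta>last by simp
  qed
  define r where "r = (\<Prod>i<2 * g. [:1, - \<beta> i:])"
  have coeff_r: "coeff r k = of_int (jpart Q (Suc k))" for k
  proof (induction k)
    case 0
    have "coeff p 0 = coeff r 0" by (simp add: p_\<beta> r_def[symmetric] coeff_mult)
    thus ?case by (simp add: coeff_p jpart_def)
  next
    case (Suc k)
    have "p = r - pCons 0 r" by (simp add: p_\<beta> r_def[symmetric])
    hence "coeff p (Suc k) = coeff r (Suc k) - coeff r k" by simp
    thus ?case using Suc by (simp add: coeff_p jpart_def)
  qed
  have "coeff r (2 * g) = (\<Prod>i<2 * g. - \<beta> i)"
  proof -
    have "degree (\<Prod>i<d. [:1, - \<beta> i:]) \<le> d \<and> coeff (\<Prod>i<d. [:1, - \<beta> i:]) d = (\<Prod>i<d. - \<beta> i)" for d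
    proof (induction d)
      case (Suc d)
      let ?P = "\<Prod>i<d. [:1, - \<beta> i:]"
      have "coeff ?P (Suc d) = 0" using Suc by (intro coeff_eq_0) auto
      moreover have "(\<Prod>i<Suc d. [:1, - \<beta> i:]) = ?P + pCons 0 (smult (- \<beta> d) ?P)" by simp
      moreover have "degree (?P + pCons 0 (smult (- \<beta> d) ?P)) \<le> Suc d"
        using Suc by (intro degree_add_le) (auto intro: order_trans[OF degree_pCons_le] order_trans[OF degree_smult_le])
      ultimately show ?case using Suc by (simp del: prod.lessThan_Suc) (simp add: mult.commute)
    qed simp
    thus ?thesis by (simp add: r_def)
  qed
  hence "(\<Prod>i<2 * g. - \<beta> i) = of_int (jpart Q (2 * g + 1))" by (simp add: coeff_r)
  moreover have "(\<Prod>i<2 * g. cmod (- \<beta> i)) = cmod (\<Prod>i<2 * g. - \<beta> i)" by (rule prod_norm)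
  ultimately have abs_top: "(\<Prod>i<2 * g. cmod (\<beta> i)) = \<bar>real_of_int (jpart Q (2 * g + 1))\<bar>"
    by simp
  \<comment> \<open>The functional equation at k = 1 and at k = 2 g + 1 links the top coefficient
    with \<open>jpart Q 1 = 1\<close> in both directions; eliminating the unknown Gauss sum leaves
    the square of the top coefficient.\<close>
  have "jpart Q (2 * g + 1) ^ 2 = int ?q ^ (2 * g)"
  proof -
    let ?G = "gsum kap_even Q 1"
    have 1: "?G * jpart Q 1 = (int ?q - 1) * int ?q ^ 1 * jpart Q (2 * g + 1)"
      using functional_equation_even[OF q Qm Qs N', of 1] by (simp add: N)
    have 2: "?G * jpart Q (2 * g + 1) = (int ?q - 1) * int ?q ^ (2 * g + 1) * jpart Q 1"
      using functional_equation_even[OF q Qm Qs N', of "2 * g + 1"] by (simp add: N)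
    have "jpart Q 1 = 1" by (simp add: jpart_def)
    hence G: "?G = ((int ?q - 1) * int ?q) * jpart Q (2 * g + 1)" using 1 by simp
    have "((int ?q - 1) * int ?q) * jpart Q (2 * g + 1) ^ 2 = ?G * jpart Q (2 * g + 1)"
      unfolding G by (simp only: power2_eq_square mult.assoc)
    also have "\<dots> = ((int ?q - 1) * int ?q) * int ?q ^ (2 * g)"
      unfolding 2 using \<open>jpart Q 1 = 1\<close> by simp
    finally have "((int ?q - 1) * int ?q) * jpart Q (2 * g + 1) ^ 2 = ((int ?q - 1) * int ?q) * int ?q ^ (2 * g)" .
    moreover have "(int ?q - 1) * int ?q \<noteq> 0" using q1 by simp
    ultimately show ?thesis by (simp only: mult_cancel_left) simp
  qed
  hence "real_of_int (jpart Q (2 * g + 1)) ^ 2 = real ?q ^ (2 * g)"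
    by (metis of_int_of_nat_eq of_int_power)
  hence "\<bar>real_of_int (jpart Q (2 * g + 1))\<bar> = sqrt (real ?q ^ (2 * g))"
    by (metis real_sqrt_abs)
  also have "\<dots> = sqrt (real ?q) ^ (2 * g)" by (rule real_sqrt_power)
  finally have prod_eq: "(\<Prod>i<2 * g. cmod (\<beta> i)) = sqrt (real ?q) ^ (2 * g)" using abs_top by simp
  have norm_\<beta>: "cmod (\<beta> i) = sqrt (real ?q)" if "i < 2 * g" for i
  proof (rule norm_eq_of_prod_norm_eq[OF _ _ prod_eq that])
    show "sqrt (real ?q) > 0" using q1 by simp
    fix i assume i: "i < 2 * g"
    hence lt: "transpose i0 (2 * g) i < 2 * g + 1" using i0 by (auto simp: transpose_def)
    show "cmod (\<beta> i) \<le> sqrt (real ?q)"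
      unfolding \<beta>_def o_def
      using inverse_roots_bound[where \<alpha> = \<alpha> and d = "2 * g + 1", OF q Qm nsq \<alpha> lt] .
  qed
  define \<theta> where "\<theta> = (\<lambda>i. Arg (\<beta> i))"
  have \<beta>_cis: "\<beta> i = of_real (sqrt (real ?q)) * cis (\<theta> i)" if "i < 2 * g" for i
    unfolding norm_\<beta>[OF that, symmetric] \<theta>_def using rcis_cmod_Arg[of "\<beta> i"] by (simp add: rcis_def)
  define G where "G = (\<Prod>i<2 * g. 1 - fps_const (\<beta> i) * fps_X)"
  have num: "of_nat (num_points Q m) = of_nat ?q ^ m + 1 - (\<Sum>i<2 * g. \<beta> i ^ m)" if "m > 0" for m
  proof -
    have "of_nat (num_points Q m) = (of_int (int (num_points Q m)) :: complex)" by simp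
    also have "\<dots> = of_nat ?q ^ m + of_int (charsum m Q) + 2"
      unfolding num_points_eq[OF q Qm N that] by simp
    finally show ?thesis using pow_\<beta>[OF that] by simp
  qed
  have "Abs_fps (\<lambda>m. if m = 0 then 0 else of_nat (num_points Q m)) - (pow_fps 1 + pow_fps (of_nat ?q))
      = - (\<Sum>i<2 * g. pow_fps (\<beta> i))"
    by (rule fps_ext) (auto simp: pow_fps_def num fps_sum_nth)
  hence ode_Z: "fps_X * fps_deriv (hyp_zeta Q * zeta_den ?q) = (- (\<Sum>i<2 * g. pow_fps (\<beta> i))) * (hyp_zeta Q * zeta_den ?q)"
    using hyp_zeta_den_log_deriv[of Q ?q] by (simp only:)
  have ode_G: "fps_X * fps_deriv G = (- (\<Sum>i<2 * g. pow_fps (\<beta> i))) * G"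
    unfolding G_def by (rule fps_log_deriv_prod)
  have G_0: "fps_nth G 0 = 1"
  proof -
    have "fps_nth (\<Prod>i<d. 1 - fps_const (\<beta> i) * fps_X) 0 = 1" for d by (induction d) auto
    thus ?thesis by (simp add: G_def)
  qed
  have "fps_nth (- (\<Sum>i<2 * g. pow_fps (\<beta> i))) 0 = 0" by (simp add: pow_fps_def fps_sum_nth)
  from fps_ode_unique[OF ode_Z ode_G this] have "hyp_zeta Q * zeta_den ?q = G"
    unfolding fps_mult_nth_0 hyp_zeta_nth_0 zeta_den_nth_0 G_0 by simp
  moreover have "zeta_den ?q \<noteq> 0" using zeta_den_nth_0[of ?q] by auto
  ultimately have "hyp_zeta Q = G / zeta_den ?q" by (metis nonzero_mult_div_cancel_right)
  moreover have "G = (\<Prod>i<2 * g. 1 - fps_const (of_real (sqrt (real ?q)) * cis (\<theta> i)) * fps_X)"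
    unfolding G_def using \<beta>_cis by (intro prod.cong) auto
  moreover have "hyp_genus Q = g" by (simp add: hyp_genus_def N)
  ultimately have "is_unitarized_frobenius Q (mat_diag (2 * g) (\<lambda>j. cis (\<theta> j)))"
    unfolding is_unitarized_frobenius_def zeta_den_def by (intro exI[of _ \<theta>]) simp
  thus ?thesis ..
qed

lemma mat_trace_mat_diag: "mat_trace (mat_diag d f) = (\<Sum>i<d. f i)"
  by (simp add: mat_trace_def diag_mat_def mat_diag_def interv_sum_list_conv_sum_set_nat atLeast0LessThan)

lemma mat_diag_pow: "mat_diag d f ^\<^sub>m n = mat_diag d (\<lambda>i. f i ^ n :: complex)"
proof (induction n)
  case 0
  show ?case using carrier_matD(1)[OF mat_diag_dim[of d f]] by simp
next
  case (Suc n)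
  show ?case by (simp add: Suc mult.commute)
qed

text \<open>Whichever matrix \<open>Frob_class\<close> chooses, the logarithmic derivative of the
  zeta function fixes the power sums of its scaled eigenvalues.\<close>

theorem trace_Frob_class:
  fixes Q :: "'a::{field,finite} poly"
  assumes q: "odd CARD('a)" and Q: "Q \<in> monic_squarefree (2 * g + 2)" and n: "n > 0"
  shows "mat_trace (Frob_class Q ^\<^sub>m n) = of_real (- (1 + of_int (charsum n Q)) / sqrt (real CARD('a)) ^ n)"
proof -
  let ?q = "CARD('a)"
  have Qm: "lead_coeff Q = 1" and N: "degree Q = 2 * g + 2"
    using Q by (auto simp: monic_squarefree_def)
  have g: "hyp_genus Q = g" by (simp add: hyp_genus_def N)
  have q1: "?q > 1" by (rule card_field_gt_1)
  have "is_unitarized_frobenius Q (Frob_class Q)"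
    unfolding Frob_class_def by (rule someI_ex[OF exists_unitarized_frobenius[OF q Q]])
  hence "\<exists>\<theta>. Frob_class Q = mat_diag (2 * g) (\<lambda>j. cis (\<theta> j)) \<and>
      hyp_zeta Q = (\<Prod>j<2 * g. 1 - fps_const (of_real (sqrt (real ?q)) * cis (\<theta> j)) * fps_X) / zeta_den ?q"
    unfolding is_unitarized_frobenius_def g zeta_den_def .
  then obtain \<theta> where *: "Frob_class Q = mat_diag (2 * g) (\<lambda>j. cis (\<theta> j)) \<and>
      hyp_zeta Q = (\<Prod>j<2 * g. 1 - fps_const (of_real (sqrt (real ?q)) * cis (\<theta> j)) * fps_X) / zeta_den ?q" ..
  note \<Theta> = conjunct1[OF *] and Z = conjunct2[OF *]
  define b where "b = (\<lambda>j. of_real (sqrt (real ?q)) * cis (\<theta> j))"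
  define G where "G = (\<Prod>j<2 * g. 1 - fps_const (b j) * fps_X)"
  \<comment> \<open>Constant term 1 makes the denominator a unit among power series, so the quotient
    in the zeta function is a genuine one.\<close>
  have "is_unit (zeta_den ?q)" unfolding fps_is_unit_iff zeta_den_nth_0 by (rule one_neq_zero)
  hence "zeta_den ?q dvd G" by (rule unit_imp_dvd)
  hence ZG: "hyp_zeta Q * zeta_den ?q = G" unfolding Z G_def b_def by (rule dvd_div_mult_self)
  have G0: "G \<noteq> 0"
  proof
    assume "G = 0"
    hence "fps_nth (hyp_zeta Q * zeta_den ?q) 0 = 0" unfolding ZG by simp
    thus False unfolding fps_mult_nth_0 hyp_zeta_nth_0 zeta_den_nth_0 by simp
  qed
  have "Abs_fps (\<lambda>m. if m = 0 then 0 else of_nat (num_points Q m)) - (pow_fps 1 + pow_fps (of_nat ?q))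
      = - (\<Sum>i<2 * g. pow_fps (b i))"
    using hyp_zeta_den_log_deriv[of Q ?q] fps_log_deriv_prod[of b "2 * g"] G0
    unfolding ZG G_def[symmetric] by (rule fps_log_deriv_unique)
  from arg_cong[OF this, of "\<lambda>f. fps_nth f n"]
  have "of_nat (num_points Q n) - (1 + of_nat ?q ^ n) = - (\<Sum>i<2 * g. b i ^ n)"
    using n by (simp add: pow_fps_def fps_sum_nth)
  moreover have "of_nat (num_points Q n) = (of_int (int (num_points Q n)) :: complex)" by simp
  ultimately have "(\<Sum>i<2 * g. b i ^ n) = - (1 + of_int (charsum n Q))"
    unfolding num_points_eq[OF q Qm N n] by (simp add: algebra_simps)
  moreover have "(\<Sum>i<2 * g. b i ^ n) = of_real (sqrt (real ?q)) ^ n * (\<Sum>i<2 * g. cis (\<theta> i) ^ n)"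
    by (simp add: b_def power_mult_distrib sum_distrib_left)
  moreover have "of_real (sqrt (real ?q)) ^ n \<noteq> (0 :: complex)" using q1 by simp
  ultimately have "(\<Sum>i<2 * g. cis (\<theta> i) ^ n) = - (1 + of_int (charsum n Q)) / of_real (sqrt (real ?q)) ^ n"
    by (simp add: field_simps)
  thus ?thesis unfolding \<Theta> mat_diag_pow mat_trace_mat_diag by simp
qed

section \<open>Sieving for squarefree polynomials\<close>

lemma irreducible_factor_of_nonunit:
  fixes x :: "'a::{field,finite} poly"
  assumes "x \<noteq> 0" "\<not> is_unit x"
  obtains S where "monic_irreducible S" "S dvd x"
  using exists_monic_irreducible_factor[of x] assms by (auto simp: is_unit_iff_degree)

lemma squarefree_iff_pmult:
  fixes f :: "'a::{field,finite} poly"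
  assumes "f \<noteq> 0"
  shows "squarefree f \<longleftrightarrow> (\<forall>P. monic_irreducible P \<longrightarrow> pmult P f \<le> 1)"
proof
  assume f: "squarefree f"
  show "\<forall>P. monic_irreducible P \<longrightarrow> pmult P f \<le> 1"
  proof (intro allI impI, rule ccontr)
    fix P assume P: "monic_irreducible P" and "\<not> pmult P f \<le> 1"
    hence "P ^ 2 dvd f" using power_dvd_iff_le_pmult[OF P assms] by simp
    hence "is_unit P" by (rule squarefreeD[OF f])
    thus False using monic_irreducibleD(2)[OF P] irreducible_not_unit by blast
  qed
next
  assume *: "\<forall>P. monic_irreducible P \<longrightarrow> pmult P f \<le> 1"
  show "squarefree f"
  proof (rule squarefreeI, rule ccontr)
    fix x assume x: "x ^ 2 dvd f" "\<not> is_unit x"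
    have "x \<noteq> 0" using x(1) assms by auto
    then obtain S where S: "monic_irreducible S" "S dvd x" using irreducible_factor_of_nonunit x(2) by blast
    hence "S ^ 2 dvd f" using x(1) dvd_power_same dvd_trans by blast
    hence "pmult S f \<ge> 2" using power_dvd_iff_le_pmult[OF S(1) assms] by blast
    thus False using * S(1) by fastforce
  qed
qed

lemma pmult_eq_imp_eq:
  fixes f g :: "'a::{field,finite} poly"
  assumes "lead_coeff f = 1" "lead_coeff g = 1" "\<And>P. monic_irreducible P \<Longrightarrow> pmult P f = pmult P g"
  shows "f = g"
  using assms
proof (induction f arbitrary: g rule: monic_induct)
  case one
  have g0: "g \<noteq> 0" using one by auto
  have "pmult P g = 0" if P: "monic_irreducible P" for P
    using one(2)[OF P] irreducible_not_unit[OF monic_irreducibleD(2)[OF P]] pmult_eq_0[OF P, of 1] by simp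
  hence "\<not> P dvd g" if "monic_irreducible P" for P
    using power_dvd_iff_le_pmult[OF that g0, of 1] that by simp
  hence "degree g = 0" using exists_monic_irreducible_factor by blast
  hence "g \<in> monics 0" using one by (simp add: monics_def)
  thus ?case by simp
next
  case (mult P f)
  note Pd = monic_irreducibleD[OF mult.hyps(1)]
  have f0: "f \<noteq> 0" and g0: "g \<noteq> 0" using mult.hyps mult.prems by auto
  have "pmult P g = Suc (pmult P f)"
    using mult.prems(2)[OF mult.hyps(1)] pmult_mult[OF mult.hyps(1) Pd(4) f0] pmult_irreducible[OF mult.hyps(1,1)] by simp
  hence "P dvd g" using power_dvd_iff_le_pmult[OF mult.hyps(1) g0, of 1] by simp
  then obtain h where h: "g = P * h" by (elim dvdE)
  have h0: "h \<noteq> 0" using h g0 by auto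
  have "lead_coeff h = 1" using mult.prems(1) Pd(1) unfolding h by (rule monic_cofactor)
  moreover have "pmult S f = pmult S h" if S: "monic_irreducible S" for S
    using mult.prems(2)[OF S] unfolding h pmult_mult[OF S Pd(4) f0] pmult_mult[OF S Pd(4) h0] by simp
  ultimately have "f = h" by (rule mult.IH)
  thus ?case by (simp add: h)
qed

lemma monic_squarefree_altdef: "monic_squarefree d = {Q \<in> monics d. squarefree Q}"
  by (auto simp: monic_squarefree_def monics_def)

lemma finite_monic_squarefree [simp]: "finite (monic_squarefree d)"
  by (simp add: monic_squarefree_altdef)

lemma monic_squarefree_0 [simp]: "monic_squarefree 0 = {1}"
  by (auto simp: monic_squarefree_altdef)

lemma exists_square_part:
  fixes f :: "'a::{field,finite} poly"
  assumes "lead_coeff f = 1"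
  shows "\<exists>A Q. lead_coeff A = 1 \<and> lead_coeff Q = 1 \<and> squarefree Q \<and> f = A\<^sup>2 * Q"
  using assms
proof (induction "degree f" arbitrary: f rule: less_induct)
  case less
  have f0: "f \<noteq> 0" using less.prems by auto
  show ?case
  proof (cases "squarefree f")
    case True
    thus ?thesis using less.prems by (intro exI[of _ 1] exI[of _ f]) simp
  next
    case False
    then obtain P where P: "monic_irreducible P" "pmult P f \<ge> 2"
      using squarefree_iff_pmult[OF f0] by (metis not_less_eq_eq one_add_one plus_1_eq_Suc)
    hence "P ^ 2 dvd f" using power_dvd_iff_le_pmult[OF P(1) f0] by blast
    then obtain h where h: "f = P ^ 2 * h" by (elim dvdE)
    note Pd = monic_irreducibleD[OF P(1)]
    have h0: "h \<noteq> 0" using h f0 by auto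
    have "lead_coeff (P ^ 2) = 1" using lead_coeff_power[of P 2] Pd(1) by simp
    from monic_cofactor[OF less.prems[unfolded h] this] have "lead_coeff h = 1" .
    moreover have "degree h < degree f"
      using Pd h0 by (simp add: h degree_mult_eq degree_power_eq)
    ultimately obtain A Q where AQ: "lead_coeff A = 1" "lead_coeff Q = 1" "squarefree Q" "h = A\<^sup>2 * Q"
      using less.hyps by blast
    have "lead_coeff (P * A) = 1" using lead_coeff_mult[of P A] Pd AQ by simp
    moreover have "f = (P * A)\<^sup>2 * Q" by (simp add: h AQ(4) power_mult_distrib mult.assoc)
    ultimately show ?thesis using AQ by blast
  qed
qed

lemma square_part_unique:
  fixes A B Q R :: "'a::{field,finite} poly"
  assumes "lead_coeff A = 1" "lead_coeff B = 1" "squarefree Q" "squarefree R" "A\<^sup>2 * Q = B\<^sup>2 * R"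
  shows "A = B" "Q = R"
proof -
  have nz: "A \<noteq> 0" "B \<noteq> 0" "Q \<noteq> 0" "R \<noteq> 0" using assms by auto
  show AB: "A = B"
  proof (rule pmult_eq_imp_eq[OF assms(1,2)])
    fix P :: "'a poly" assume P: "monic_irreducible P"
    have "pmult P (A\<^sup>2 * Q) = 2 * pmult P A + pmult P Q" "pmult P (B\<^sup>2 * R) = 2 * pmult P B + pmult P R"
      using nz by (simp_all add: pmult_mult[OF P] power2_eq_square)
    moreover have "pmult P Q \<le> 1" "pmult P R \<le> 1"
      using assms(3,4) P squarefree_iff_pmult nz by blast+
    ultimately show "pmult P A = pmult P B" using assms(5) by simp
  qed
  show "Q = R" using assms(5) nz by (simp add: AB)
qed

text \<open>Every monic f is A^2 Q with A monic and Q monic squarefree in exactly one way; this is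
  the sieve.\<close>

lemma sum_monics_square_part:
  fixes w :: "'a::{field,finite} poly \<Rightarrow> int"
  shows "(\<Sum>f\<in>monics d. w f) = (\<Sum>i\<le>d div 2. \<Sum>A\<in>monics i. \<Sum>Q\<in>monic_squarefree (d - 2 * i). w (A\<^sup>2 * Q))"
proof -
  let ?D = "SIGMA i:{..d div 2}. monics i \<times> monic_squarefree (d - 2 * i) :: (nat \<times> 'a poly \<times> 'a poly) set"
  let ?g = "\<lambda>(i, A, Q). A\<^sup>2 * Q"
  have "inj_on ?g ?D"
  proof (rule inj_onI)
    fix x y assume x: "x \<in> ?D" and y: "y \<in> ?D" and eq: "?g x = ?g y"
    obtain i A Q j B R where [simp]: "x = (i, A, Q)" "y = (j, B, R)" by (cases x, cases y)
    have *: "lead_coeff A = 1" "lead_coeff B = 1" "squarefree Q" "squarefree R" "degree A = i" "degree B = j"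
      using x y by (auto simp: monics_def monic_squarefree_def)
    have "A\<^sup>2 * Q = B\<^sup>2 * R" using eq by simp
    from square_part_unique[OF *(1-4) this] show "x = y" using * by simp
  qed
  moreover have "?g ` ?D = monics d"
  proof (intro equalityI subsetI)
    fix f assume "f \<in> ?g ` ?D"
    then obtain i A Q where *: "f = A\<^sup>2 * Q" "i \<le> d div 2" "A \<in> monics i" "Q \<in> monics (d - 2 * i)"
      by (auto simp: monic_squarefree_altdef)
    have "A * A \<in> monics (i + i)" using * monics_mult by blast
    hence "A * A * Q \<in> monics (i + i + (d - 2 * i))" using * monics_mult by blast
    moreover have "i + i + (d - 2 * i) = d" using *(2) by simp
    ultimately show "f \<in> monics d" by (simp add: *(1) power2_eq_square)
  next
    fix f :: "'a poly" assume f: "f \<in> monics d"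
    then obtain A Q where AQ: "lead_coeff A = 1" "lead_coeff Q = 1" "squarefree Q" "f = A\<^sup>2 * Q"
      using exists_square_part[of f] by (auto simp: monics_def)
    have "A \<noteq> 0" "Q \<noteq> 0" using AQ by auto
    hence "d = 2 * degree A + degree Q"
      using f by (simp add: AQ(4) monics_def degree_mult_eq degree_power_eq)
    hence "(degree A, A, Q) \<in> ?D" using AQ by (simp add: monics_def monic_squarefree_def)
    thus "f \<in> ?g ` ?D" using AQ(4) by (intro image_eqI[of _ _ "(degree A, A, Q)"]) simp_all
  qed
  ultimately have "bij_betw ?g ?D (monics d)" by (simp add: bij_betw_def)
  hence "(\<Sum>f\<in>monics d. w f) = (\<Sum>x\<in>?D. w (?g x))" by (rule sum.reindex_bij_betw[symmetric])
  also have "\<dots> = (\<Sum>(i, A, Q)\<in>?D. w (A\<^sup>2 * Q))" by (intro sum.cong) auto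
  also have "\<dots> = (\<Sum>i\<le>d div 2. \<Sum>(A, Q)\<in>monics i \<times> monic_squarefree (d - 2 * i). w (A\<^sup>2 * Q))"
    by (rule sum.Sigma[symmetric]) auto
  finally show ?thesis by (simp add: sum.cartesian_product)
qed

text \<open>A convolution in steps of 2 is inverted by one difference: for v i = q^i it returns
  \<open>t d\<close> itself, and for other weights the deviation of v from geometric growth remains
  as a correction.\<close>

lemma shifted_difference:
  fixes v t :: "nat \<Rightarrow> int" and q :: int
  defines "c \<equiv> \<lambda>d. \<Sum>i\<le>d div 2. v i * t (d - 2 * i)"
  assumes "d \<ge> 2"
  shows "c d - q * c (d - 2) = v 0 * t d + (\<Sum>i=1..d div 2. (v i - q * v (i - 1)) * t (d - 2 * i))"
proof -
  have "c d = v 0 * t d + (\<Sum>i=1..d div 2. v i * t (d - 2 * i))"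
  proof -
    have "{..d div 2} = insert 0 {1..d div 2}" by auto
    thus ?thesis by (simp add: c_def)
  qed
  moreover have "c (d - 2) = (\<Sum>i=1..d div 2. v (i - 1) * t (d - 2 * i))"
    unfolding c_def
    by (rule sum.reindex_bij_witness[of _ "\<lambda>i. i - 1" Suc]) (use assms in auto)
  ultimately show ?thesis by (simp add: sum_distrib_left left_diff_distrib sum_subtractf algebra_simps)
qed

lemma card_monic_squarefree:
  assumes "d \<ge> 2"
  shows "int (card (monic_squarefree d :: 'a::{field,finite} poly set)) = int CARD('a) ^ d - int CARD('a) ^ (d - 1)"
proof -
  let ?q = "int CARD('a)" and ?t = "\<lambda>d. int (card (monic_squarefree d :: 'a poly set))"
  have conv: "(\<Sum>i\<le>d div 2. ?q ^ i * ?t (d - 2 * i)) = ?q ^ d" for d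
    using sum_monics_square_part[of "\<lambda>_ :: 'a poly. 1" d] by (simp add: card_monics)
  have "?q ^ d - ?q * ?q ^ (d - 2) = ?t d"
    using shifted_difference[OF assms, of "\<lambda>i. ?q ^ i" ?t ?q] unfolding conv
    by (simp add: power_eq_if)
  moreover have "?q * ?q ^ (d - 2) = ?q ^ (d - 1)"
    using assms by (simp add: Suc_diff_Suc numeral_2_eq_2 flip: power_Suc)
  ultimately show ?thesis by simp
qed

lemma card_monic_squarefree_le: "card (monic_squarefree d :: 'a::{field,finite} poly set) \<le> CARD('a) ^ d"
  using card_mono[of "monics d" "monic_squarefree d :: 'a poly set"]
  by (simp add: monic_squarefree_altdef card_monics)

section \<open>Symbols averaged over squarefree polynomials\<close>

definition sqsum :: "'a::{field,finite} poly \<Rightarrow> nat \<Rightarrow> int" where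
  "sqsum P d = (\<Sum>Q\<in>monic_squarefree d. jac Q P)"

text \<open>For irreducible \<open>P\<close> the square of the symbol is the indicator of
  coprimality, so this counts the squarefree Q prime to \<open>P\<close>.\<close>

definition sqcop :: "'a::{field,finite} poly \<Rightarrow> nat \<Rightarrow> int" where
  "sqcop P d = (\<Sum>Q\<in>monic_squarefree d. (jac Q P)\<^sup>2)"

lemma jac_square_irreducible:
  fixes P :: "'a::{field,finite} poly"
  assumes "odd CARD('a)" "monic_irreducible P"
  shows "(jac f P)\<^sup>2 = (if P dvd f then 0 else 1)"
  using jac_cases[of f P] jac_eq_0_iff[OF assms, of f] by auto

lemma sum_jac_squares:
  fixes P :: "'a::{field,finite} poly"
  assumes q: "odd CARD('a)" and P: "monic_irreducible P"
  shows "(\<Sum>A\<in>monics i. (jac A P)\<^sup>2) = int CARD('a) ^ i - (if degree P \<le> i then int CARD('a) ^ (i - degree P) else 0)"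
proof -
  note Pd = monic_irreducibleD[OF P]
  have "(\<Sum>A\<in>monics i. (jac A P)\<^sup>2) = (\<Sum>A\<in>(monics i :: 'a poly set). 1 - (if P dvd A then 1 else 0))"
    by (intro sum.cong refl) (simp add: jac_square_irreducible[OF q P])
  also have "\<dots> = int CARD('a) ^ i - int (card {A \<in> monics i. P dvd A})"
    by (simp add: sum_subtractf card_monics flip: sum.inter_filter)
  also have "int (card {A \<in> monics i. P dvd A}) = (\<Sum>f | f \<in> monics i \<and> P ^ 1 dvd f. jac 1 f)"
    by simp
  also have "\<dots> = (if degree P \<le> i then int CARD('a) ^ (i - degree P) else 0)"
    unfolding sum_multiples_irreducible_power[OF q Pd(1)] by (simp add: lcoef_def card_monics)
  finally show ?thesis .
qed

text \<open>In generating functions: the series of \<open>sqsum P\<close> is L(u) (1 - q u^2) / (1 -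
  u^(2 deg P)). The weight v i counts the monic A of degree i prime to P; for i \<ge> 1 the
  difference v i - q v (i - 1) vanishes except at i = deg P, where it is -1.\<close>

lemma sqsum_recurrence:
  fixes P :: "'a::{field,finite} poly"
  assumes q: "odd CARD('a)" and P: "monic_irreducible P" and d: "d \<ge> 2"
  shows "sqsum P d = jsum P d - int CARD('a) * jsum P (d - 2) + (if 2 * degree P \<le> d then sqsum P (d - 2 * degree P) else 0)"
proof -
  note Pd = monic_irreducibleD[OF P]
  let ?q = "int CARD('a)" and ?n = "degree P"
  define v where "v = (\<lambda>i. \<Sum>A\<in>monics i. (jac A P)\<^sup>2)"
  have v: "v i = ?q ^ i - (if ?n \<le> i then ?q ^ (i - ?n) else 0)" for i
    unfolding v_def by (rule sum_jac_squares[OF q P])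
  have conv: "jsum P d = (\<Sum>i\<le>d div 2. v i * sqsum P (d - 2 * i))" for d
    unfolding jsum_def sum_monics_square_part[of "\<lambda>f. jac f P" d] v_def sqsum_def
    by (simp add: jac_mult_num[OF q Pd(1)] power2_eq_square sum_product)
  have v0: "v 0 = 1" using Pd(5) by (simp add: v)
  have dv: "v i - ?q * v (i - 1) = (if i = ?n then -1 else 0)" if i: "i \<ge> 1" for i
  proof -
    obtain j where j: "i = Suc j" using i by (cases i) auto
    consider "i < ?n" | "i = ?n" | "?n \<le> j" using j by linarith
    thus ?thesis
    proof cases
      case 2
      hence "?n = Suc j" by (simp add: j)
      thus ?thesis by (simp add: v j)
    next
      case 3
      thus ?thesis by (simp add: v j Suc_diff_le right_diff_distrib)
    qed (auto simp: v j)
  qed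
  have "jsum P d - ?q * jsum P (d - 2) = sqsum P d + (\<Sum>i=1..d div 2. (v i - ?q * v (i - 1)) * sqsum P (d - 2 * i))"
    unfolding conv using shifted_difference[OF d, of v "sqsum P" ?q] v0 by simp
  also have "(\<Sum>i=1..d div 2. (v i - ?q * v (i - 1)) * sqsum P (d - 2 * i))
      = (\<Sum>i=1..d div 2. if i = ?n then - sqsum P (d - 2 * ?n) else 0)"
  proof (intro sum.cong refl)
    fix i assume "i \<in> {1..d div 2}"
    hence "1 \<le> i" by simp
    thus "(v i - ?q * v (i - 1)) * sqsum P (d - 2 * i) = (if i = ?n then - sqsum P (d - 2 * ?n) else 0)"
      using dv[of i] by simp
  qed
  also have "\<dots> = (if 2 * ?n \<le> d then - sqsum P (d - 2 * ?n) else 0)"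
    using Pd(5) by (subst sum.delta) auto
  finally show ?thesis by (simp split: if_splits)
qed

lemma abs_sqsum_le_card: "\<bar>sqsum P d\<bar> \<le> int CARD('a) ^ d" for P :: "'a::{field,finite} poly"
proof -
  have "\<bar>sqsum P d\<bar> \<le> (\<Sum>Q\<in>(monic_squarefree d :: 'a poly set). 1)"
    unfolding sqsum_def by (rule order_trans[OF sum_abs]) (intro sum_mono abs_jac_le_1)
  also have "\<dots> \<le> int CARD('a) ^ d"
    using of_nat_mono[OF card_monic_squarefree_le[of d, where ?'a='a], where ?'a=int] by simp
  finally show ?thesis .
qed

lemma irreducible_not_square:
  "monic_irreducible P \<Longrightarrow> \<nexists>A. P = A\<^sup>2"
  by (rule squarefree_not_square[OF squarefree_irreducible monic_irreducibleD(5)])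

lemma jsum_irreducible_eq_0:
  fixes P :: "'a::{field,finite} poly"
  assumes q: "odd CARD('a)" and P: "monic_irreducible P" and k: "degree P \<le> k"
  shows "jsum P k = 0"
proof -
  obtain u where "jac u P = -1"
    using nonsquare_exists_minus_one[OF q monic_irreducibleD(1)[OF P] irreducible_not_square[OF P]] .
  thus ?thesis using jsum_eq_0[OF q monic_irreducibleD(1)[OF P] _ k] by blast
qed

text \<open>From degree deg P + 2 on, both L-coefficients vanish and the recurrence leads back to a
  smaller d or to 0. Below that, the number of polynomials is a sufficient bound.\<close>

lemma abs_sqsum_le:
  fixes P :: "'a::{field,finite} poly"
  assumes q: "odd CARD('a)" and P: "monic_irreducible P"
  shows "\<bar>sqsum P d\<bar> \<le> int CARD('a) ^ (degree P + 1)"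
proof (induction d rule: less_induct)
  case (less d)
  note Pd = monic_irreducibleD[OF P]
  show ?case
  proof (cases "d \<ge> degree P + 2")
    case True
    hence "sqsum P d = (if 2 * degree P \<le> d then sqsum P (d - 2 * degree P) else 0)"
      using sqsum_recurrence[OF q P, of d] jsum_irreducible_eq_0[OF q P, of d] jsum_irreducible_eq_0[OF q P, of "d - 2"] by simp
    thus ?thesis using less[of "d - 2 * degree P"] Pd(5) True by auto
  next
    case False
    have "\<bar>sqsum P d\<bar> \<le> int CARD('a) ^ d" by (rule abs_sqsum_le_card)
    also have "\<dots> \<le> int CARD('a) ^ (degree P + 1)"
      using False card_field_gt_1[where ?'a='a] by (intro power_increasing) auto
    finally show ?thesis .
  qed
qed

text \<open>A squarefree multiple of \<open>P\<close> is \<open>P * R\<close> with \<open>R\<close>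
  squarefree and prime to \<open>P\<close>, so the multiples in degree d are what
  \<open>sqcop\<close> counts in degree d - deg P.\<close>

lemma sqcop_recurrence:
  fixes P :: "'a::{field,finite} poly"
  assumes q: "odd CARD('a)" and P: "monic_irreducible P"
  shows "sqcop P d = int (card (monic_squarefree d :: 'a poly set)) - (if degree P \<le> d then sqcop P (d - degree P) else 0)"
proof -
  note Pd = monic_irreducibleD[OF P]
  let ?F = "monic_squarefree :: nat \<Rightarrow> 'a poly set"
  have cop: "sqcop P d = int (card {Q \<in> ?F d. \<not> P dvd Q})" for d
  proof -
    have "sqcop P d = (\<Sum>Q\<in>?F d. if \<not> P dvd Q then 1 else 0)"
      unfolding sqcop_def by (intro sum.cong refl) (simp add: jac_square_irreducible[OF q P])
    thus ?thesis by (simp flip: sum.inter_filter)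
  qed
  have sq: "squarefree (P * R) \<longleftrightarrow> squarefree R \<and> \<not> P dvd R" if R: "R \<noteq> 0" for R
  proof
    assume PR: "squarefree (P * R)"
    have "\<not> P dvd R"
    proof
      assume "P dvd R"
      hence "P ^ 2 dvd P * R" by (simp add: power2_eq_square)
      hence "is_unit P" by (rule squarefreeD[OF PR])
      thus False using irreducible_not_unit[OF Pd(2)] by blast
    qed
    thus "squarefree R \<and> \<not> P dvd R" using squarefree_mono[OF _ PR, of R] by simp
  next
    assume *: "squarefree R \<and> \<not> P dvd R"
    have PR0: "P * R \<noteq> 0" using Pd(4) R by simp
    show "squarefree (P * R)" unfolding squarefree_iff_pmult[OF PR0]
    proof (intro allI impI)
      fix S :: "'a poly" assume S: "monic_irreducible S"
      have "pmult S R \<le> 1" using * squarefree_iff_pmult[OF R] S by blast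
      moreover have "pmult P R = 0" using pmult_eq_0[OF P] * by blast
      ultimately show "pmult S (P * R) \<le> 1"
        unfolding pmult_mult[OF S Pd(4) R] pmult_irreducible[OF S P] by auto
    qed
  qed
  have "{Q \<in> ?F d. P dvd Q} = (if degree P \<le> d then (\<lambda>R. P * R) ` {R \<in> ?F (d - degree P). \<not> P dvd R} else {})"
  proof (intro equalityI subsetI)
    fix Q assume Q: "Q \<in> {Q \<in> ?F d. P dvd Q}"
    then obtain R where R: "Q = P * R" by (auto elim: dvdE)
    have Q0: "Q \<noteq> 0" "degree Q = d" "lead_coeff Q = 1" "squarefree Q" using Q by (auto simp: monic_squarefree_def)
    have R0: "R \<noteq> 0" using R Q0 by auto
    have "d = degree P + degree R" using Q0 Pd R0 R by (auto simp: degree_mult_eq)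
    moreover have "lead_coeff R = 1" using Q0(3) Pd(1) unfolding R by (rule monic_cofactor)
    moreover have "squarefree R \<and> \<not> P dvd R" using Q0(4) sq[OF R0] R by simp
    ultimately show "Q \<in> (if degree P \<le> d then (\<lambda>R. P * R) ` {R \<in> ?F (d - degree P). \<not> P dvd R} else {})"
      using R by (auto simp: monic_squarefree_def intro!: image_eqI[of _ _ R])
  next
    fix Q assume Q: "Q \<in> (if degree P \<le> d then (\<lambda>R. P * R) ` {R \<in> ?F (d - degree P). \<not> P dvd R} else {})"
    hence le: "degree P \<le> d" by (auto split: if_splits)
    with Q obtain R where R: "Q = P * R" "R \<in> ?F (d - degree P)" "\<not> P dvd R" by auto
    have Rm: "R \<in> monics (d - degree P)" "squarefree R" using R(2) by (auto simp: monic_squarefree_altdef)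
    have "Q \<in> monics d" using monics_mult[OF Pd(6) Rm(1)] le R(1) by simp
    moreover have "squarefree Q" using sq[OF monics_nonzero[OF Rm(1)]] Rm(2) R by simp
    ultimately show "Q \<in> {Q \<in> ?F d. P dvd Q}" using R(1) by (simp add: monic_squarefree_altdef)
  qed
  moreover have "inj_on (\<lambda>R. P * R) {R \<in> ?F (d - degree P). \<not> P dvd R}"
    using Pd(4) by (auto simp: inj_on_def)
  ultimately have "int (card {Q \<in> ?F d. P dvd Q}) = (if degree P \<le> d then sqcop P (d - degree P) else 0)"
    unfolding cop by (cases "degree P \<le> d") (simp_all only: if_True if_False card_image card.empty of_nat_0)
  moreover have "card (?F d) = card {Q \<in> ?F d. P dvd Q} + card {Q \<in> ?F d. \<not> P dvd Q}"
  proof -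
    have "?F d = {Q \<in> ?F d. P dvd Q} \<union> {Q \<in> ?F d. \<not> P dvd Q}" by auto
    moreover have "card ({Q \<in> ?F d. P dvd Q} \<union> {Q \<in> ?F d. \<not> P dvd Q})
        = card {Q \<in> ?F d. P dvd Q} + card {Q \<in> ?F d. \<not> P dvd Q}"
      by (intro card_Un_disjoint) auto
    ultimately show ?thesis by simp
  qed
  ultimately show ?thesis by (simp add: cop)
qed

text \<open>The main term satisfies the recurrence of \<open>sqcop\<close> exactly, so the deviation
  only changes sign from d - deg P to d. At the start it is small: at most 1 for 2 \<le> d < deg P,
  while for d < 2, where the count q^d - q^(d - 1) is not valid, both terms lie between 0 and
  q.\<close>

lemma sqcop_estimate:
  fixes P :: "'a::{field,finite} poly"
  assumes q: "odd CARD('a)" and P: "monic_irreducible P"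
  defines "Q \<equiv> real CARD('a)"
  shows "\<bar>real_of_int (sqcop P d) - (Q ^ d - Q ^ d / Q) * (1 - 1 / (Q ^ degree P + 1))\<bar> \<le> 2 * Q"
proof (induction d rule: less_induct)
  case (less d)
  note Pd = monic_irreducibleD[OF P]
  let ?m = "degree P"
  have Q2: "Q \<ge> 2" using card_field_gt_1[where ?'a='a] by (simp add: Q_def)
  define main where "main = (\<lambda>d. (Q ^ d - Q ^ d / Q) * (1 - 1 / (Q ^ ?m + 1)))"
  have Qm: "Q ^ ?m > 0" using Q2 by simp
  have main_nonneg: "main d \<ge> 0" and main_le: "main d \<le> Q ^ d - Q ^ d / Q" for d
  proof -
    have "Q ^ d - Q ^ d / Q \<ge> 0" using Q2 by (simp add: field_simps)
    moreover have "1 - 1 / (Q ^ ?m + 1) \<ge> 0" "1 - 1 / (Q ^ ?m + 1) \<le> 1" using Qm by (simp_all add: field_simps)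
    ultimately show "main d \<ge> 0" "main d \<le> Q ^ d - Q ^ d / Q"
      unfolding main_def by (auto simp: mult_left_le)
  qed
  have card_eq: "real_of_int (int (card (monic_squarefree d :: 'a poly set))) = Q ^ d - Q ^ d / Q" if "d \<ge> 2"
  proof -
    have "Q ^ d / Q = Q ^ (d - 1)" using that Q2 by (simp add: power_diff)
    thus ?thesis unfolding card_monic_squarefree[OF that] Q_def by simp
  qed
  show ?case
  proof (cases "d \<ge> 2")
    case d2: True
    show ?thesis
    proof (cases "?m \<le> d")
      case True
      have "main d + main (d - ?m) = Q ^ d - Q ^ d / Q"
      proof -
        have "Q ^ d = Q ^ (d - ?m) * Q ^ ?m" using True by (simp flip: power_add)
        moreover define E where "E = 1 - 1 / (Q ^ ?m + 1)"
        ultimately have "main d + main (d - ?m) = (Q ^ (d - ?m) - Q ^ (d - ?m) / Q) * ((Q ^ ?m + 1) * E)"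
          unfolding main_def E_def[symmetric] by (simp add: algebra_simps add_divide_distrib)
        also have "(Q ^ ?m + 1) * E = Q ^ ?m"
        proof -
          have "Q ^ ?m + 1 \<noteq> 0" using Qm by linarith
          thus ?thesis by (simp add: E_def field_simps)
        qed
        finally show ?thesis using \<open>Q ^ d = _\<close> by (simp add: left_diff_distrib)
      qed
      hence "real_of_int (sqcop P d) - main d = - (real_of_int (sqcop P (d - ?m)) - main (d - ?m))"
        using sqcop_recurrence[OF q P, of d] True card_eq[OF d2] by simp
      hence "\<bar>real_of_int (sqcop P d) - main d\<bar> = \<bar>real_of_int (sqcop P (d - ?m)) - main (d - ?m)\<bar>"
        by (simp only: abs_minus_cancel)
      moreover have "d - ?m < d" using Pd(5) True by simp
      ultimately show ?thesis using less[of "d - ?m"] by (simp only: main_def)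
    next
      case False
      have "real_of_int (sqcop P d) - main d = (Q ^ d - Q ^ d / Q) / (Q ^ ?m + 1)"
        using sqcop_recurrence[OF q P, of d] False card_eq[OF d2] by (simp add: main_def right_diff_distrib)
      moreover have "(Q ^ d - Q ^ d / Q) / (Q ^ ?m + 1) \<ge> 0" using Q2 Qm by (simp add: field_simps)
      moreover have "(Q ^ d - Q ^ d / Q) / (Q ^ ?m + 1) \<le> 1"
      proof -
        have "Q ^ d \<le> Q ^ ?m" using False Q2 by (intro power_increasing) auto
        moreover have "Q ^ d / Q \<ge> 0" using Q2 by simp
        ultimately show ?thesis using Qm by simp
      qed
      ultimately show ?thesis using Q2 by (simp add: main_def)
    qed
  next
    case False
    hence "Q ^ d \<le> Q ^ 1" using Q2 by (intro power_increasing) auto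
    hence Qd: "Q ^ d \<le> Q" by simp
    have "sqcop P d \<ge> 0" by (simp add: sqcop_def sum_nonneg)
    moreover have "real_of_int (sqcop P d) \<le> Q ^ d"
    proof -
      have "sqcop P d \<le> (\<Sum>R\<in>(monic_squarefree d :: 'a poly set). 1)"
        unfolding sqcop_def by (intro sum_mono) (simp add: jac_square_irreducible[OF q P])
      also have "\<dots> \<le> int CARD('a) ^ d"
        using of_nat_mono[OF card_monic_squarefree_le[of d, where ?'a='a], where ?'a=int] by simp
      finally have "real_of_int (sqcop P d) \<le> real_of_int (int CARD('a) ^ d)" by (simp only: of_int_le_iff)
      thus ?thesis by (simp add: Q_def)
    qed
    moreover have "Q ^ d / Q \<ge> 0" using Q2 by simp
    hence "main d \<le> Q ^ d" using main_le[of d] by linarith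
    ultimately have "\<bar>real_of_int (sqcop P d) - main d\<bar> \<le> 2 * Q"
      using main_nonneg[of d] Qd Q2 by linarith
    thus ?thesis by (simp only: main_def)
  qed
qed

section \<open>Averages over monic irreducible polynomials\<close>

definition primes_deg :: "nat \<Rightarrow> 'a::{field,finite} poly set" where
  "primes_deg n = {P. monic_irreducible P \<and> degree P = n}"

lemma finite_primes_deg [simp]: "finite (primes_deg n)"
  by (rule finite_subset[OF _ finite_irreds_le[of n]]) (auto simp: primes_deg_def)

lemma card_primes_deg_le:
  assumes "n > 0"
  shows "n * card (primes_deg n :: 'a::{field,finite} poly set) \<le> CARD('a) ^ n"
proof -
  have "n * card (primes_deg n :: 'a poly set) = (\<Sum>P\<in>(primes_deg n :: 'a poly set). degree P)"
    by (simp add: primes_deg_def)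
  also have "\<dots> \<le> (\<Sum>P\<in>(irreds n :: 'a poly set). degree P)"
    by (intro sum_mono2 finite_irreds[OF assms]) (auto simp: primes_deg_def irreds_def)
  finally show ?thesis using sum_degree_irreds[OF assms, where ?'a='a] by simp
qed

lemma geometric_sum_le:
  fixes x :: real
  assumes "x \<ge> 2"
  shows "(\<Sum>m=1..M. x ^ m) \<le> 2 * x ^ M"
proof (induction M)
  case (Suc M)
  have "2 * x ^ M \<le> x * x ^ M" using assms by (intro mult_right_mono) auto
  thus ?case using Suc by simp
qed simp

lemma sum_irr_le_degree_weight:
  fixes c :: "nat \<Rightarrow> real"
  assumes "\<And>m. c m \<ge> 0"
  shows "(\<Sum>P\<in>(irr_le M :: 'a::{field,finite} poly set). real (degree P) * c (degree P))
    \<le> (\<Sum>m=1..M. real CARD('a) ^ m * c m)"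
proof -
  have "(\<Sum>P\<in>(irr_le M :: 'a poly set). real (degree P) * c (degree P))
      = (\<Sum>m=1..M. \<Sum>P | P \<in> (irr_le M :: 'a poly set) \<and> degree P = m. real (degree P) * c (degree P))"
    by (rule sum.group[symmetric]) (use finite_irreds_le monic_irreducibleD(5) in \<open>auto simp: Suc_le_eq\<close>)
  also have "\<dots> \<le> (\<Sum>m=1..M. real CARD('a) ^ m * c m)"
  proof (rule sum_mono)
    fix m assume m: "m \<in> {1..M}"
    have "{P. P \<in> (irr_le M :: 'a poly set) \<and> degree P = m} = primes_deg m"
      using m by (auto simp: primes_deg_def)
    hence "(\<Sum>P | P \<in> (irr_le M :: 'a poly set) \<and> degree P = m. real (degree P) * c (degree P))
        = (\<Sum>P\<in>(primes_deg m :: 'a poly set). real m * c m)"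
      by (intro sum.cong) (auto simp: primes_deg_def)
    also have "\<dots> = real (m * card (primes_deg m :: 'a poly set)) * c m" by simp
    also have "\<dots> \<le> real (CARD('a) ^ m) * c m"
      using card_primes_deg_le[of m, where ?'a='a] m assms by (intro mult_right_mono of_nat_mono) auto
    finally show "(\<Sum>P | P \<in> (irr_le M :: 'a poly set) \<and> degree P = m. real (degree P) * c (degree P))
        \<le> real CARD('a) ^ m * c m" by simp
  qed
  finally show ?thesis .
qed

lemma sqrt_card_facts:
  defines "x \<equiv> sqrt (real CARD('a::{field,finite}))"
  shows "x > 1" "x\<^sup>2 = real CARD('a)" "real CARD('a) ^ k = x ^ (2 * k)"
proof -
  show "x > 1" using card_field_gt_1[where ?'a='a] by (simp add: x_def)
  show sq: "x\<^sup>2 = real CARD('a)" by (simp add: x_def)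
  show "real CARD('a) ^ k = x ^ (2 * k)" by (simp only: power_mult sq)
qed

text \<open>The gap in the prime polynomial theorem: q^n minus n times the number of monic
  irreducibles of degree n.\<close>

definition proper_weight :: "'a::{field,finite} itself \<Rightarrow> nat \<Rightarrow> real" where
  "proper_weight _ n = (\<Sum>P\<in>(irreds n - primes_deg n :: 'a poly set). real (degree P))"

lemma irreds_split:
  assumes "n > 0"
  shows "(\<Sum>P\<in>irreds n. f P) = (\<Sum>P\<in>primes_deg n. f P) + (\<Sum>P\<in>irreds n - primes_deg n. f P :: 'c::comm_monoid_add)"
proof -
  have "primes_deg n \<subseteq> irreds n" by (auto simp: primes_deg_def irreds_def)
  from sum.subset_diff[OF this finite_irreds[OF assms], of f] show ?thesis by (simp add: add.commute)
qed

lemma proper_weight_bounds: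
  assumes n: "n > 0"
  shows "proper_weight TYPE('a::{field,finite}) n \<ge> 0"
    and "proper_weight TYPE('a) n \<le> 2 * sqrt (real CARD('a)) ^ n"
    and "real n * real (card (primes_deg n :: 'a poly set)) = real CARD('a) ^ n - proper_weight TYPE('a) n"
proof -
  note x = sqrt_card_facts[where ?'a='a]
  show "proper_weight TYPE('a) n \<ge> 0" by (simp add: proper_weight_def sum_nonneg)
  have "proper_weight TYPE('a) n \<le> (\<Sum>P\<in>(irr_le (n div 2) :: 'a poly set). real (degree P) * 1)"
    unfolding proper_weight_def mult_1_right
  proof (rule sum_mono2[OF finite_irreds_le])
    show "irreds n - primes_deg n \<subseteq> (irr_le (n div 2) :: 'a poly set)"
    proof
      fix P :: "'a poly" assume P: "P \<in> irreds n - primes_deg n"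
      hence Pi: "monic_irreducible P" and d: "degree P dvd n" and ne: "degree P \<noteq> n"
        by (auto simp: irreds_def primes_deg_def)
      obtain k where k: "n = degree P * k" using d by (elim dvdE)
      have "k \<noteq> 0" "k \<noteq> 1" using k n ne by auto
      hence "k \<ge> 2" by linarith
      hence "degree P * 2 \<le> n" unfolding k by (rule mult_left_mono) simp
      thus "P \<in> irr_le (n div 2)" using Pi by simp
    qed
  qed simp
  also have "\<dots> \<le> (\<Sum>m=1..n div 2. real CARD('a) ^ m * 1)"
    by (rule sum_irr_le_degree_weight) simp
  also have "\<dots> \<le> 2 * real CARD('a) ^ (n div 2)"
    using geometric_sum_le[of "real CARD('a)" "n div 2"] card_field_gt_1[where ?'a='a] by simp
  also have "real CARD('a) ^ (n div 2) = sqrt (real CARD('a)) ^ (2 * (n div 2))" by (rule x(3))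
  also have "\<dots> \<le> sqrt (real CARD('a)) ^ n" using x(1) by (intro power_increasing) auto
  finally show "proper_weight TYPE('a) n \<le> 2 * sqrt (real CARD('a)) ^ n" by simp
  have "real CARD('a) ^ n = (\<Sum>P\<in>(irreds n :: 'a poly set). real (degree P))"
    unfolding sum_degree_irreds[OF n, where ?'a='a, symmetric] of_nat_power[symmetric] by simp
  also have "\<dots> = (\<Sum>P\<in>(primes_deg n :: 'a poly set). real (degree P)) + proper_weight TYPE('a) n"
    unfolding proper_weight_def by (rule irreds_split[OF n])
  also have "(\<Sum>P\<in>(primes_deg n :: 'a poly set). real (degree P)) = real n * real (card (primes_deg n :: 'a poly set))"
    by (simp add: primes_deg_def)
  finally show "real n * real (card (primes_deg n :: 'a poly set)) = real CARD('a) ^ n - proper_weight TYPE('a) n"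
    by simp
qed

text \<open>The Riemann hypothesis bounds the whole of \<open>charsum n B\<close>, in which the
  primes of degree n carry exponent 1; the other prime powers have total weight at most 2
  q^(n/2).\<close>

lemma primes_charsum:
  fixes B :: "'a::{field,finite} poly"
  assumes q: "odd CARD('a)" and n: "n > 0" and B: "lead_coeff B = 1" "\<nexists>A. B = A\<^sup>2"
  shows "\<bar>\<Sum>P\<in>primes_deg n. real n * real_of_int (jac B P)\<bar> \<le> (real (degree B) + 2) * sqrt (real CARD('a)) ^ n"
proof -
  let ?x = "sqrt (real CARD('a))"
  let ?f = "\<lambda>P. int (degree P) * jac B P ^ (n div degree P)"
  have "charsum n B = (\<Sum>P\<in>primes_deg n. ?f P) + (\<Sum>P\<in>irreds n - primes_deg n. ?f P)"
    unfolding charsum_eq[OF q n] by (rule irreds_split[OF n])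
  also have "(\<Sum>P\<in>primes_deg n. ?f P) = (\<Sum>P\<in>primes_deg n. int n * jac B P)"
    using n by (intro sum.cong) (auto simp: primes_deg_def)
  finally have "real_of_int (\<Sum>P\<in>primes_deg n. int n * jac B P)
      = real_of_int (charsum n B) - real_of_int (\<Sum>P\<in>irreds n - primes_deg n. ?f P)"
    by simp
  hence "\<bar>\<Sum>P\<in>primes_deg n. real n * real_of_int (jac B P)\<bar>
      \<le> \<bar>real_of_int (charsum n B)\<bar> + \<bar>real_of_int (\<Sum>P\<in>irreds n - primes_deg n. ?f P)\<bar>"
    by simp
  also have "\<bar>real_of_int (charsum n B)\<bar> \<le> real (degree B) * ?x ^ n" by (rule charsum_bound[OF q B n])
  also have "\<bar>real_of_int (\<Sum>P\<in>irreds n - primes_deg n. ?f P)\<bar> \<le> proper_weight TYPE('a) n"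
  proof -
    have "\<bar>real_of_int (\<Sum>P\<in>irreds n - primes_deg n. ?f P)\<bar> \<le> (\<Sum>P\<in>irreds n - primes_deg n. \<bar>real_of_int (?f P)\<bar>)"
      unfolding of_int_sum by (rule sum_abs)
    also have "\<dots> \<le> (\<Sum>P\<in>(irreds n - primes_deg n :: 'a poly set). real (degree P))"
    proof (rule sum_mono)
      fix P :: "'a poly"
      have "\<bar>jac B P ^ (n div degree P)\<bar> \<le> 1"
        unfolding power_abs using abs_jac_le_1[of B P] by (intro power_le_one) auto
      hence "\<bar>real_of_int (jac B P ^ (n div degree P))\<bar> \<le> 1" by linarith
      hence "real (degree P) * \<bar>real_of_int (jac B P ^ (n div degree P))\<bar> \<le> real (degree P) * 1"
        by (intro mult_left_mono) auto
      thus "\<bar>real_of_int (?f P)\<bar> \<le> real (degree P)" by (simp add: abs_mult)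
    qed
    finally show ?thesis by (simp add: proper_weight_def)
  qed
  also have "proper_weight TYPE('a) n \<le> 2 * ?x ^ n" by (rule proper_weight_bounds(2)[OF n])
  finally show ?thesis by (simp add: algebra_simps)
qed

definition usum :: "'a::{field,finite} itself \<Rightarrow> nat \<Rightarrow> nat \<Rightarrow> real" where
  "usum _ n j = (\<Sum>P\<in>(primes_deg n :: 'a poly set). real n * real_of_int (jsum P j))"

lemma monic_squares_eq:
  "{B \<in> monics j. \<exists>A. B = A\<^sup>2} = (if even j then (\<lambda>A. A\<^sup>2) ` monics (j div 2) else {} :: 'a::{field,finite} poly set)"
proof -
  have root: "\<exists>A'. B = A'\<^sup>2 \<and> A' \<in> monics (degree A) \<and> j = 2 * degree A" if "B \<in> monics j" "B = A\<^sup>2" for A B :: "'a poly"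
  proof -
    have A0: "A \<noteq> 0" using that monics_nonzero by fastforce
    have j: "j = 2 * degree A" using that A0 by (simp add: monics_def degree_power_eq)
    have "lead_coeff A * lead_coeff A = 1"
      using that lead_coeff_mult[of A A] by (simp add: monics_def power2_eq_square)
    hence "lead_coeff A = 1 \<or> lead_coeff A = -1" by (simp add: square_eq_1_iff)
    thus ?thesis
    proof
      assume "lead_coeff A = 1"
      thus ?thesis using that j by (intro exI[of _ A]) (simp add: monics_def)
    next
      assume "lead_coeff A = -1"
      thus ?thesis using that j by (intro exI[of _ "-A"]) (simp add: monics_def)
    qed
  qed
  show ?thesis
  proof (intro equalityI subsetI)
    fix B :: "'a poly" assume "B \<in> {B \<in> monics j. \<exists>A. B = A\<^sup>2}"
    then obtain A where "B \<in> monics j" "B = A\<^sup>2" by blast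
    from root[OF this] obtain A' where "B = A'\<^sup>2" "A' \<in> monics (degree A)" "j = 2 * degree A" by blast
    thus "B \<in> (if even j then (\<lambda>A. A\<^sup>2) ` monics (j div 2) else {})" by auto
  next
    fix B :: "'a poly" assume B: "B \<in> (if even j then (\<lambda>A. A\<^sup>2) ` monics (j div 2) else {})"
    hence ev: "even j" by (auto split: if_splits)
    with B obtain A where A: "A \<in> monics (j div 2)" "B = A\<^sup>2" by auto
    have "A * A \<in> monics (j div 2 + j div 2)" using A monics_mult by blast
    moreover have "j div 2 + j div 2 = j" using ev by auto
    ultimately have "B \<in> monics j" using A by (simp add: power2_eq_square)
    thus "B \<in> {B \<in> monics j. \<exists>A. B = A\<^sup>2}" using A by blast
  qed
qed

text \<open>After exchanging the sums, each monic B of degree j contributes the sum of n (B/P). If B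
  is a square the symbol is always 1, since deg B < deg P excludes that P divides B; for even j
  there are q^(j/2) such B. All other B obey the square root bound. The constant 4 adds up the prime
  counting errors of both kinds.\<close>

lemma usum_estimate:
  assumes q: "odd CARD('a::{field,finite})" and j: "j < n"
  shows "\<bar>usum TYPE('a) n j - (if even j then real CARD('a) ^ (j div 2 + n) else 0)\<bar>
    \<le> (real n + 4) * real CARD('a) ^ j * sqrt (real CARD('a)) ^ n"
proof -
  let ?q = "real CARD('a)" and ?x = "sqrt (real CARD('a))" and ?\<delta> = "proper_weight TYPE('a) n"
  have n: "n > 0" using j by simp
  have q1: "?q > 1" using card_field_gt_1[where ?'a='a] by simp
  have x0: "?x ^ n > 0" using q1 by simp
  define f where "f = (\<lambda>B :: 'a poly. \<Sum>P\<in>primes_deg n. real n * real_of_int (jac B P))"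
  define Sq where "Sq = {B \<in> (monics j :: 'a poly set). \<exists>A. B = A\<^sup>2}"
  have fin: "finite Sq" by (simp add: Sq_def)
  have "usum TYPE('a) n j = (\<Sum>B\<in>(monics j :: 'a poly set). f B)"
    unfolding usum_def f_def jsum_def of_int_sum sum_distrib_left by (rule sum.swap)
  also have "\<dots> = (\<Sum>B\<in>Sq. f B) + (\<Sum>B\<in>monics j - Sq. f B)"
    using sum.subset_diff[of Sq "monics j" f] by (simp add: Sq_def add.commute)
  finally have split: "usum TYPE('a) n j = (\<Sum>B\<in>Sq. f B) + (\<Sum>B\<in>monics j - Sq. f B)" .
  have fsq: "f B = ?q ^ n - ?\<delta>" if B: "B \<in> Sq" for B
  proof -
    obtain A where A: "B = A\<^sup>2" "B \<in> monics j" using B by (auto simp: Sq_def)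
    have "jac B P = 1" if P: "P \<in> primes_deg n" for P
    proof -
      have Pi: "monic_irreducible P" "degree P = n" using P by (auto simp: primes_deg_def)
      have "\<not> P dvd B"
      proof
        assume "P dvd B"
        hence "degree P \<le> degree B" using monics_nonzero[OF A(2)] by (rule dvd_imp_degree_le)
        thus False using Pi A(2) j by (simp add: monics_def)
      qed
      hence "\<not> P dvd A" unfolding A(1) power2_eq_square using dvd_mult by blast
      hence "(jac A P)\<^sup>2 = 1" using jac_square_irreducible[OF q Pi(1)] by simp
      thus ?thesis unfolding A(1) by (simp add: power2_eq_square jac_mult_num[OF q monic_irreducibleD(1)[OF Pi(1)]])
    qed
    hence "f B = real n * real (card (primes_deg n :: 'a poly set))" by (simp add: f_def)
    thus ?thesis using proper_weight_bounds(3)[OF n, where ?'a='a] by simp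
  qed
  have cSq: "real (card Sq) = (if even j then ?q ^ (j div 2) else 0)"
  proof -
    have "inj_on (\<lambda>A. A\<^sup>2) (monics (j div 2) :: 'a poly set)"
      by (rule inj_onI) (rule square_part_unique(1)[where Q = 1 and R = 1], auto simp: monics_def)
    moreover have "Sq = (if even j then (\<lambda>A. A\<^sup>2) ` monics (j div 2) else {})"
      unfolding Sq_def by (rule monic_squares_eq)
    ultimately show ?thesis
      by (cases "even j") (simp_all only: if_True if_False card_image card_monics of_nat_power card.empty of_nat_0)
  qed
  have cSq_le: "real (card Sq) \<le> ?q ^ j"
  proof -
    have "?q ^ (j div 2) \<le> ?q ^ j" using q1 by (intro power_increasing) auto
    moreover have "?q ^ j \<ge> 0" using q1 by simp
    ultimately show ?thesis unfolding cSq by (cases "even j") simp_all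
  qed
  have main: "(\<Sum>B\<in>Sq. f B) = (if even j then ?q ^ (j div 2 + n) else 0) - real (card Sq) * ?\<delta>"
  proof -
    have "(\<Sum>B\<in>Sq. f B) = real (card Sq) * ?q ^ n - real (card Sq) * ?\<delta>"
      by (simp add: fsq right_diff_distrib)
    also have "real (card Sq) * ?q ^ n = (if even j then ?q ^ (j div 2 + n) else 0)"
      unfolding cSq by (cases "even j") (simp_all add: power_add)
    finally show ?thesis .
  qed
  have err1: "\<bar>real (card Sq) * ?\<delta>\<bar> \<le> ?q ^ j * (2 * ?x ^ n)"
    unfolding abs_mult using proper_weight_bounds(1,2)[OF n, where ?'a='a] cSq_le q1
    by (intro mult_mono) auto
  have "\<bar>\<Sum>B\<in>monics j - Sq. f B\<bar> \<le> (\<Sum>B\<in>monics j - Sq. \<bar>f B\<bar>)" by (rule sum_abs)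
  also have "\<dots> \<le> (\<Sum>B\<in>monics j - Sq. (real n + 2) * ?x ^ n)"
  proof (rule sum_mono)
    fix B assume B: "B \<in> monics j - Sq"
    hence nsq: "\<nexists>A. B = A\<^sup>2" and Bm: "lead_coeff B = 1" "degree B = j" by (auto simp: Sq_def monics_def)
    have "\<bar>f B\<bar> \<le> (real (degree B) + 2) * ?x ^ n"
      unfolding f_def by (rule primes_charsum[OF q n Bm(1) nsq])
    also have "\<dots> \<le> (real n + 2) * ?x ^ n" using Bm j x0 by (intro mult_right_mono) auto
    finally show "\<bar>f B\<bar> \<le> (real n + 2) * ?x ^ n" .
  qed
  also have "\<dots> = real (card (monics j - Sq)) * ((real n + 2) * ?x ^ n)" by simp
  also have "\<dots> \<le> ?q ^ j * ((real n + 2) * ?x ^ n)"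
  proof (rule mult_right_mono)
    have "card (monics j - Sq) \<le> card (monics j :: 'a poly set)" by (intro card_mono) auto
    hence "real (card (monics j - Sq)) \<le> real (CARD('a) ^ j)" unfolding card_monics by (rule of_nat_mono)
    thus "real (card (monics j - Sq)) \<le> ?q ^ j" by simp
  qed (use x0 in simp)
  finally have err2: "\<bar>\<Sum>B\<in>monics j - Sq. f B\<bar> \<le> ?q ^ j * ((real n + 2) * ?x ^ n)" .
  have "\<bar>usum TYPE('a) n j - (if even j then ?q ^ (j div 2 + n) else 0)\<bar>
      \<le> ?q ^ j * (2 * ?x ^ n) + ?q ^ j * ((real n + 2) * ?x ^ n)"
    unfolding split main using err1 err2 by linarith
  also have "\<dots> = (real n + 4) * ?q ^ j * ?x ^ n" by (simp add: algebra_simps)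
  finally show ?thesis .
qed

definition ypart :: "'a::{field,finite} itself \<Rightarrow> nat \<Rightarrow> nat \<Rightarrow> real" where
  "ypart _ n k = (\<Sum>P\<in>(primes_deg n :: 'a poly set). real n * real_of_int (jpart P k))"

lemma ypart_eq: "ypart TYPE('a::{field,finite}) n k = (\<Sum>j<k. usum TYPE('a) n j)"
  unfolding ypart_def usum_def jpart_def of_int_sum sum_distrib_left by (rule sum.swap)

text \<open>For \<open>q = CARD('a)\<close> this is the number of monic squares of degree below
  \<open>k\<close>.\<close>

definition even_geom :: "real \<Rightarrow> nat \<Rightarrow> real" where
  "even_geom q k = (\<Sum>j<k. if even j then q ^ (j div 2) else 0)"

lemma even_geom_Suc: "even_geom q (Suc (2 * r)) = even_geom q (2 * r) + q ^ r"
  "even_geom q (2 * r + 2) = even_geom q (2 * r) + q ^ r"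
  by (simp_all add: even_geom_def)

lemma even_geom_double: "(q - 1) * even_geom q (2 * r) = q ^ r - 1"
proof (induction r)
  case (Suc r)
  have "even_geom q (2 * Suc r) = even_geom q (2 * r) + q ^ r" using even_geom_Suc(2)[of q r] by simp
  thus ?case using Suc by (simp add: algebra_simps)
qed (simp add: even_geom_def)

lemma ypart_estimate:
  assumes q: "odd CARD('a::{field,finite})" and k: "k \<le> n"
  shows "\<bar>ypart TYPE('a) n k - real CARD('a) ^ n * even_geom (real CARD('a)) k\<bar>
    \<le> (real n + 4) * real CARD('a) ^ k * sqrt (real CARD('a)) ^ n"
proof -
  let ?q = "real CARD('a)" and ?x = "sqrt (real CARD('a))"
  have q1: "?q \<ge> 2" using card_field_gt_1[where ?'a='a] by simp
  have "ypart TYPE('a) n k - ?q ^ n * even_geom ?q k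
      = (\<Sum>j<k. usum TYPE('a) n j - (if even j then ?q ^ (j div 2 + n) else 0))"
    unfolding ypart_eq even_geom_def sum_distrib_left sum_subtractf[symmetric]
    by (intro sum.cong refl) (simp add: power_add)
  hence "\<bar>ypart TYPE('a) n k - ?q ^ n * even_geom ?q k\<bar>
      \<le> (\<Sum>j<k. \<bar>usum TYPE('a) n j - (if even j then ?q ^ (j div 2 + n) else 0)\<bar>)"
    by (simp only: sum_abs)
  also have "\<dots> \<le> (\<Sum>j<k. (real n + 4) * ?q ^ j * ?x ^ n)"
    using k by (intro sum_mono usum_estimate[OF q]) auto
  also have "\<dots> = (real n + 4) * (\<Sum>j<k. ?q ^ j) * ?x ^ n"
    by (simp add: sum_distrib_left sum_distrib_right)
  also have "\<dots> \<le> (real n + 4) * ?q ^ k * ?x ^ n"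
  proof -
    have "(\<Sum>j<k. ?q ^ j) \<le> ?q ^ k" for k
    proof (induction k)
      case (Suc k)
      have "2 * ?q ^ k \<le> ?q * ?q ^ k" using q1 by (intro mult_right_mono) auto
      moreover have "(\<Sum>j<Suc k. ?q ^ j) = (\<Sum>j<k. ?q ^ j) + ?q ^ k" by simp
      ultimately show ?case using Suc by (simp only: power_Suc)
    qed simp
    thus ?thesis by (intro mult_right_mono mult_left_mono) auto
  qed
  finally show ?thesis .
qed

section \<open>The contribution of the primes of degree n\<close>

definition full_sum :: "'a::{field,finite} itself \<Rightarrow> nat \<Rightarrow> nat \<Rightarrow> real" where
  "full_sum _ n d = (\<Sum>P\<in>(primes_deg n :: 'a poly set). real n * real_of_int (sqsum P d))"

lemma full_sum_le:
  assumes n: "n > 0" and bound: "\<And>P :: 'a::{field,finite} poly. P \<in> primes_deg n \<Longrightarrow> \<bar>real_of_int (sqsum P d)\<bar> \<le> b" and b: "b \<ge> 0"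
  shows "\<bar>full_sum TYPE('a) n d\<bar> \<le> real CARD('a) ^ n * b"
proof -
  have "\<bar>full_sum TYPE('a) n d\<bar> \<le> (\<Sum>P\<in>(primes_deg n :: 'a poly set). real n * b)"
    unfolding full_sum_def using bound
    by (intro order_trans[OF sum_abs] sum_mono) (auto simp: abs_mult intro!: mult_left_mono)
  also have "\<dots> = real (n * card (primes_deg n :: 'a poly set)) * b" by simp
  also have "\<dots> \<le> real (CARD('a) ^ n) * b"
    using card_primes_deg_le[OF n, where ?'a='a] b by (intro mult_right_mono of_nat_mono) auto
  finally show ?thesis by simp
qed

lemma full_sum_small:
  assumes q: "odd CARD('a::{field,finite})" and n: "n > 0"
  shows "\<bar>full_sum TYPE('a) n d\<bar> \<le> real CARD('a) ^ (2 * n + 1)"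
proof -
  have "\<bar>full_sum TYPE('a) n d\<bar> \<le> real CARD('a) ^ n * real CARD('a) ^ (n + 1)"
  proof (rule full_sum_le[OF n])
    fix P :: "'a poly" assume "P \<in> primes_deg n"
    hence "\<bar>sqsum P d\<bar> \<le> int CARD('a) ^ (n + 1)" using abs_sqsum_le[OF q, of P d] by (auto simp: primes_deg_def)
    hence "real_of_int \<bar>sqsum P d\<bar> \<le> real_of_int (int CARD('a) ^ (n + 1))" by (simp only: of_int_le_iff)
    thus "\<bar>real_of_int (sqsum P d)\<bar> \<le> real CARD('a) ^ (n + 1)" by simp
  qed simp
  moreover have "2 * n + 1 = n + (n + 1)" by simp
  ultimately show ?thesis by (simp only: power_add)
qed

text \<open>As n \<le> 2 g, both L-coefficients in the recurrence vanish. A remainder survives only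
  if 2 n \<le> 2 g + 2, that is n = g + 1, and it is then the value 1 in degree 0.\<close>

lemma full_sum_middle:
  assumes q: "odd CARD('a::{field,finite})" and n: "g < n" "n \<le> 2 * g"
  shows "\<bar>full_sum TYPE('a) n (2 * g + 2)\<bar> \<le> real CARD('a) ^ n * 1"
proof (rule full_sum_le)
  show "n > 0" using n by simp
  fix P :: "'a poly" assume "P \<in> primes_deg n"
  hence P: "monic_irreducible P" "degree P = n" by (auto simp: primes_deg_def)
  have "sqsum P (2 * g + 2) = (if 2 * n \<le> 2 * g + 2 then sqsum P (2 * g + 2 - 2 * n) else 0)"
    using sqsum_recurrence[OF q P(1), of "2 * g + 2"] jsum_irreducible_eq_0[OF q P(1), of "2 * g + 2"]
      jsum_irreducible_eq_0[OF q P(1), of "2 * g"] P n by simp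
  also have "\<dots> \<in> {0, 1}"
  proof (cases "2 * n \<le> 2 * g + 2")
    case True
    hence "2 * g + 2 - 2 * n = 0" using n by simp
    thus ?thesis by (simp only: True if_True) (simp add: sqsum_def)
  qed simp
  finally show "\<bar>real_of_int (sqsum P (2 * g + 2))\<bar> \<le> 1" by auto
qed simp

lemma sqsum_large:
  fixes P :: "'a::{field,finite} poly"
  assumes q: "odd CARD('a)" and P: "P \<in> primes_deg n" and n: "g + 1 < n"
  shows "sqsum P (2 * g + 2) = jsum P (2 * g + 2) - int CARD('a) * jsum P (2 * g)"
  using sqsum_recurrence[OF q, of P "2 * g + 2"] P n by (auto simp: primes_deg_def)

text \<open>Here 2 g + 2 is past the degree of the L-function and 2 g is its top degree. The
  functional equation gives the top coefficient q^g for every P, so each P contributes the same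
  -q^(g + 1): the source of the exceptional term.\<close>

lemma full_sum_critical:
  assumes q: "odd CARD('a::{field,finite})" and g: "g \<ge> 1"
  shows "\<bar>full_sum TYPE('a) (2 * g + 1) (2 * g + 2) + real CARD('a) ^ (3 * g + 2)\<bar>
    \<le> 2 * sqrt (real CARD('a)) ^ (2 * g + 1) * real CARD('a) ^ (g + 1)"
proof -
  let ?n = "2 * g + 1" and ?q = "real CARD('a)"
  have n: "?n > 0" by simp
  have "sqsum P (2 * g + 2) = - (int CARD('a) ^ (g + 1))" if P: "P \<in> primes_deg ?n" for P :: "'a poly"
  proof -
    have Pi: "monic_irreducible P" "degree P = ?n" using P by (auto simp: primes_deg_def)
    have "int CARD('a) ^ g * jsum P 0 = int CARD('a) ^ 0 * jsum P (2 * g)"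
      using functional_equation_irreducible_odd[OF q Pi(1), of 0] Pi(2) by simp
    moreover have "jsum P (2 * g + 2) = 0" using jsum_irreducible_eq_0[OF q Pi(1)] Pi(2) by simp
    ultimately show ?thesis using sqsum_large[OF q P, of g] g by simp
  qed
  hence "full_sum TYPE('a) ?n (2 * g + 2) = - (real ?n * real (card (primes_deg ?n :: 'a poly set)) * ?q ^ (g + 1))"
    unfolding full_sum_def by (simp add: sum_negf)
  also have "\<dots> = - (?q ^ (3 * g + 2)) + proper_weight TYPE('a) ?n * ?q ^ (g + 1)"
  proof -
    have "?q ^ ?n * ?q ^ (g + 1) = ?q ^ (3 * g + 2)" by (simp flip: power_add)
    thus ?thesis unfolding proper_weight_bounds(3)[OF n, where ?'a='a] by (simp add: left_diff_distrib)
  qed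
  finally have "full_sum TYPE('a) ?n (2 * g + 2) + ?q ^ (3 * g + 2) = proper_weight TYPE('a) ?n * ?q ^ (g + 1)"
    by simp
  moreover have "\<bar>proper_weight TYPE('a) ?n * ?q ^ (g + 1)\<bar> \<le> 2 * sqrt ?q ^ ?n * ?q ^ (g + 1)"
    unfolding abs_mult using proper_weight_bounds(1,2)[OF n, where ?'a='a] by (intro mult_mono) auto
  ultimately show ?thesis by simp
qed

text \<open>The functional equation moves the degrees 2 g + 2 and 2 g to 2 e and 2 e + 2. The
  squares of these two degrees give equal main terms q^(2 g + 2 + e + n), which cancel in the
  difference; only the error of \<open>usum_estimate\<close> remains.\<close>

lemma full_sum_odd:
  assumes q: "odd CARD('a::{field,finite})" and n: "odd n" "n > 2 * g + 1"
  shows "real CARD('a) ^ (n div 2) * \<bar>full_sum TYPE('a) n (2 * g + 2)\<bar>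
    \<le> 2 * (real n + 4) * real CARD('a) ^ n * sqrt (real CARD('a)) ^ n"
proof -
  let ?q = "real CARD('a)" and ?x = "sqrt (real CARD('a))" and ?h = "n div 2" and ?i = "int CARD('a)"
  obtain e where e: "n = 2 * g + 3 + 2 * e"
  proof -
    have "even (n - (2 * g + 3))" using n by simp
    then obtain e where "n - (2 * g + 3) = 2 * e" by (elim evenE)
    moreover have "n \<ge> 2 * g + 3" using n by presburger
    ultimately have "n = 2 * g + 3 + 2 * e" by simp
    thus ?thesis using that by blast
  qed
  have step: "?q ^ ?h * (real n * real_of_int (sqsum P (2 * g + 2)))
      = ?q ^ (2 * g + 2) * (real n * real_of_int (jsum P (2 * e))) - ?q ^ (2 * g + 1) * (real n * real_of_int (jsum P (2 * e + 2)))"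
    if P: "P \<in> primes_deg n" for P :: "'a poly"
  proof -
    have Pi: "monic_irreducible P" "degree P = n" using P by (auto simp: primes_deg_def)
    have 1: "int CARD('a) ^ ?h * jsum P (2 * g + 2) = int CARD('a) ^ (2 * g + 2) * jsum P (2 * e)"
      using functional_equation_irreducible_odd[OF q Pi(1), of "2 * g + 2"] Pi(2) n(1) by (simp add: e)
    have 2: "int CARD('a) ^ ?h * jsum P (2 * g) = int CARD('a) ^ (2 * g) * jsum P (2 * e + 2)"
      using functional_equation_irreducible_odd[OF q Pi(1), of "2 * g"] Pi(2) n(1) by (simp add: e)
    have "int CARD('a) ^ ?h * sqsum P (2 * g + 2)
        = int CARD('a) ^ ?h * jsum P (2 * g + 2) - int CARD('a) * (int CARD('a) ^ ?h * jsum P (2 * g))"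
    proof -
      have "sqsum P (2 * g + 2) = jsum P (2 * g + 2) - ?i * jsum P (2 * g)"
        using n by (intro sqsum_large[OF q P]) simp
      thus ?thesis by (simp only: right_diff_distrib mult.left_commute)
    qed
    also have "\<dots> = int CARD('a) ^ (2 * g + 2) * jsum P (2 * e) - int CARD('a) ^ (2 * g + 1) * jsum P (2 * e + 2)"
      unfolding 1 2 by simp
    finally have "real_of_int (int CARD('a) ^ ?h * sqsum P (2 * g + 2))
        = real_of_int (int CARD('a) ^ (2 * g + 2) * jsum P (2 * e) - int CARD('a) ^ (2 * g + 1) * jsum P (2 * e + 2))"
      by (rule arg_cong)
    hence r: "?q ^ ?h * real_of_int (sqsum P (2 * g + 2))
        = ?q ^ (2 * g + 2) * real_of_int (jsum P (2 * e)) - ?q ^ (2 * g + 1) * real_of_int (jsum P (2 * e + 2))"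
      by simp
    have "?q ^ ?h * (real n * real_of_int (sqsum P (2 * g + 2))) = real n * (?q ^ ?h * real_of_int (sqsum P (2 * g + 2)))"
      by (simp only: mult_ac)
    thus ?thesis unfolding r by (simp only: right_diff_distrib mult_ac)
  qed
  have "?q ^ ?h * full_sum TYPE('a) n (2 * g + 2)
      = ?q ^ (2 * g + 2) * usum TYPE('a) n (2 * e) - ?q ^ (2 * g + 1) * usum TYPE('a) n (2 * e + 2)"
    unfolding full_sum_def usum_def sum_distrib_left sum_subtractf[symmetric]
    by (intro sum.cong refl step)
  also have "\<dots> = ?q ^ (2 * g + 2) * (usum TYPE('a) n (2 * e) - ?q ^ (e + n))
      - ?q ^ (2 * g + 1) * (usum TYPE('a) n (2 * e + 2) - ?q ^ (e + 1 + n))"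
    by (simp add: algebra_simps power_add)
  finally have eq: "?q ^ ?h * full_sum TYPE('a) n (2 * g + 2)
      = ?q ^ (2 * g + 2) * (usum TYPE('a) n (2 * e) - ?q ^ (e + n))
      - ?q ^ (2 * g + 1) * (usum TYPE('a) n (2 * e + 2) - ?q ^ (e + 1 + n))" .
  have b1: "\<bar>usum TYPE('a) n (2 * e) - ?q ^ (e + n)\<bar> \<le> (real n + 4) * ?q ^ (2 * e) * ?x ^ n"
    using usum_estimate[OF q, of "2 * e" n] by (simp add: e)
  have b2: "\<bar>usum TYPE('a) n (2 * e + 2) - ?q ^ (e + 1 + n)\<bar> \<le> (real n + 4) * ?q ^ (2 * e + 2) * ?x ^ n"
    using usum_estimate[OF q, of "2 * e + 2" n] by (simp add: e)
  have "?q ^ ?h * \<bar>full_sum TYPE('a) n (2 * g + 2)\<bar> = \<bar>?q ^ ?h * full_sum TYPE('a) n (2 * g + 2)\<bar>"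
    by (simp add: abs_mult)
  also have "\<dots> \<le> ?q ^ (2 * g + 2) * ((real n + 4) * ?q ^ (2 * e) * ?x ^ n)
      + ?q ^ (2 * g + 1) * ((real n + 4) * ?q ^ (2 * e + 2) * ?x ^ n)"
    unfolding eq using b1 b2
    by (intro order_trans[OF abs_triangle_ineq4] add_mono) (simp_all add: abs_mult mult_left_mono)
  also have "\<dots> = (real n + 4) * (?q ^ (2 * g + 2 + 2 * e) + ?q ^ (2 * g + 1 + (2 * e + 2))) * ?x ^ n"
    by (simp only: power_add distrib_left distrib_right mult_ac)
  also have "\<dots> \<le> (real n + 4) * (?q ^ n + ?q ^ n) * ?x ^ n"
    using card_field_gt_1[where ?'a='a]
    by (intro mult_right_mono mult_left_mono add_mono power_increasing) (auto simp: e)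
  finally show ?thesis by (simp add: algebra_simps)
qed

text \<open>The functional equation concerns partial sums, so each coefficient becomes a difference
  of two of them and four terms arise. Their main terms, counts of squares, combine to (q - 1) ((q -
  1) G (2 r) - q^r) up to a power of q, and the geometric sum reduces the bracket to -1. What is
  left later cancels the contribution of the even prime powers.\<close>

lemma full_sum_even:
  assumes q: "odd CARD('a::{field,finite})" and n: "even n" "n > 2 * g + 1"
  shows "\<bar>real CARD('a) ^ (n div 2) * full_sum TYPE('a) n (2 * g + 2) + real CARD('a) ^ (n + 2 * g + 1) * (real CARD('a) - 1)\<bar>
    \<le> 4 * (real n + 4) * real CARD('a) ^ (n + 1) * sqrt (real CARD('a)) ^ n"
proof -
  let ?q = "real CARD('a)" and ?x = "sqrt (real CARD('a))" and ?h = "n div 2" and ?i = "int CARD('a)"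
  obtain r where r: "n = 2 * g + 2 + 2 * r"
  proof -
    have "even (n - (2 * g + 2))" using n by simp
    then obtain r where "n - (2 * g + 2) = 2 * r" by (elim evenE)
    hence "n = 2 * g + 2 + 2 * r" using n by simp
    thus ?thesis using that by blast
  qed
  have step: "?q ^ ?h * (real n * real_of_int (sqsum P (2 * g + 2)))
      = ?q ^ (2 * g + 3) * (real n * real_of_int (jpart P (2 * r - 1))) - ?q ^ (2 * g + 2) * (real n * real_of_int (jpart P (2 * r)))
      - ?q ^ (2 * g + 2) * (real n * real_of_int (jpart P (2 * r + 1))) + ?q ^ (2 * g + 1) * (real n * real_of_int (jpart P (2 * r + 2)))"
    if P: "P \<in> primes_deg n" for P :: "'a poly"
  proof -
    have Pi: "monic_irreducible P" "degree P = n" using P by (auto simp: primes_deg_def)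
    have fe: "?i ^ ?h * jpart P k = ?i ^ k * jpart P (n - k)" if "k \<le> n" for k
      using functional_equation_irreducible_even[OF q Pi(1), of k] Pi(2) n(1) that by simp
    \<comment> \<open>For r = 0 the degree 2 g + 3 exceeds n, out of reach of the functional
      equation; then both sides are 0, with \<open>2 * r - 1\<close> truncated to 0.\<close>
    have 1: "?i ^ ?h * jpart P (2 * g + 3) = ?i ^ (2 * g + 3) * jpart P (2 * r - 1)"
    proof (cases "r = 0")
      case True
      have "jpart P (2 * g + 3) = jpart P n"
        using jsum_irreducible_eq_0[OF q Pi(1), of n] Pi(2) True by (simp add: jpart_def r numeral_eq_Suc)
      moreover have "?i ^ ?h * jpart P n = 0" using fe[of n] by (simp add: jpart_def)
      ultimately show ?thesis using True by (simp add: jpart_def)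
    next
      case False
      hence "n - (2 * g + 3) = 2 * r - 1" "2 * g + 3 \<le> n" by (auto simp: r)
      thus ?thesis using fe[of "2 * g + 3"] by simp
    qed
    have 2: "?i ^ ?h * jpart P (2 * g + 2) = ?i ^ (2 * g + 2) * jpart P (2 * r)"
      using fe[of "2 * g + 2"] by (simp add: r)
    have 3: "?i ^ ?h * jpart P (2 * g + 1) = ?i ^ (2 * g + 1) * jpart P (2 * r + 1)"
      using fe[of "2 * g + 1"] by (simp add: r)
    have 4: "?i ^ ?h * jpart P (2 * g) = ?i ^ (2 * g) * jpart P (2 * r + 2)"
      using fe[of "2 * g"] by (simp add: r)
    have j: "jsum P k = jpart P (Suc k) - jpart P k" for k by (simp add: jpart_def)
    have "?i ^ ?h * sqsum P (2 * g + 2)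
        = ?i ^ ?h * jpart P (2 * g + 3) - ?i ^ ?h * jpart P (2 * g + 2)
        - ?i * (?i ^ ?h * jpart P (2 * g + 1)) + ?i * (?i ^ ?h * jpart P (2 * g))"
    proof -
      have "sqsum P (2 * g + 2) = jsum P (2 * g + 2) - ?i * jsum P (2 * g)"
        using n by (intro sqsum_large[OF q P]) simp
      moreover have "Suc (2 * g + 2) = 2 * g + 3" "Suc (2 * g) = 2 * g + 1" by simp_all
      ultimately have "sqsum P (2 * g + 2)
          = jpart P (2 * g + 3) - jpart P (2 * g + 2) - ?i * jpart P (2 * g + 1) + ?i * jpart P (2 * g)"
        using j[of "2 * g + 2"] j[of "2 * g"] by (simp only: right_diff_distrib)
      thus ?thesis by (simp only: right_diff_distrib distrib_left mult.left_commute)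
    qed
    also have "\<dots> = ?i ^ (2 * g + 3) * jpart P (2 * r - 1) - ?i ^ (2 * g + 2) * jpart P (2 * r)
        - ?i ^ (2 * g + 2) * jpart P (2 * r + 1) + ?i ^ (2 * g + 1) * jpart P (2 * r + 2)"
      unfolding 1 2 3 4 by simp
    finally have "real_of_int (?i ^ ?h * sqsum P (2 * g + 2)) = real_of_int (?i ^ (2 * g + 3) * jpart P (2 * r - 1)
        - ?i ^ (2 * g + 2) * jpart P (2 * r) - ?i ^ (2 * g + 2) * jpart P (2 * r + 1) + ?i ^ (2 * g + 1) * jpart P (2 * r + 2))"
      by (rule arg_cong)
    hence e: "?q ^ ?h * real_of_int (sqsum P (2 * g + 2)) = ?q ^ (2 * g + 3) * real_of_int (jpart P (2 * r - 1))
        - ?q ^ (2 * g + 2) * real_of_int (jpart P (2 * r)) - ?q ^ (2 * g + 2) * real_of_int (jpart P (2 * r + 1))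
        + ?q ^ (2 * g + 1) * real_of_int (jpart P (2 * r + 2))"
      by (simp only: of_int_add of_int_diff of_int_mult of_int_power of_int_of_nat_eq)
    have "?q ^ ?h * (real n * real_of_int (sqsum P (2 * g + 2))) = real n * (?q ^ ?h * real_of_int (sqsum P (2 * g + 2)))"
      by (simp only: mult_ac)
    thus ?thesis unfolding e by (simp only: right_diff_distrib distrib_left mult_ac)
  qed
  define Y where "Y = ypart TYPE('a) n"
  define G where "G = even_geom ?q"
  have "?q ^ ?h * full_sum TYPE('a) n (2 * g + 2)
      = ?q ^ (2 * g + 3) * Y (2 * r - 1) - ?q ^ (2 * g + 2) * Y (2 * r)
        - ?q ^ (2 * g + 2) * Y (2 * r + 1) + ?q ^ (2 * g + 1) * Y (2 * r + 2)"
    unfolding full_sum_def Y_def ypart_def sum_distrib_left sum_subtractf[symmetric] sum.distrib[symmetric]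
    by (intro sum.cong refl step)
  moreover have "?q ^ (2 * g + 3) * (?q ^ n * G (2 * r - 1)) - ?q ^ (2 * g + 2) * (?q ^ n * G (2 * r))
        - ?q ^ (2 * g + 2) * (?q ^ n * G (2 * r + 1)) + ?q ^ (2 * g + 1) * (?q ^ n * G (2 * r + 2))
      = - (?q ^ (n + 2 * g + 1) * (?q - 1))"
  proof -
    \<comment> \<open>No square has the odd degree 2 r - 1; for r = 0 the truncated index is again
      0.\<close>
    have G1: "G (2 * r - 1) = G (2 * r)"
    proof (cases r)
      case (Suc s)
      thus ?thesis using even_geom_Suc(1)[of ?q s] even_geom_Suc(2)[of ?q s] by (simp add: G_def)
    qed simp
    have G2: "G (2 * r + 1) = G (2 * r) + ?q ^ r" "G (2 * r + 2) = G (2 * r) + ?q ^ r"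
      using even_geom_Suc[of ?q r] by (simp_all add: G_def)
    have G3: "(?q - 1) * G (2 * r) = ?q ^ r - 1" by (simp add: G_def even_geom_double)
    have pw: "?q ^ (2 * g + 3) = ?q ^ (2 * g + 1) * ?q * ?q" "?q ^ (2 * g + 2) = ?q ^ (2 * g + 1) * ?q"
      "?q ^ (n + 2 * g + 1) = ?q ^ n * ?q ^ (2 * g + 1)"
      by (simp_all add: power_add numeral_3_eq_3)
    have "?q ^ (2 * g + 3) * (?q ^ n * G (2 * r - 1)) - ?q ^ (2 * g + 2) * (?q ^ n * G (2 * r))
        - ?q ^ (2 * g + 2) * (?q ^ n * G (2 * r + 1)) + ?q ^ (2 * g + 1) * (?q ^ n * G (2 * r + 2))
        = ?q ^ n * ?q ^ (2 * g + 1) * (?q - 1) * ((?q - 1) * G (2 * r) - ?q ^ r)"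
      unfolding G1 G2 pw by (simp add: algebra_simps)
    also have "\<dots> = - (?q ^ (n + 2 * g + 1) * (?q - 1))" unfolding G3 pw by simp
    finally show ?thesis .
  qed
  ultimately have eq: "?q ^ ?h * full_sum TYPE('a) n (2 * g + 2) + ?q ^ (n + 2 * g + 1) * (?q - 1)
      = ?q ^ (2 * g + 3) * (Y (2 * r - 1) - ?q ^ n * G (2 * r - 1)) - ?q ^ (2 * g + 2) * (Y (2 * r) - ?q ^ n * G (2 * r))
        - ?q ^ (2 * g + 2) * (Y (2 * r + 1) - ?q ^ n * G (2 * r + 1)) + ?q ^ (2 * g + 1) * (Y (2 * r + 2) - ?q ^ n * G (2 * r + 2))"
    by (simp add: right_diff_distrib)
  have q1: "?q > 1" using card_field_gt_1[where ?'a='a] by simp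
  have b: "\<bar>?q ^ a * (Y k - ?q ^ n * G k)\<bar> \<le> (real n + 4) * ?q ^ (n + 1) * ?x ^ n"
    if k: "k \<le> n" "a + k \<le> n + 1" for a k
  proof -
    have "\<bar>?q ^ a * (Y k - ?q ^ n * G k)\<bar> \<le> ?q ^ a * ((real n + 4) * ?q ^ k * ?x ^ n)"
      unfolding abs_mult using ypart_estimate[OF q k(1)] by (simp add: Y_def G_def mult_left_mono)
    also have "\<dots> = (real n + 4) * ?q ^ (a + k) * ?x ^ n" by (simp only: power_add mult_ac)
    also have "\<dots> \<le> (real n + 4) * ?q ^ (n + 1) * ?x ^ n"
      using k q1 by (intro mult_right_mono mult_left_mono power_increasing) auto
    finally show ?thesis .
  qed
  have tri: "\<bar>t1 - t2 - t3 + t4\<bar> \<le> 4 * B"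
    if "\<bar>t1\<bar> \<le> B" "\<bar>t2\<bar> \<le> B" "\<bar>t3\<bar> \<le> B" "\<bar>t4\<bar> \<le> B" for t1 t2 t3 t4 B :: real
    using that by linarith
  have "2 * r - 1 \<le> n" "2 * g + 3 + (2 * r - 1) \<le> n + 1"
    "2 * r \<le> n" "2 * g + 2 + 2 * r \<le> n + 1" "2 * r + 1 \<le> n" "2 * g + 2 + (2 * r + 1) \<le> n + 1"
    "2 * r + 2 \<le> n" "2 * g + 1 + (2 * r + 2) \<le> n + 1" by (auto simp: r)
  from tri[OF b[OF this(1,2)] b[OF this(3,4)] b[OF this(5,6)] b[OF this(7,8)]]
  show ?thesis unfolding eq by (simp only: mult.assoc)
qed

section \<open>The mean trace\<close>

lemma powr_half_nat: "(q::real) > 0 \<Longrightarrow> q powr (real n / 2) = sqrt q ^ n"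
  by (simp add: powr_half_sqrt[symmetric] powr_realpow[symmetric] powr_powr)

definition even_sum :: "'a::{field,finite} itself \<Rightarrow> nat \<Rightarrow> nat \<Rightarrow> real" where
  "even_sum _ n d = (\<Sum>P | P \<in> (irreds n :: 'a poly set) \<and> even (n div degree P).
     real (degree P) * real_of_int (sqcop P d))"

text \<open>Odd exponents n / deg P other than 1, hence at least 3.\<close>

definition odd_sum :: "'a::{field,finite} itself \<Rightarrow> nat \<Rightarrow> nat \<Rightarrow> real" where
  "odd_sum _ n d = (\<Sum>P | P \<in> (irreds n :: 'a poly set) - primes_deg n \<and> odd (n div degree P).
     real (degree P) * real_of_int (sqsum P d))"

text \<open>Only the parity of the exponent n / deg P matters for a power of the symbol: even
  exponents test coprimality, odd ones return the symbol.\<close>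

lemma sum_charsum:
  assumes q: "odd CARD('a::{field,finite})" and n: "n > 0"
  shows "(\<Sum>Q\<in>(monic_squarefree d :: 'a poly set). real_of_int (charsum n Q))
    = even_sum TYPE('a) n d + full_sum TYPE('a) n d + odd_sum TYPE('a) n d"
proof -
  let ?I = "irreds n :: 'a poly set"
  let ?e = "\<lambda>P :: 'a poly. even (n div degree P)"
  have pw: "jac Q P ^ k = (if even k then (jac Q P)\<^sup>2 else jac Q P)" if "k > 0" for Q P :: "'a poly" and k
    using jac_cases[of Q P] that by auto
  have "(\<Sum>Q\<in>(monic_squarefree d :: 'a poly set). charsum n Q)
      = (\<Sum>P\<in>?I. \<Sum>Q\<in>monic_squarefree d. int (degree P) * jac Q P ^ (n div degree P))"
    unfolding charsum_eq[OF q n] by (rule sum.swap)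
  also have "\<dots> = (\<Sum>P\<in>?I. if ?e P then int (degree P) * sqcop P d else int (degree P) * sqsum P d)"
  proof (rule sum.cong[OF refl])
    fix P :: "'a poly" assume P: "P \<in> ?I"
    hence "degree P dvd n" "degree P > 0" by (auto simp: irreds_def monic_irreducibleD(5))
    hence "n div degree P > 0" using n by (simp add: dvd_imp_le div_greater_zero_iff)
    from pw[OF this] show "(\<Sum>Q\<in>monic_squarefree d. int (degree P) * jac Q P ^ (n div degree P))
        = (if ?e P then int (degree P) * sqcop P d else int (degree P) * sqsum P d)"
      by (simp add: sqcop_def sqsum_def sum_distrib_left)
  qed
  also have "\<dots> = (\<Sum>P\<in>{P \<in> ?I. ?e P}. int (degree P) * sqcop P d) + (\<Sum>P\<in>{P \<in> ?I. \<not> ?e P}. int (degree P) * sqsum P d)"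
    using n by (subst sum.If_cases) (simp_all add: Int_def Collect_neg_eq[symmetric])
  finally have "real_of_int (\<Sum>Q\<in>(monic_squarefree d :: 'a poly set). charsum n Q)
      = real_of_int ((\<Sum>P\<in>{P \<in> ?I. ?e P}. int (degree P) * sqcop P d) + (\<Sum>P\<in>{P \<in> ?I. \<not> ?e P}. int (degree P) * sqsum P d))"
    by (rule arg_cong)
  hence 1: "(\<Sum>Q\<in>(monic_squarefree d :: 'a poly set). real_of_int (charsum n Q))
      = even_sum TYPE('a) n d + (\<Sum>P\<in>{P \<in> ?I. \<not> ?e P}. real (degree P) * real_of_int (sqsum P d))"
    by (simp add: even_sum_def)
  have "{P \<in> ?I. \<not> ?e P} = primes_deg n \<union> {P. P \<in> ?I - primes_deg n \<and> odd (n div degree P)}"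
    using n by (auto simp: irreds_def primes_deg_def)
  hence "(\<Sum>P\<in>{P \<in> ?I. \<not> ?e P}. real (degree P) * real_of_int (sqsum P d))
      = (\<Sum>P\<in>(primes_deg n :: 'a poly set). real (degree P) * real_of_int (sqsum P d)) + odd_sum TYPE('a) n d"
    unfolding odd_sum_def using n by (simp only:) (intro sum.union_disjoint, auto)
  also have "(\<Sum>P\<in>(primes_deg n :: 'a poly set). real (degree P) * real_of_int (sqsum P d)) = full_sum TYPE('a) n d"
    unfolding full_sum_def by (intro sum.cong) (auto simp: primes_deg_def)
  finally show ?thesis using 1 by simp
qed

lemma even_sum_odd:
  assumes "odd n"
  shows "even_sum TYPE('a::{field,finite}) n d = 0"
proof -
  have "odd (n div degree P)" if "P \<in> irreds n" for P :: "'a poly"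
  proof -
    have "n div degree P * degree P = n" using that by (simp add: irreds_def)
    thus ?thesis using assms by (metis even_mult_iff)
  qed
  hence "{P :: 'a poly. P \<in> irreds n \<and> even (n div degree P)} = {}" by blast
  thus ?thesis by (simp only: even_sum_def sum.empty)
qed

text \<open>The exponent n / deg P is even exactly if deg P divides n/2. The degrees of these
  \<open>P\<close> add up to q^(n/2), the main term, and the density 1/(|P| + 1) of the multiples of
  \<open>P\<close> among squarefree polynomials gives the correction.\<close>

lemma even_sum_estimate:
  assumes q: "odd CARD('a::{field,finite})" and n: "even n" "n > 0"
  defines "Q \<equiv> real CARD('a)"
  shows "\<bar>even_sum TYPE('a) n d - (Q ^ d - Q ^ d / Q) *
      (Q ^ (n div 2) - (\<Sum>P\<in>(irreds (n div 2) :: 'a poly set). real (degree P) / (Q ^ degree P + 1)))\<bar> \<le> 2 * Q * Q ^ (n div 2)"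
proof -
  let ?J = "irreds (n div 2) :: 'a poly set" and ?F = "Q ^ d - Q ^ d / Q"
  have n2: "n div 2 > 0" using n by auto
  have set_eq: "{P. P \<in> irreds n \<and> even (n div degree P)} = ?J"
  proof (intro equalityI subsetI)
    fix P :: "'a poly" assume "P \<in> {P. P \<in> irreds n \<and> even (n div degree P)}"
    hence P: "monic_irreducible P" "degree P dvd n" "even (n div degree P)" by (auto simp: irreds_def)
    obtain k where k: "n = degree P * k" using P(2) by (elim dvdE)
    have "even k" using P(3) monic_irreducibleD(5)[OF P(1)] by (simp add: k)
    then obtain j where "k = 2 * j" by (elim evenE)
    hence "n div 2 = degree P * j" by (simp add: k)
    thus "P \<in> ?J" using P(1) by (simp add: irreds_def)
  next
    fix P :: "'a poly" assume "P \<in> ?J"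
    hence P: "monic_irreducible P" "degree P dvd n div 2" by (auto simp: irreds_def)
    obtain j where "n div 2 = degree P * j" using P(2) by (elim dvdE)
    hence "n = degree P * (2 * j)" using n(1) by (metis dvd_mult_div_cancel mult.left_commute)
    thus "P \<in> {P. P \<in> irreds n \<and> even (n div degree P)}"
      using P(1) monic_irreducibleD(5)[OF P(1)] by (simp add: irreds_def)
  qed
  have deg: "(\<Sum>P\<in>?J. real (degree P)) = Q ^ (n div 2)"
    using arg_cong[OF sum_degree_irreds[OF n2, where ?'a='a], of real] by (simp add: Q_def)
  have step: "a * b - c * (a - a / s) = a * (b - c * (1 - 1 / s))" for a b c s :: real
    by (simp add: algebra_simps)
  have "even_sum TYPE('a) n d - ?F * (Q ^ (n div 2) - (\<Sum>P\<in>?J. real (degree P) / (Q ^ degree P + 1)))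
      = (\<Sum>P\<in>?J. real (degree P) * (real_of_int (sqcop P d) - ?F * (1 - 1 / (Q ^ degree P + 1))))"
    unfolding even_sum_def set_eq deg[symmetric]
    by (simp only: sum_distrib_left sum_subtractf[symmetric]) (intro sum.cong refl step)
  also have "\<bar>\<dots>\<bar> \<le> (\<Sum>P\<in>?J. real (degree P) * (2 * Q))"
  proof (rule order_trans[OF sum_abs], rule sum_mono)
    fix P :: "'a poly" assume "P \<in> ?J"
    hence "monic_irreducible P" by (simp add: irreds_def)
    from sqcop_estimate[OF q this, of d]
    show "\<bar>real (degree P) * (real_of_int (sqcop P d) - ?F * (1 - 1 / (Q ^ degree P + 1)))\<bar> \<le> real (degree P) * (2 * Q)"
      by (simp add: abs_mult Q_def mult_left_mono)
  qed
  also have "\<dots> = 2 * Q * Q ^ (n div 2)" by (simp add: sum_distrib_right[symmetric] deg)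
  finally show ?thesis .
qed

text \<open>The exponent is at least 3, so deg P is at most n/3. With at most q^m / m primes of
  degree m and symbol sums of size at most q^(m + 1), the total is dominated by a geometric sum with
  ratio q^2.\<close>

lemma odd_sum_bound:
  assumes q: "odd CARD('a::{field,finite})" and n: "n > 0"
  shows "\<bar>odd_sum TYPE('a) n d\<bar> \<le> 2 * sqrt (real CARD('a)) ^ (4 * (n div 3) + 2)"
proof -
  let ?q = "real CARD('a)" and ?M = "n div 3"
  let ?S = "{P. P \<in> (irreds n :: 'a poly set) - primes_deg n \<and> odd (n div degree P)}"
  have q2: "?q\<^sup>2 \<ge> 2"
    using power_mono[of 2 ?q 2] card_field_gt_1[where ?'a='a] by simp
  have "\<bar>odd_sum TYPE('a) n d\<bar> \<le> (\<Sum>P\<in>?S. real (degree P) * ?q ^ (degree P + 1))"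
    unfolding odd_sum_def
  proof (rule order_trans[OF sum_abs], rule sum_mono)
    fix P :: "'a poly" assume "P \<in> ?S"
    hence "monic_irreducible P" by (simp add: irreds_def)
    from abs_sqsum_le[OF q this, of d]
    have "real_of_int \<bar>sqsum P d\<bar> \<le> real_of_int (int CARD('a) ^ (degree P + 1))"
      by (simp only: of_int_le_iff)
    thus "\<bar>real (degree P) * real_of_int (sqsum P d)\<bar> \<le> real (degree P) * ?q ^ (degree P + 1)"
      by (simp add: abs_mult mult_left_mono)
  qed
  also have "\<dots> \<le> (\<Sum>P\<in>(irr_le ?M :: 'a poly set). real (degree P) * ?q ^ (degree P + 1))"
  proof (rule sum_mono2[OF finite_irreds_le])
    show "?S \<subseteq> irr_le ?M"
    proof
      fix P :: "'a poly" assume "P \<in> ?S"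
      hence P: "monic_irreducible P" "degree P dvd n" "degree P \<noteq> n" "odd (n div degree P)"
        by (auto simp: irreds_def primes_deg_def)
      obtain k where k: "n = degree P * k" using P(2) by (elim dvdE)
      have "odd k" using P(4) monic_irreducibleD(5)[OF P(1)] by (simp add: k)
      moreover have "k \<noteq> 1" using P(3) k by auto
      ultimately have "k \<ge> 3" by presburger
      hence "degree P * 3 \<le> n" unfolding k by (rule mult_left_mono) simp
      thus "P \<in> irr_le ?M" using P(1) by simp
    qed
  qed simp
  also have "\<dots> \<le> (\<Sum>m=1..?M. ?q ^ m * ?q ^ (m + 1))"
    by (rule sum_irr_le_degree_weight) simp
  also have "\<dots> = ?q * (\<Sum>m=1..?M. (?q\<^sup>2) ^ m)"
    unfolding sum_distrib_left by (intro sum.cong refl) (simp add: power2_eq_square power_mult_distrib)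
  also have "\<dots> \<le> ?q * (2 * (?q\<^sup>2) ^ ?M)"
    by (intro mult_left_mono geometric_sum_le[OF q2]) simp
  also have "\<dots> = 2 * ?q ^ (2 * ?M + 1)" by (simp add: power_mult)
  also have "\<dots> = 2 * sqrt ?q ^ (4 * ?M + 2)" unfolding sqrt_card_facts(3) by simp
  finally show ?thesis .
qed

text \<open>Division by q^(n div 2) in a form common to both parities; powers of x = sqrt q keep the
  exponents integral.\<close>

lemma full_sum_large:
  assumes q: "odd CARD('a::{field,finite})" and n: "n > 2 * g + 1"
  defines "x \<equiv> sqrt (real CARD('a))"
  shows "\<bar>full_sum TYPE('a) n (2 * g + 2) + eta n * (x ^ (4 * g + 2) * (x\<^sup>2 - 1) * x ^ n)\<bar>
    \<le> 4 * (real n + 4) * x ^ (2 * n + 2)"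
proof (cases "even n")
  case True
  note x = sqrt_card_facts[where ?'a='a, folded x_def]
  let ?B = "full_sum TYPE('a) n (2 * g + 2)"
  have "x ^ n * \<bar>?B + eta n * (x ^ (4 * g + 2) * (x\<^sup>2 - 1) * x ^ n)\<bar>
      = \<bar>x ^ n * (?B + eta n * (x ^ (4 * g + 2) * (x\<^sup>2 - 1) * x ^ n))\<bar>"
    using x(1) by (simp add: abs_mult)
  also have "x ^ n * (?B + eta n * (x ^ (4 * g + 2) * (x\<^sup>2 - 1) * x ^ n))
      = real CARD('a) ^ (n div 2) * ?B + real CARD('a) ^ (n + 2 * g + 1) * (real CARD('a) - 1)"
  proof -
    have "real CARD('a) ^ (n div 2) = x ^ n" using True by (simp add: x(3))
    moreover have "real CARD('a) ^ (n + 2 * g + 1) = x ^ n * (x ^ (4 * g + 2) * x ^ n)"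
      unfolding x(3) by (simp add: power_add[symmetric])
    ultimately show ?thesis using True by (simp add: x(2)[symmetric] eta_def algebra_simps)
  qed
  also have "\<bar>\<dots>\<bar> \<le> 4 * (real n + 4) * real CARD('a) ^ (n + 1) * x ^ n"
    unfolding x_def by (rule full_sum_even[OF q True n])
  also have "\<dots> = x ^ n * (4 * (real n + 4) * x ^ (2 * n + 2))" unfolding x(3) by simp
  finally show ?thesis using x(1) by simp
next
  case False
  note x = sqrt_card_facts[where ?'a='a, folded x_def]
  let ?B = "full_sum TYPE('a) n (2 * g + 2)"
  have pw: "real CARD('a) ^ (n div 2) * x = x ^ n"
    using False unfolding x(3) by (metis odd_two_times_div_two_succ power_add power_one_right)
  have "x ^ n * \<bar>?B\<bar> = x * (real CARD('a) ^ (n div 2) * \<bar>?B\<bar>)" unfolding pw[symmetric] by simp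
  also have "\<dots> \<le> x * (2 * (real n + 4) * real CARD('a) ^ n * x ^ n)"
    unfolding x_def by (intro mult_left_mono full_sum_odd[OF q False n]) simp
  also have "\<dots> = x ^ n * (2 * (real n + 4) * x ^ (2 * n + 1))" unfolding x(3) by simp
  finally have "\<bar>?B\<bar> \<le> 2 * (real n + 4) * x ^ (2 * n + 1)" using x(1) by simp
  also have "\<dots> \<le> 4 * (real n + 4) * x ^ (2 * n + 2)"
    using x(1) by (intro mult_mono power_increasing) auto
  finally show ?thesis using False by (simp add: eta_def)
qed

text \<open>F is the number of squarefree polynomials of degree 2 g + 2. The discrepancy of the even
  powers always goes into E1; the prime and odd power parts go into E1 up to n = 2 g + 1 and into E2
  beyond.\<close>

lemma sums_decomposition:
  assumes q: "odd CARD('a::{field,finite})" and g: "g \<ge> 1" and n: "n \<ge> 1"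
  defines "x \<equiv> sqrt (real CARD('a))"
  defines "F \<equiv> x ^ (4 * g + 2) * (x\<^sup>2 - 1)"
  defines "S \<equiv> (\<Sum>P\<in>(irreds (n div 2) :: 'a poly set). real (degree P) / (real CARD('a) ^ degree P + 1))"
  shows "\<exists>E1 E2. \<bar>E1\<bar> \<le> 50 * (real g / x ^ g) \<and> \<bar>E2\<bar> \<le> 50 * (real n * (x ^ n / x ^ (4 * g))) \<and>
    - (1 / x ^ n) - (even_sum TYPE('a) n (2 * g + 2) + full_sum TYPE('a) n (2 * g + 2) + odd_sum TYPE('a) n (2 * g + 2)) / (F * x ^ n)
    = - (1 / x ^ n) + eta n * (1 / x ^ n) * S + E1
      + (if n < 2 * g + 1 then - eta n else if n = 2 * g + 1 then x / (x\<^sup>2 - 1) else E2)"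
proof -
  note x = sqrt_card_facts[where ?'a='a, folded x_def]
  have x2: "x\<^sup>2 - 1 \<ge> 1" using card_field_gt_1[where ?'a='a] by (simp add: x(2))
  define A where "A = even_sum TYPE('a) n (2 * g + 2)"
  define B where "B = full_sum TYPE('a) n (2 * g + 2)"
  define R where "R = odd_sum TYPE('a) n (2 * g + 2)"
  define N where "N = F * x ^ n"
  define e where "e = A - eta n * (F * (x ^ n - S))"
  have Fpos: "F > 0" and Npos: "N > 0" using x(1) x2 by (simp_all add: F_def N_def)
  have Nge: "N \<ge> x ^ (4 * g + 2 + n)"
    unfolding N_def F_def power_add[of x "4 * g + 2" n] using x(1) x2
    using mult_left_mono[OF x2, of "x ^ (4 * g + 2)"] by (intro mult_right_mono) simp_all
  have nb: "\<bar>t\<bar> / N \<le> c * x ^ k / x ^ (4 * g + 2 + n)" if "\<bar>t\<bar> \<le> c * x ^ k" for t c k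
    using that Nge x(1) by (intro frac_le) auto
  define W where "W = real g / x ^ g"
  \<comment> \<open>An error of size x^k is absorbed by g / x^g as soon as k + g \<le> 4 g + 2 + n,
    because N \<ge> x^(4 g + 2 + n).\<close>
  have bA: "\<bar>t / N\<bar> \<le> c * W" if "\<bar>t\<bar> \<le> c * x ^ k" "c \<ge> 0" "k + g \<le> 4 * g + 2 + n" for t c k
  proof -
    have "c * x ^ k * x ^ g \<le> c * x ^ (4 * g + 2 + n)"
      unfolding mult.assoc power_add[symmetric] using that x(1) by (intro mult_left_mono power_increasing) auto
    hence "c * x ^ k / x ^ (4 * g + 2 + n) \<le> c * (1 / x ^ g)" using x(1) by (simp add: field_simps)
    also have "\<dots> \<le> c * W" unfolding W_def using that(2) g x(1) by (intro mult_left_mono divide_right_mono) auto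
    finally have "c * x ^ k / x ^ (4 * g + 2 + n) \<le> c * W" .
    thus ?thesis using nb[OF that(1)] Npos by simp
  qed
  \<comment> \<open>The analogue for errors measured against x^n / x^(4 g), with room for k up to 2
    n + 2.\<close>
  have bB: "\<bar>t / N\<bar> \<le> c * (x ^ n / x ^ (4 * g))" if "\<bar>t\<bar> \<le> c * x ^ k" "c \<ge> 0" "k \<le> 2 * n + 2" for t c k
  proof -
    have "c * x ^ k * x ^ (4 * g) \<le> c * (x ^ n * x ^ (4 * g + 2 + n))"
      unfolding mult.assoc power_add[symmetric] using that x(1) by (intro mult_left_mono power_increasing) auto
    hence "c * x ^ k / x ^ (4 * g + 2 + n) \<le> c * (x ^ n / x ^ (4 * g))" using x(1) by (simp add: field_simps)
    thus ?thesis using nb[OF that(1)] Npos by simp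
  qed
  have e: "\<bar>e\<bar> \<le> 2 * x ^ (n + 2)"
  proof (cases "even n")
    case True
    have "real CARD('a) ^ (n div 2) = x ^ n" using True by (simp add: x(3))
    moreover have "real CARD('a) ^ (2 * g + 2) - real CARD('a) ^ (2 * g + 2) / real CARD('a) = F"
    proof -
      have "real CARD('a) ^ (2 * g + 2) - real CARD('a) ^ (2 * g + 2) / real CARD('a)
          = real CARD('a) ^ (2 * g + 1) * (real CARD('a) - 1)" by (simp add: algebra_simps)
      thus ?thesis unfolding x(3) by (simp add: F_def x(2))
    qed
    ultimately show ?thesis using even_sum_estimate[OF q True, of "2 * g + 2"] n True
      by (simp add: e_def A_def S_def eta_def x(2)[symmetric] power2_eq_square mult_ac)
  next
    case False
    thus ?thesis using x(1) by (simp add: e_def A_def even_sum_odd eta_def)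
  qed
  have R: "\<bar>R\<bar> \<le> 2 * x ^ (4 * (n div 3) + 2)"
    unfolding R_def x_def using n by (intro odd_sum_bound[OF q]) simp
  have eA: "\<bar>e / N\<bar> \<le> 2 * W" by (rule bA[OF e]) auto
  have W: "W \<ge> 0" using x(1) by (simp add: W_def)
  have main: "- (1 / x ^ n) - (A + B + R) / N
      = - (1 / x ^ n) + eta n * (1 / x ^ n) * S - eta n - e / N - B / N - R / N"
  proof -
    have "A / N = eta n * (F * (x ^ n - S)) / N + e / N" by (simp add: e_def diff_divide_distrib)
    also have "eta n * (F * (x ^ n - S)) / N = eta n - eta n * (1 / x ^ n) * S"
      using Fpos x(1) by (simp add: N_def field_simps)
    finally show ?thesis by (simp add: add_divide_distrib)
  qed
  consider "n < 2 * g + 1" | "n = 2 * g + 1" | "n > 2 * g + 1" by linarith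
  thus ?thesis unfolding A_def[symmetric] B_def[symmetric] R_def[symmetric] N_def[symmetric] W_def[symmetric] main
  proof cases
    case 1
    have RA: "\<bar>R / N\<bar> \<le> 2 * W" by (rule bA[OF R]) (use 1 in auto)
    have BA: "\<bar>B / N\<bar> \<le> 1 * W"
    proof (cases "n \<le> g")
      case True
      \<comment> \<open>The case split at g is exactly where this crude bound meets 4 n + 2 + g
        \<le> 4 g + 2 + n.\<close>
      have "\<bar>B\<bar> \<le> 1 * x ^ (2 * (2 * n + 1))"
        using full_sum_small[OF q, of n "2 * g + 2"] n by (simp add: B_def x(3) del: power_Suc mult_Suc_right)
      thus ?thesis by (rule bA) (use True in auto)
    next
      case False
      have "\<bar>B\<bar> \<le> 1 * x ^ (2 * n)"
        using full_sum_middle[OF q, of g n] 1 False by (simp add: B_def x(3))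
      thus ?thesis by (rule bA) (use 1 in auto)
    qed
    have "\<bar>- (e / N) - B / N - R / N\<bar> \<le> 50 * W" using eA RA BA W by linarith
    moreover have "0 \<le> x" using x(1) by simp
    ultimately show "\<exists>E1 E2. \<bar>E1\<bar> \<le> 50 * W \<and> \<bar>E2\<bar> \<le> 50 * (real n * (x ^ n / x ^ (4 * g))) \<and>
      - (1 / x ^ n) + eta n * (1 / x ^ n) * S - eta n - e / N - B / N - R / N
      = - (1 / x ^ n) + eta n * (1 / x ^ n) * S + E1
        + (if n < 2 * g + 1 then - eta n else if n = 2 * g + 1 then x / (x\<^sup>2 - 1) else E2)"
      using 1 by (intro exI[of _ "- (e / N) - B / N - R / N"] exI[of _ 0]) simp
  next
    case 2
    have RA: "\<bar>R / N\<bar> \<le> 2 * W" by (rule bA[OF R]) (use 2 in auto)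
    define B' where "B' = B + x ^ (6 * g + 4)"
    have "\<bar>B'\<bar> \<le> 2 * x ^ (4 * g + 3)"
    proof -
      have ex: "2 * (3 * g + 2) = 6 * g + 4" "2 * g + 1 + 2 * (g + 1) = 4 * g + 3" by simp_all
      have "real CARD('a) ^ (3 * g + 2) = x ^ (6 * g + 4)" unfolding x(3) ex ..
      moreover have "2 * x ^ (2 * g + 1) * real CARD('a) ^ (g + 1) = 2 * x ^ (4 * g + 3)"
        unfolding x(3) mult.assoc power_add[symmetric] ex ..
      ultimately show ?thesis using full_sum_critical[OF q g] 2 by (simp add: B_def B'_def x_def)
    qed
    hence BA: "\<bar>B' / N\<bar> \<le> 2 * W" by (rule bA) (use 2 in auto)
    have "B / N = B' / N - x ^ (6 * g + 4) / N" by (simp add: B'_def add_divide_distrib)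
    also have "x ^ (6 * g + 4) / N = x / (x\<^sup>2 - 1)"
    proof -
      have "4 * g + 2 + (2 * g + 1) = 6 * g + 3" by simp
      hence "x ^ (6 * g + 3) = x ^ (4 * g + 2) * x ^ (2 * g + 1)" by (simp only: power_add[symmetric])
      hence "N = x ^ (6 * g + 3) * (x\<^sup>2 - 1)" unfolding N_def F_def 2 by (simp only: mult_ac)
      moreover have "x ^ (6 * g + 4) = x ^ (6 * g + 3) * x"
        using power_add[of x "6 * g + 3" 1] by (simp add: add.commute del: power_Suc)
      ultimately show ?thesis using x(1) by simp
    qed
    finally have BN: "B / N = B' / N - x / (x\<^sup>2 - 1)" .
    have "\<bar>- (e / N) - B' / N - R / N\<bar> \<le> 50 * W" using eA RA BA W by linarith
    moreover have "0 \<le> x" using x(1) by simp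
    ultimately show "\<exists>E1 E2. \<bar>E1\<bar> \<le> 50 * W \<and> \<bar>E2\<bar> \<le> 50 * (real n * (x ^ n / x ^ (4 * g))) \<and>
      - (1 / x ^ n) + eta n * (1 / x ^ n) * S - eta n - e / N - B / N - R / N
      = - (1 / x ^ n) + eta n * (1 / x ^ n) * S + E1
        + (if n < 2 * g + 1 then - eta n else if n = 2 * g + 1 then x / (x\<^sup>2 - 1) else E2)"
      using 2 by (intro exI[of _ "- (e / N) - B' / N - R / N"] exI[of _ 0]) (simp add: BN eta_def)
  next
    case 3
    define T where "T = x ^ n / x ^ (4 * g)"
    have T: "T \<ge> 0" using x(1) by (simp add: T_def)
    have RB: "\<bar>R / N\<bar> \<le> 2 * T" unfolding T_def by (rule bB[OF R]) auto
    define B' where "B' = B + eta n * N"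
    have "\<bar>B'\<bar> \<le> 4 * (real n + 4) * x ^ (2 * n + 2)"
      unfolding B'_def B_def N_def F_def x_def by (rule full_sum_large[OF q 3])
    hence BB: "\<bar>B' / N\<bar> \<le> 4 * (real n + 4) * T" unfolding T_def by (rule bB) auto
    have BN: "B / N = B' / N - eta n" using Npos by (simp add: B'_def add_divide_distrib)
    have "\<bar>- (B' / N) - R / N\<bar> \<le> (4 * (real n + 4) + 2) * T"
      unfolding distrib_right using RB BB unfolding mult.assoc by linarith
    \<comment> \<open>For n \<ge> 1, 4 n + 18 is at most 22 n, so the common constant 50 is
      ample.\<close>
    also have "\<dots> \<le> 50 * real n * T" using n T by (intro mult_right_mono) auto
    finally have "\<bar>- (B' / N) - R / N\<bar> \<le> 50 * (real n * (x ^ n / x ^ (4 * g)))" by (simp add: T_def)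
    moreover have "\<bar>- (e / N)\<bar> \<le> 50 * W" using eA W by linarith
    ultimately show "\<exists>E1 E2. \<bar>E1\<bar> \<le> 50 * W \<and> \<bar>E2\<bar> \<le> 50 * (real n * (x ^ n / x ^ (4 * g))) \<and>
      - (1 / x ^ n) + eta n * (1 / x ^ n) * S - eta n - e / N - B / N - R / N
      = - (1 / x ^ n) + eta n * (1 / x ^ n) * S + E1
        + (if n < 2 * g + 1 then - eta n else if n = 2 * g + 1 then x / (x\<^sup>2 - 1) else E2)"
      using 3 by (intro exI[of _ "- (e / N)"] exI[of _ "- (B' / N) - R / N"]) (simp add: BN)
  qed
qed

lemma mean_trace:
  assumes q: "odd CARD('a::{field,finite})" and n: "n \<ge> 1"
  defines "x \<equiv> sqrt (real CARD('a))"
  shows "mean_monic_squarefree (2 * g + 2) (\<lambda>Q :: 'a poly. mat_trace (Frob_class Q ^\<^sub>m n))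
    = of_real (- (1 / x ^ n) - (even_sum TYPE('a) n (2 * g + 2) + full_sum TYPE('a) n (2 * g + 2)
        + odd_sum TYPE('a) n (2 * g + 2)) / (x ^ (4 * g + 2) * (x\<^sup>2 - 1) * x ^ n))"
proof -
  note x = sqrt_card_facts[where ?'a='a, folded x_def]
  let ?M = "monic_squarefree (2 * g + 2) :: 'a poly set"
  define F where "F = x ^ (4 * g + 2) * (x\<^sup>2 - 1)"
  have "real (card ?M) = real CARD('a) ^ (2 * g + 2) - real CARD('a) ^ (2 * g + 1)"
    using arg_cong[OF card_monic_squarefree[of "2 * g + 2", where ?'a='a], of real_of_int] by simp
  also have "\<dots> = F" unfolding x(3) by (simp add: F_def algebra_simps power_add[symmetric])
  finally have cardF: "real (card ?M) = F" .
  have Fpos: "F > 0" using x(1) by (simp add: F_def)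
  define T where "T = even_sum TYPE('a) n (2 * g + 2) + full_sum TYPE('a) n (2 * g + 2) + odd_sum TYPE('a) n (2 * g + 2)"
  have "(\<Sum>Q\<in>?M. mat_trace (Frob_class Q ^\<^sub>m n))
      = of_real (\<Sum>Q\<in>?M. - (1 + real_of_int (charsum n Q)) / x ^ n)"
    unfolding of_real_sum
  proof (rule sum.cong[OF refl])
    fix Q assume "Q \<in> ?M"
    from trace_Frob_class[OF q this, of n] n
    show "mat_trace (Frob_class Q ^\<^sub>m n) = of_real (- (1 + real_of_int (charsum n Q)) / x ^ n)"
      by (simp add: x_def)
  qed
  also have "(\<Sum>Q\<in>?M. - (1 + real_of_int (charsum n Q)) / x ^ n)
      = - (\<Sum>Q\<in>?M. 1 + real_of_int (charsum n Q)) / x ^ n"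
    by (simp only: sum_divide_distrib[symmetric] sum_negf)
  also have "(\<Sum>Q\<in>?M. 1 + real_of_int (charsum n Q)) = F + T"
    using sum_charsum[OF q, of n "2 * g + 2"] n by (simp only: sum.distrib sum_constant cardF T_def mult_1_right)
  finally have "mean_monic_squarefree (2 * g + 2) (\<lambda>Q :: 'a poly. mat_trace (Frob_class Q ^\<^sub>m n))
      = of_real (- (F + T) / x ^ n) / of_real (real (card ?M))"
    by (simp add: mean_monic_squarefree_def)
  also have "\<dots> = of_real (- (F + T) / x ^ n / F)" by (simp only: of_real_divide cardF)
  also have "- (F + T) / x ^ n / F = - (1 / x ^ n) - T / (F * x ^ n)"
    using Fpos x(1) by (simp add: field_simps)
  finally show ?thesis by (simp only: T_def F_def)
qed

theorem theorem8p1: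
  fixes q :: real
  assumes "q = real CARD('a::{field,finite})" and "odd CARD('a)"
  shows "\<exists>C::real. \<forall>g::nat. \<forall>n::nat. g \<ge> 1 \<longrightarrow> n \<ge> 1 \<longrightarrow>
    (\<exists>E1 E2 :: complex.
       cmod E1 \<le> C * (real g * q powr (- (real g / 2))) \<and>
       cmod E2 \<le> C * (real n * q powr (real n / 2 - 2 * real g)) \<and>
       mean_monic_squarefree (2 * g + 2)
           (\<lambda>Q :: 'a poly. mat_trace (Frob_class Q ^\<^sub>m n)) =
         - of_real (1 / q powr (real n / 2))
         + of_real (eta n * (1 / q powr (real n / 2)) *
             (\<Sum>P | monic_irreducible (P :: 'a poly) \<and> Polynomial.degree P dvd n div 2.
                real (Polynomial.degree P) / (poly_abs P + 1)))
         + E1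
         + (if n < 2 * g + 1 then - of_real (eta n)
            else if n = 2 * g + 1 then of_real (q powr (1 / 2) / (q - 1))
            else E2))"
proof (intro exI[of _ "50::real"] allI impI)
  \<comment> \<open>The constant is that of \<open>sums_decomposition\<close> and is the same for
    every q.\<close>
  fix g n :: nat assume g: "g \<ge> 1" and n: "n \<ge> 1"
  define x where "x = sqrt q"
  note x = sqrt_card_facts[where ?'a='a, folded assms(1) x_def]
  have qpos: "q > 0" using zero_less_card_finite[where ?'a='a] by (simp add: assms(1))
  have p1: "q powr (real n / 2) = x ^ n" using powr_half_nat[OF qpos] by (simp add: x_def)
  have p2: "q powr (- (real g / 2)) = 1 / x ^ g"
    using powr_half_nat[OF qpos, of g] by (simp add: x_def powr_minus inverse_eq_divide)
  have "q powr (2 * real g) = x ^ (4 * g)"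
    using powr_half_nat[OF qpos, of "4 * g"] by (simp add: x_def)
  hence p3: "q powr (real n / 2 - 2 * real g) = x ^ n / x ^ (4 * g)" by (simp add: powr_diff p1)
  have p4: "q powr (1 / 2) = x" using qpos by (simp add: x_def powr_half_sqrt)
  \<comment> \<open>For n = 1 the index set is infinite, since \<open>n div 2 = 0\<close> is
    divisible by every degree, and the sum is 0 by convention; for all odd n the factor
    \<open>eta n\<close> is 0.\<close>
  define S where "S = (\<Sum>P\<in>(irreds (n div 2) :: 'a poly set). real (degree P) / (q ^ degree P + 1))"
  have S: "(\<Sum>P | monic_irreducible (P :: 'a poly) \<and> degree P dvd n div 2. real (degree P) / (poly_abs P + 1)) = S"
    by (simp add: S_def irreds_def poly_abs_def assms(1))
  obtain E1 E2 where E: "\<bar>E1\<bar> \<le> 50 * (real g / x ^ g)" "\<bar>E2\<bar> \<le> 50 * (real n * (x ^ n / x ^ (4 * g)))"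
    "- (1 / x ^ n) - (even_sum TYPE('a) n (2 * g + 2) + full_sum TYPE('a) n (2 * g + 2) + odd_sum TYPE('a) n (2 * g + 2))
      / (x ^ (4 * g + 2) * (x\<^sup>2 - 1) * x ^ n)
    = - (1 / x ^ n) + eta n * (1 / x ^ n) * S + E1
      + (if n < 2 * g + 1 then - eta n else if n = 2 * g + 1 then x / (x\<^sup>2 - 1) else E2)"
    using sums_decomposition[OF assms(2) g n, folded assms(1), folded x_def, folded S_def] by blast
  have "mean_monic_squarefree (2 * g + 2) (\<lambda>Q :: 'a poly. mat_trace (Frob_class Q ^\<^sub>m n))
      = of_real (- (1 / x ^ n) + eta n * (1 / x ^ n) * S + E1
      + (if n < 2 * g + 1 then - eta n else if n = 2 * g + 1 then x / (x\<^sup>2 - 1) else E2))"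
    using mean_trace[OF assms(2) n, of g, folded assms(1), folded x_def] unfolding E(3) .
  also have "\<dots> = - of_real (1 / x ^ n) + of_real (eta n * (1 / x ^ n) * S) + complex_of_real E1
      + (if n < 2 * g + 1 then - of_real (eta n) else if n = 2 * g + 1 then of_real (x / (q - 1)) else complex_of_real E2)"
    using x(2) by (simp add: if_distrib)
  finally show "\<exists>E1 E2 :: complex.
       cmod E1 \<le> 50 * (real g * q powr (- (real g / 2))) \<and>
       cmod E2 \<le> 50 * (real n * q powr (real n / 2 - 2 * real g)) \<and>
       mean_monic_squarefree (2 * g + 2)
           (\<lambda>Q :: 'a poly. mat_trace (Frob_class Q ^\<^sub>m n)) =
         - of_real (1 / q powr (real n / 2))
         + of_real (eta n * (1 / q powr (real n / 2)) *
             (\<Sum>P | monic_irreducible (P :: 'a poly) \<and> Polynomial.degree P dvd n div 2.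
                real (Polynomial.degree P) / (poly_abs P + 1)))
         + E1
         + (if n < 2 * g + 1 then - of_real (eta n)
            else if n = 2 * g + 1 then of_real (q powr (1 / 2) / (q - 1))
            else E2)"
    unfolding S p1 p2 p3 p4 using E(1,2)
    by (intro exI[of _ "complex_of_real E1"] exI[of _ "complex_of_real E2"] conjI) simp_all
qed

end
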